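(* Let $B_{11}$ be the Betsy Ross matroid. Then $\underline{\mathrm{Gr}}_{B_{11}}(\mathbb{T}_q)=\underline{\mathrm{Gr}}^{\mathrm w}_{B_{11}}(\mathbb{T}_q)$ for all $0\le q\le\infty$. Moreover, the map $h\colon\mathbb{R}\to\underline{\mathrm{Gr}}_{B_{11}}(\mathbb{T}_\infty)$, $t\mapsto$ class of $(S\mapsto|\det A_S|^t)$, is a homeomorphism, and for every $0\le q<\infty$ it maps the closed interval $[-q,q]$ onto $\underline{\mathrm{Gr}}_{B_{11}}(\mathbb{T}_q)$. Under $h$, the space $\underline{\mathrm{L}}_{B_{11}}$ corresponds to $[-2,2]$ and $\underline{\mathrm{S}}_{B_{11}}$ corresponds to $\{-2,2\}$.
   Context: Let $\varphi=\frac{1+\sqrt5}{2}$ and let $A$ be the real $3\times11$ matrix with columns $(0,1,0)$, $(0,0,1)$, $(1,1,1)$, $(1,\varphi+1,\varphi)$, $(1,\varphi,1/\varphi)$, $(1,\varphi+1,0)$, $(1,0,\varphi)$, $(1,\varphi,\varphi)$, $(1,\varphi,1)$, $(1,\varphi+1,1)$, $(1,0,0)$ (columns $1,\dots,11$). The Betsy Ross matroid $B_{11}$ is the rank-3 matroid on $[11]$ whose bases are the 3-sets $S$ with $\det A_S\ne0$, $A_S$ the $3\times3$ submatrix with columns in $S$. Identify bases with indicator vectors in $\Delta^3_{11}$. For $0<q<\infty$, a list $b_1,\dots,b_k\ge0$ is $q$-null if $b_i^{1/q}\le\sum_{j\ne i}b_j^{1/q}$ for all $i$; $0$-null if all zero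 or maximum attained at least twice; $\infty$-null if all zero, maximum attained twice, or at least three nonzero. For a matroid $M$ of rank $d$ and $q\in[0,\infty]$, a strong $\mathbb{T}_q$-representation is $\rho\colon\Delta^d_n\to\mathbb{R}_{\ge0}$ with support the bases such that for every Plücker relation indexed by $S_1\in\binom{[n]}{d-1}$, $S_2\in\binom{[n]}{d+1}$, the list $\rho(S_1\cup\{x\})\rho(S_2\setminus\{x\})$, $x\in S_2\setminus S_1$, is $q$-null; a weak one requires this only when $|S_2\setminus S_1|=3$ (three-term relations). $\underline{\mathrm{Gr}}_M(\mathbb{T}_q)$ ($\underline{\mathrm{Gr}}^{\mathrm w}_M(\mathbb{T}_q)$) is the set of strong (weak) representations in $\mathbb{R}^{\mathcal B(M)}_{>0}$ modulo $\mathbb{R}^n_{>0}$ acting by $(t.\rho)(S)=\prod_{i\in S}t_i\rho(S)$, with quotient topology. A multiaffine polynomial $f=\sum_Sc_Sx^S$ is identified with $\rho_f(S)=c_S$. $\mathrm{L}_M$ is the set of Lorentzian polynomials (nonzero, nonnegative coefficients, M-convex support, and every $\partial^\alpha f$ of degree 2 has Hessian with at most one positive eigenvalue) with support the bases of $M$; $\mathrm{S}_M$ the set of stable polynomials (nonvanishing on the product of open upper half-planes) with nonnegative coefficients and support the bases. $\underline{\mathrm{L}}_M,\underline{\mathrm{S}}_M$ are their quotients by $\mathbb{R}^n_{>0}$ rescaling variables, regarded inside $\underline{\mathrm{Gr}}_M(\mathbb{T}_\infty)$ via $f\mapsto\rho_f$. *)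

theory Defs
  imports
    "HOL-Analysis.Function_Topology"
    "HOL-Library.Extended_Nonnegative_Real"
    "HOL-Library.Poly_Mapping"
    "Jordan_Normal_Form.DL_Submatrix"
    "Jordan_Normal_Form.Char_Poly"
begin

text \<open>
  The ground set with \<open>n\<close> elements is \<open>{..<n}\<close>, so labels, matrix columns and variables are
  numbered from \<open>0\<close>. A matroid of rank \<open>d\<close> is given by \<open>n\<close>, \<open>d\<close> and its set \<open>B\<close> of bases.
  A function on the \<open>d\<close>-subsets of \<open>{..<n}\<close> is rendered as a function on all sets of naturals
  that vanishes elsewhere. On functions that vanish outside the finite set \<open>B\<close>, the topology
  of type \<open>nat set \<Rightarrow> real\<close> is that of \<open>\<real>\<^sup>B\<close>.
\<close>


section \<open>Representations over the tropical hyperfields\<close>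

text \<open>The list \<open>b\<^sub>1, \<dots>, b\<^sub>k\<close> is a family \<open>b\<close> indexed by a finite set \<open>I\<close>.\<close>

definition tropical_null :: "ennreal \<Rightarrow> 'i set \<Rightarrow> ('i \<Rightarrow> real) \<Rightarrow> bool" where
  "tropical_null q I b \<longleftrightarrow>
    (let max_twice = (\<exists>i\<in>I. \<exists>j\<in>I. i \<noteq> j \<and> b i = b j \<and> (\<forall>k\<in>I. b k \<le> b i))
     in if q = 0 then (\<forall>i\<in>I. b i = 0) \<or> max_twice
        else if q = \<infinity> then (\<forall>i\<in>I. b i = 0) \<or> max_twice \<or> 3 \<le> card {i\<in>I. b i \<noteq> 0}
        else (\<forall>i\<in>I. b i powr (1 / enn2real q) \<le> (\<Sum>j\<in>I - {i}. b j powr (1 / enn2real q))))"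

definition plucker_null ::
    "ennreal \<Rightarrow> (nat set \<Rightarrow> real) \<Rightarrow> nat set \<Rightarrow> nat set \<Rightarrow> bool" where
  "plucker_null q \<rho> S1 S2 \<longleftrightarrow>
    tropical_null q (S2 - S1) (\<lambda>x. \<rho> (insert x S1) * \<rho> (S2 - {x}))"

definition strong_reps :: "nat \<Rightarrow> nat \<Rightarrow> nat set set \<Rightarrow> ennreal \<Rightarrow> (nat set \<Rightarrow> real) set" where
  "strong_reps n d B q =
    {\<rho>. (\<forall>S. 0 \<le> \<rho> S) \<and> {S. \<rho> S \<noteq> 0} = B \<and>
        (\<forall>S1 S2. S1 \<subseteq> {..<n} \<and> S2 \<subseteq> {..<n} \<and> card S1 + 1 = d \<and> card S2 = d + 1
           \<longrightarrow> plucker_null q \<rho> S1 S2)}"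

definition weak_reps :: "nat \<Rightarrow> nat \<Rightarrow> nat set set \<Rightarrow> ennreal \<Rightarrow> (nat set \<Rightarrow> real) set" where
  "weak_reps n d B q =
    {\<rho>. (\<forall>S. 0 \<le> \<rho> S) \<and> {S. \<rho> S \<noteq> 0} = B \<and>
        (\<forall>S1 S2. S1 \<subseteq> {..<n} \<and> S2 \<subseteq> {..<n} \<and> card S1 + 1 = d \<and> card S2 = d + 1
           \<and> card (S2 - S1) = 3 \<longrightarrow> plucker_null q \<rho> S1 S2)}"


section \<open>Quotients by rescaling\<close>

definition rescaling_class :: "nat \<Rightarrow> (nat set \<Rightarrow> real) \<Rightarrow> (nat set \<Rightarrow> real) set" where
  "rescaling_class n \<rho> = {(\<lambda>S. (\<Prod>i\<in>S. t i) * \<rho> S) | t :: nat \<Rightarrow> real. \<forall>i<n. 0 < t i}"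

definition rescaling_quotient ::
    "nat \<Rightarrow> (nat set \<Rightarrow> real) set \<Rightarrow> (nat set \<Rightarrow> real) set topology" where
  "rescaling_quotient n X =
    topology (\<lambda>U. U \<subseteq> rescaling_class n ` X \<and>
                  openin (top_of_set X) {\<rho>\<in>X. rescaling_class n \<rho> \<in> U})"

lemma openin_rescaling_quotient:
  "openin (rescaling_quotient n X) U \<longleftrightarrow>
    U \<subseteq> rescaling_class n ` X \<and> openin (top_of_set X) {\<rho>\<in>X. rescaling_class n \<rho> \<in> U}"
proof -
  let ?P = "\<lambda>U. {\<rho>\<in>X. rescaling_class n \<rho> \<in> U}"
  have "istopology (\<lambda>U. U \<subseteq> rescaling_class n ` X \<and> openin (top_of_set X) (?P U))"
    unfolding istopology_def
  proof (rule conjI; (intro allI impI))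
    fix S T
    assume S: "S \<subseteq> rescaling_class n ` X \<and> openin (top_of_set X) (?P S)"
      and T: "T \<subseteq> rescaling_class n ` X \<and> openin (top_of_set X) (?P T)"
    have "?P (S \<inter> T) = ?P S \<inter> ?P T" by blast
    with openin_Int[OF conjunct2[OF S] conjunct2[OF T]]
    have "openin (top_of_set X) (?P (S \<inter> T))" by (simp only:)
    with S show "S \<inter> T \<subseteq> rescaling_class n ` X \<and> openin (top_of_set X) (?P (S \<inter> T))"
      by blast
  next
    fix \<K>
    assume *: "\<forall>K\<in>\<K>. K \<subseteq> rescaling_class n ` X \<and> openin (top_of_set X) (?P K)"
    have "openin (top_of_set X) (\<Union>K\<in>\<K>. ?P K)"
      by (rule openin_Union) (use * in blast)
    moreover have "?P (\<Union>\<K>) = (\<Union>K\<in>\<K>. ?P K)" by blast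
    ultimately have "openin (top_of_set X) (?P (\<Union>\<K>))" by (simp only:)
    with * show "\<Union>\<K> \<subseteq> rescaling_class n ` X \<and> openin (top_of_set X) (?P (\<Union>\<K>))"
      by blast
  qed
  then show ?thesis
    by (simp only: rescaling_quotient_def topology_inverse')
qed

lemma topspace_rescaling_quotient: "topspace (rescaling_quotient n X) = rescaling_class n ` X"
proof
  show "topspace (rescaling_quotient n X) \<subseteq> rescaling_class n ` X"
    using openin_topspace[of "rescaling_quotient n X"]
    by (simp only: openin_rescaling_quotient)
  have "{\<rho>\<in>X. rescaling_class n \<rho> \<in> rescaling_class n ` X} = X" by blast
  then have "openin (rescaling_quotient n X) (rescaling_class n ` X)"
    unfolding openin_rescaling_quotient by simp
  then show "rescaling_class n ` X \<subseteq> topspace (rescaling_quotient n X)"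
    by (rule openin_subset)
qed

lemma quotient_map_rescaling_class:
  "quotient_map (top_of_set X) (rescaling_quotient n X) (rescaling_class n)"
  unfolding quotient_map_def topspace_rescaling_quotient openin_rescaling_quotient by simp


definition Gr_strong ::
    "nat \<Rightarrow> nat \<Rightarrow> nat set set \<Rightarrow> ennreal \<Rightarrow> (nat set \<Rightarrow> real) set topology" where
  "Gr_strong n d B q = rescaling_quotient n (strong_reps n d B q)"

definition Gr_weak ::
    "nat \<Rightarrow> nat \<Rightarrow> nat set set \<Rightarrow> ennreal \<Rightarrow> (nat set \<Rightarrow> real) set topology" where
  "Gr_weak n d B q = rescaling_quotient n (weak_reps n d B q)"


section \<open>Lorentzian and stable polynomials\<close>

text \<open>
  Real polynomials are finitely supported maps from exponent vectors to coefficients; the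
  support is \<^const>\<open>Poly_Mapping.keys\<close>.
\<close>

type_synonym real_mpoly = "(nat \<Rightarrow>\<^sub>0 nat) \<Rightarrow>\<^sub>0 real"

definition in_variables :: "nat \<Rightarrow> real_mpoly \<Rightarrow> bool" where
  "in_variables n f \<longleftrightarrow> (\<forall>\<alpha> \<in> Poly_Mapping.keys f. Poly_Mapping.keys \<alpha> \<subseteq> {..<n})"

definition mpoly_degree :: "real_mpoly \<Rightarrow> nat" where
  "mpoly_degree f =
    Max (insert 0 ((\<lambda>\<alpha>. \<Sum>i\<in>Poly_Mapping.keys \<alpha>. Poly_Mapping.lookup \<alpha> i) ` Poly_Mapping.keys f))"

definition mpoly_eval :: "real_mpoly \<Rightarrow> (nat \<Rightarrow> complex) \<Rightarrow> complex" where
  "mpoly_eval f z =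
    (\<Sum>\<alpha>\<in>Poly_Mapping.keys f. of_real (Poly_Mapping.lookup f \<alpha>) *
       (\<Prod>i\<in>Poly_Mapping.keys \<alpha>. z i ^ Poly_Mapping.lookup \<alpha> i))"

text \<open>
  Subtraction of exponent vectors is truncated; where it truncates, the coefficient
  \<open>\<alpha>\<^sub>i\<close> is \<open>0\<close>.
\<close>

definition mpoly_deriv :: "nat \<Rightarrow> real_mpoly \<Rightarrow> real_mpoly" where
  "mpoly_deriv i f =
    (\<Sum>\<alpha>\<in>Poly_Mapping.keys f.
       Poly_Mapping.single (\<alpha> - Poly_Mapping.single i 1)
         (of_nat (Poly_Mapping.lookup \<alpha> i) * Poly_Mapping.lookup f \<alpha>))"

definition mpoly_derivs :: "nat \<Rightarrow> (nat \<Rightarrow> nat) \<Rightarrow> real_mpoly \<Rightarrow> real_mpoly" where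
  "mpoly_derivs n \<alpha> f = fold (\<lambda>i. mpoly_deriv i ^^ \<alpha> i) [0..<n] f"

text \<open>The Hessian at the origin; for a quadratic polynomial the Hessian is constant.\<close>

definition hessian :: "nat \<Rightarrow> real_mpoly \<Rightarrow> real mat" where
  "hessian n f = mat n n (\<lambda>(i, j). Poly_Mapping.lookup (mpoly_deriv i (mpoly_deriv j f)) 0)"

text \<open>Eigenvalues are counted with multiplicity, as roots of the characteristic polynomial.\<close>

definition at_most_one_positive_eigenvalue :: "real mat \<Rightarrow> bool" where
  "at_most_one_positive_eigenvalue H \<longleftrightarrow> size {#x \<in># proots (char_poly H). 0 < x#} \<le> 1"

definition M_convex :: "(nat \<Rightarrow>\<^sub>0 nat) set \<Rightarrow> bool" where
  "M_convex J \<longleftrightarrow>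
    (\<forall>\<alpha>\<in>J. \<forall>\<beta>\<in>J. \<forall>i. Poly_Mapping.lookup \<beta> i < Poly_Mapping.lookup \<alpha> i \<longrightarrow>
       (\<exists>j. Poly_Mapping.lookup \<alpha> j < Poly_Mapping.lookup \<beta> j \<and>
            \<alpha> - Poly_Mapping.single i 1 + Poly_Mapping.single j 1 \<in> J))"

definition lorentzian :: "nat \<Rightarrow> real_mpoly \<Rightarrow> bool" where
  "lorentzian n f \<longleftrightarrow>
    in_variables n f \<and> f \<noteq> 0 \<and> (\<forall>\<alpha>. 0 \<le> Poly_Mapping.lookup f \<alpha>) \<and>
    M_convex (Poly_Mapping.keys f) \<and>
    (\<forall>\<alpha>. mpoly_degree (mpoly_derivs n \<alpha> f) = 2 \<longrightarrow>
       at_most_one_positive_eigenvalue (hessian n (mpoly_derivs n \<alpha> f)))"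

definition stable :: "nat \<Rightarrow> real_mpoly \<Rightarrow> bool" where
  "stable n f \<longleftrightarrow>
    in_variables n f \<and> (\<forall>z. (\<forall>i<n. 0 < Im (z i)) \<longrightarrow> mpoly_eval f z \<noteq> 0)"

definition indicator_vector :: "nat set \<Rightarrow> nat \<Rightarrow>\<^sub>0 nat" where
  "indicator_vector S = (\<Sum>i\<in>S. Poly_Mapping.single i 1)"

definition coeff_function :: "real_mpoly \<Rightarrow> nat set \<Rightarrow> real" where
  "coeff_function f S = (if finite S then Poly_Mapping.lookup f (indicator_vector S) else 0)"

definition lorentzian_polys :: "nat \<Rightarrow> nat set set \<Rightarrow> real_mpoly set" where
  "lorentzian_polys n B = {f. lorentzian n f \<and> Poly_Mapping.keys f = indicator_vector ` B}"

definition stable_polys :: "nat \<Rightarrow> nat set set \<Rightarrow> real_mpoly set" where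
  "stable_polys n B =
    {f. stable n f \<and> (\<forall>\<alpha>. 0 \<le> Poly_Mapping.lookup f \<alpha>) \<and>
        Poly_Mapping.keys f = indicator_vector ` B}"

text \<open>
  Rescaling variables multiplies the coefficient of \<open>x\<^sup>S\<close> by \<open>\<Prod>\<^sub>i\<^sub>\<in>\<^sub>S t\<^sub>i\<close>, so the class of a
  polynomial is identified with that of its coefficient function.
\<close>

definition lorentzian_classes :: "nat \<Rightarrow> nat set set \<Rightarrow> (nat set \<Rightarrow> real) set set" where
  "lorentzian_classes n B = (\<lambda>f. rescaling_class n (coeff_function f)) ` lorentzian_polys n B"

definition stable_classes :: "nat \<Rightarrow> nat set set \<Rightarrow> (nat set \<Rightarrow> real) set set" where
  "stable_classes n B = (\<lambda>f. rescaling_class n (coeff_function f)) ` stable_polys n B"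


section \<open>The Betsy Ross matroid\<close>

definition golden_ratio :: real where
  "golden_ratio = (1 + sqrt 5) / 2"

definition betsy_ross_matrix :: "real mat" where
  "betsy_ross_matrix =
    (let \<phi> = golden_ratio in
     mat_of_cols_list 3
       [[0, 1, 0], [0, 0, 1], [1, 1, 1], [1, \<phi> + 1, \<phi>], [1, \<phi>, 1 / \<phi>], [1, \<phi> + 1, 0],
        [1, 0, \<phi>], [1, \<phi>, \<phi>], [1, \<phi>, 1], [1, \<phi> + 1, 1], [1, 0, 0]])"

definition betsy_ross_minor :: "nat set \<Rightarrow> real" where
  "betsy_ross_minor S = Determinant.det (submatrix betsy_ross_matrix UNIV S)"

definition betsy_ross_bases :: "nat set set" where
  "betsy_ross_bases = {S. S \<subseteq> {..<11} \<and> card S = 3 \<and> betsy_ross_minor S \<noteq> 0}"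

definition betsy_ross_curve :: "real \<Rightarrow> (nat set \<Rightarrow> real) set" where
  "betsy_ross_curve t =
    rescaling_class 11 (\<lambda>S. if S \<in> betsy_ross_bases then \<bar>betsy_ross_minor S\<bar> powr t else 0)"

end

theory Submission
  imports
    "HOL-Analysis.Generalised_Binomial_Theorem"
    "HOL-Real_Asymp.Real_Asymp"
    "Jordan_Normal_Form.Schur_Decomposition"
    Defs
begin

unbundle no vec_syntax

text \<open>
  All nonzero minors of the matrix are units of \<open>\<int>[\<phi>]\<close>, so the Galois conjugate configuration has the
  inverse absolute minors, and every statement about exponents \<open>t \<ge> 0\<close> transfers to \<open>- t\<close>. For
  \<open>0 \<le> t \<le> q\<close> the Pluecker relations of a real configuration stay \<open>q\<close>-null when absolute values are
  raised to the power \<open>t\<close>, by subadditivity of \<open>x \<mapsto> x\<^sup>t\<^sup>/\<^sup>q\<close>. Conversely, the three-term relations with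
  a vanishing term force equality of the other two terms; after normalising a frame by the torus these
  equalities determine every weak representation up to the parameter \<open>t\<close>, and one relation with terms
  \<open>1, \<phi>\<^sup>t, \<phi>\<^sup>-\<^sup>t\<close> bounds \<open>\<bar>t\<bar>\<close> by \<open>q\<close>.

  Both Lorentzian and stable polynomials satisfy a quadratic inequality on each link which says that
  their coefficients are a weak \<open>2\<close>-representation; hence \<open>\<bar>t\<bar> \<le> 2\<close>. For \<open>0 \<le> t \<le> 2\<close> the polynomial is
  Lorentzian because \<open>det(v\<^sub>i, v\<^sub>j, v\<^sub>k)\<^sup>2 \<bar>v\<^sub>i\<bar>\<^sup>2 = G\<^sub>j\<^sub>j G\<^sub>k\<^sub>k - G\<^sub>j\<^sub>k\<^sup>2\<close> for the Gram matrix \<open>G\<close> of the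
  vectors \<open>v\<^sub>i \<times> v\<^sub>j\<close>, and \<open>1 - (1 - x)\<^sup>t\<^sup>/\<^sup>2\<close> is a power series with nonnegative coefficients, so the Schur
  product theorem applies. For \<open>t = 2\<close> the polynomial is the determinant of \<open>\<Sum>\<^sub>i z\<^sub>i v\<^sub>i v\<^sub>i\<^sup>T\<close>, hence
  stable. Stability at exponent \<open>t\<close> fails for \<open>\<bar>t\<bar> < 2\<close>: the configuration contains a parallelogram whose
  diagonals violate an inequality that is the parallelogram law for \<open>t = 2\<close>.
\<close>

section \<open>Symmetric matrices with at most one positive eigenvalue\<close>

text \<open>The torus has eleven coordinates and the frame twelve bases, so after normalisation one
  number is left over: a cross-ratio in the link of element 2, whose logarithm is the exponent. As
  q-nullity always implies \<open>\<infinity>\<close>-nullity, a single chain of two-term relations,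
  checked by exact computation in the golden integers, serves all q. Throughout,
  \<open>0 powr 0 = 0\<close>: exponent 0 gives the indicator of the bases, and nonbases vanish
  along the whole curve. The quadratic inequalities on links hold for all exponents with absolute
  value at most 2, so they cannot separate stable from Lorentzian; excluding the interior needs a
  test that sees the full cubic. For the chosen parallelogram it reads 2 v + 2 <= 1 / v + v^2 with v
  = \<phi>^(-t), i.e. (v + 1)(v^2 - 3 v + 1) >= 0. The positive roots are \<phi>^2 and \<phi>^(-2),
  so this inequality bounds the exponent from the opposite side and only 2 and -2 survive.\<close>

lemma symmetric_real_mat_eigenvalue:
  fixes A :: "real mat"
  assumes A: "A \<in> carrier_mat n n" and sym: "transpose_mat A = A" and n: "0 < n"
  shows "\<exists>e. eigenvalue A e"
proof -
  let ?A = "map_mat complex_of_real A"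
  have cA: "?A \<in> carrier_mat n n" using A by simp
  from char_poly_factorized[OF cA] obtain as where
    as: "char_poly ?A = (\<Prod>a\<leftarrow>as. [:- a, 1:])" and len: "length as = n" by auto
  with n obtain a as' where "as = a # as'" by (cases as) auto
  then have root: "poly (char_poly ?A) a = 0" using as by simp
  then obtain z where z: "z \<in> carrier_vec n" "z \<noteq> 0\<^sub>v n" "?A *\<^sub>v z = a \<cdot>\<^sub>v z"
    using eigenvalue_root_char_poly[OF cA] cA unfolding eigenvalue_def eigenvector_def by auto
  have Aij: "A $$ (i, j) = A $$ (j, i)" if "i < n" "j < n" for i j
    using arg_cong[OF sym, of "\<lambda>M. M $$ (i, j)"] A that by simp
  have Az: "(\<Sum>j<n. complex_of_real (A $$ (i, j)) * z $ j) = a * z $ i" if "i < n" for i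
    using arg_cong[OF z(3), of "\<lambda>v. v $ i"] that A z(1)
    by (simp add: scalar_prod_def lessThan_atLeast0)
  define N where "N = (\<Sum>i<n. (cmod (z $ i))\<^sup>2)"
  have "\<exists>i<n. z $ i \<noteq> 0"
  proof (rule ccontr)
    assume "\<not> ?thesis"
    then have "z = 0\<^sub>v n" using z(1) by (intro eq_vecI) auto
    with z(2) show False ..
  qed
  then obtain i0 where "i0 < n" "z $ i0 \<noteq> 0" by blast
  then have N: "N > 0" unfolding N_def by (intro sum_pos2[of _ i0]) auto
  \<comment> \<open>The Hermitian form conj(z)^T A z equals a |z|^2. Conjugation swaps the two
    summation indices, and symmetry of the real matrix makes the value real, hence also a.\<close>
  have eq: "a * of_real N = (\<Sum>i<n. \<Sum>j<n. of_real (A $$ (i, j)) * z $ j * cnj (z $ i))"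
  proof -
    have "a * of_real N = (\<Sum>i<n. (a * z $ i) * cnj (z $ i))"
      unfolding N_def of_real_sum sum_distrib_left
      by (intro sum.cong refl) (simp only: complex_norm_square mult.assoc)
    also have "\<dots> = (\<Sum>i<n. \<Sum>j<n. of_real (A $$ (i, j)) * z $ j * cnj (z $ i))"
      by (intro sum.cong refl) (simp add: Az[symmetric] sum_distrib_right)
    finally show ?thesis .
  qed
  have "cnj (a * of_real N) = (\<Sum>i<n. \<Sum>j<n. of_real (A $$ (i, j)) * cnj (z $ j) * z $ i)"
    unfolding eq by simp
  also have "\<dots> = (\<Sum>j<n. \<Sum>i<n. of_real (A $$ (i, j)) * cnj (z $ j) * z $ i)"
    by (rule sum.swap)
  also have "\<dots> = a * of_real N"
    unfolding eq by (intro sum.cong refl) (auto simp: Aij mult_ac)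
  finally have "cnj a = a" using N by simp
  then have a: "a = of_real (Re a)" by (simp add: complex_eq_iff)
  have "poly (map_poly complex_of_real (char_poly A)) (of_real (Re a)) = 0"
    using root a unfolding of_real_hom.char_poly_hom[OF A] by simp
  then have "poly (char_poly A) (Re a) = 0"
    by (simp only: of_real_hom.poly_map_poly of_real_eq_0_iff)
  then show ?thesis using eigenvalue_root_char_poly[OF A] by blast
qed

text \<open>Gram-Schmidt keeps the first vector of a completed basis, so after normalisation the
  first column spans the line of \<open>v\<close>. Deflating an eigenvector needs no more than that
  line.\<close>

lemma orthonormal_completion:
  fixes v :: "real vec"
  assumes v: "v \<in> carrier_vec n" "v \<noteq> 0\<^sub>v n"
  obtains U c where "U \<in> carrier_mat n n" "transpose_mat U * U = 1\<^sub>m n" "col U 0 = c \<cdot>\<^sub>v v"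
proof -
  interpret cof_vec_space n "TYPE(real)" .
  define b where "b = basis_completion v"
  define ws where "ws = gram_schmidt n b"
  note bc = basis_completion[OF v, folded b_def]
  from v have n: "0 < n" by (cases n) auto
  from bc(6,7) n obtain vs where bv: "b = v # vs" by (cases b) auto
  from gram_schmidt_result[OF bc(2,4,5) refl, folded ws_def]
  have ws: "set ws \<subseteq> carrier_vec n" "corthogonal ws" "length ws = n"
    by (auto simp: bc)
  have hdws: "hd ws = v" using gram_schmidt_hd[OF v(1), of vs, folded bv] unfolding ws_def .
  have c[simp]: "ws ! i \<in> carrier_vec n" if "i < n" for i using ws that by auto
  have orth: "(ws ! i \<bullet> ws ! j = 0) = (i \<noteq> j)" if "i < n" "j < n" for i j
    using corthogonalD[OF ws(2), of i j] that ws(3) by simp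
  have nn: "0 < ws ! i \<bullet> ws ! i" if "i < n" for i
    proof -
    have "0 \<le> ws ! i \<bullet> ws ! i" unfolding scalar_prod_def by (intro sum_nonneg) simp
    then show ?thesis using orth[OF that that] by linarith
  qed
  define us where "us = map (\<lambda>w. (1 / sqrt (w \<bullet> w)) \<cdot>\<^sub>v w) ws"
  define U where "U = mat_of_cols n us"
  have len: "length us = n" using ws us_def by simp
  have us: "us ! i = (1 / sqrt (ws ! i \<bullet> ws ! i)) \<cdot>\<^sub>v ws ! i" if "i < n" for i
    using that ws(3) by (simp add: us_def)
  have U: "U \<in> carrier_mat n n" unfolding U_def using len by auto
  have colU: "col U i = us ! i" if "i < n" for i
    unfolding U_def using that len us by (intro col_mat_of_cols) auto
  have "transpose_mat U * U = 1\<^sub>m n"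
  proof (rule eq_matI)
    fix i j assume ij: "i < dim_row (1\<^sub>m n :: real mat)" "j < dim_col (1\<^sub>m n :: real mat)"
    then have "(transpose_mat U * U) $$ (i, j) = us ! i \<bullet> us ! j" using U by (simp add: colU)
    also have "\<dots> = 1 / sqrt (ws ! i \<bullet> ws ! i) * (1 / sqrt (ws ! j \<bullet> ws ! j)) * (ws ! i \<bullet> ws ! j)"
      using ij by (simp add: us smult_scalar_prod_distrib[of _ n] scalar_prod_smult_distrib[of _ n])
    also have "\<dots> = (1\<^sub>m n :: real mat) $$ (i, j)"
      using ij orth[of i j] nn[of i] by (auto simp: field_simps)
    finally show "(transpose_mat U * U) $$ (i, j) = (1\<^sub>m n :: real mat) $$ (i, j)" .
  qed (use U in auto)
  moreover have "ws ! 0 = v" using hdws ws(3) n by (metis hd_conv_nth list.size(3) less_numeral_extra(3))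
  then have "col U 0 = (1 / sqrt (v \<bullet> v)) \<cdot>\<^sub>v v" using colU[OF n] us[OF n] by simp
  ultimately show ?thesis using that U by blast
qed

text \<open>Spectral theorem by deflation: in an orthonormal basis that starts with an eigenvector
  the first column is a multiple of the first unit vector, symmetry clears the first row as well,
  and the remaining block is symmetric of size one less.\<close>

lemma symmetric_real_mat_diagonalization:
  fixes A :: "real mat"
  assumes "A \<in> carrier_mat n n" and "transpose_mat A = A"
  shows "\<exists>P es. P \<in> carrier_mat n n \<and> length es = n \<and> transpose_mat P * P = 1\<^sub>m n \<and>
    transpose_mat P * A * P = mat n n (\<lambda>(i, j). if i = j then es ! i else 0)"
  using assms
proof (induction n arbitrary: A)
  case 0
  then show ?case by (intro exI[of _ "1\<^sub>m 0"] exI[of _ "[]"]) auto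
next
  case (Suc n)
  note A = Suc.prems
  obtain e v where v: "v \<in> carrier_vec (Suc n)" "v \<noteq> 0\<^sub>v (Suc n)" "A *\<^sub>v v = e \<cdot>\<^sub>v v"
    using symmetric_real_mat_eigenvalue[OF A] A(1) unfolding eigenvalue_def eigenvector_def by auto
  obtain U c where U: "U \<in> carrier_mat (Suc n) (Suc n)" "transpose_mat U * U = 1\<^sub>m (Suc n)"
    and U0: "col U 0 = c \<cdot>\<^sub>v v"
    using orthonormal_completion[OF v(1,2)] by blast
  define A' where "A' = transpose_mat U * A * U"
  have tU: "transpose_mat U \<in> carrier_mat (Suc n) (Suc n)" using U by simp
  have A': "A' \<in> carrier_mat (Suc n) (Suc n)" unfolding A'_def using U A by simp
  have symA': "transpose_mat A' = A'"
    unfolding A'_def using U A tU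
    by (simp add: transpose_mult[of _ "Suc n" "Suc n" _ "Suc n"] assoc_mult_mat[of _ "Suc n" "Suc n" _ "Suc n" _ "Suc n"])
  have AU0: "A *\<^sub>v col U 0 = e \<cdot>\<^sub>v col U 0"
    unfolding U0 using v A by (simp add: mult_mat_vec smult_smult_assoc mult.commute)
  have A'0: "A' $$ (i, 0) = (if i = 0 then e else 0)" if "i < Suc n" for i
  proof -
    have "A' = transpose_mat U * (A * U)"
      unfolding A'_def using U A tU by (simp add: assoc_mult_mat[of _ "Suc n" "Suc n" _ "Suc n" _ "Suc n"])
    then have "A' $$ (i, 0) = col U i \<bullet> col (A * U) 0" using that U A by simp
    also have "col (A * U) 0 = e \<cdot>\<^sub>v col U 0"
      unfolding col_mult2[OF A(1) U(1) zero_less_Suc] by (rule AU0)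
    also have "col U i \<bullet> (e \<cdot>\<^sub>v col U 0) = e * (transpose_mat U * U) $$ (i, 0)"
      using that U(1) by simp
    finally show ?thesis using that unfolding U(2) by simp
  qed
  have A'0': "A' $$ (0, i) = (if i = 0 then e else 0)" if "i < Suc n" for i
    using arg_cong[OF symA', of "\<lambda>M. M $$ (0, i)"] A' that A'0[OF that] by simp
  define A3 where "A3 = mat n n (\<lambda>(i, j). A' $$ (Suc i, Suc j))"
  have A3: "A3 \<in> carrier_mat n n" unfolding A3_def by simp
  have "transpose_mat A3 = A3"
  proof (rule eq_matI)
    fix i j assume "i < dim_row A3" "j < dim_col A3"
    then show "transpose_mat A3 $$ (i, j) = A3 $$ (i, j)"
      using arg_cong[OF symA', of "\<lambda>M. M $$ (Suc i, Suc j)"] A' A3 by (simp add: A3_def)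
  qed (use A3 in auto)
  from Suc.IH[OF A3 this] obtain P3 es where P3: "P3 \<in> carrier_mat n n" and es: "length es = n"
    and P3P3: "transpose_mat P3 * P3 = 1\<^sub>m n"
    and D3: "transpose_mat P3 * A3 * P3 = mat n n (\<lambda>(i, j). if i = j then es ! i else 0)" by blast
  let ?B = "\<lambda>X. four_block_mat (1\<^sub>m 1) (0\<^sub>m 1 n) (0\<^sub>m n 1) X :: real mat"
  have block: "A' = four_block_mat (mat 1 1 (\<lambda>_. e)) (0\<^sub>m 1 n) (0\<^sub>m n 1) A3"
  proof (rule eq_matI)
    fix i j
    assume "i < dim_row (four_block_mat (mat 1 1 (\<lambda>_. e)) (0\<^sub>m 1 n) (0\<^sub>m n 1) A3)"
      "j < dim_col (four_block_mat (mat 1 1 (\<lambda>_. e)) (0\<^sub>m 1 n) (0\<^sub>m n 1) A3)"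
    then show "A' $$ (i, j) = four_block_mat (mat 1 1 (\<lambda>_. e)) (0\<^sub>m 1 n) (0\<^sub>m n 1) A3 $$ (i, j)"
      using A3 A'0[of i] A'0'[of j] by (cases i; cases j) (auto simp: A3_def)
  qed (use A' A3 in auto)
  have tP3: "transpose_mat P3 \<in> carrier_mat n n" using P3 by simp
  have B: "?B P3 \<in> carrier_mat (Suc n) (Suc n)"
    using four_block_carrier_mat[of "1\<^sub>m 1" 1 1 P3 n n] P3 by simp
  have tB: "transpose_mat (?B P3) = ?B (transpose_mat P3)"
    using P3 by (simp add: transpose_four_block_mat[of _ 1 1 _ n _ n])
  have tBc: "?B (transpose_mat P3) \<in> carrier_mat (Suc n) (Suc n)"
    using four_block_carrier_mat[of "1\<^sub>m 1" 1 1 "transpose_mat P3" n n] P3 by simp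
  have mid: "transpose_mat (?B P3) * A' * ?B P3
    = mat (Suc n) (Suc n) (\<lambda>(i, j). if i = j then (e # es) ! i else 0)" (is "?L = ?R")
  proof -
    have "?L = four_block_mat (mat 1 1 (\<lambda>_. e)) (0\<^sub>m 1 n) (0\<^sub>m n 1) (transpose_mat P3 * A3 * P3)"
      unfolding tB block
      using P3 tP3 A3
      by (simp add: mult_four_block_mat[of _ 1 1 _ n _ n _ _ 1 _ n] )
    also have "\<dots> = ?R"
      unfolding D3 by (rule eq_matI) (auto simp: es nth_Cons')
    finally show ?thesis .
  qed
  have one: "transpose_mat (?B P3) * ?B P3 = 1\<^sub>m (Suc n)"
    unfolding tB using P3 tP3
    by (simp add: mult_four_block_mat[of _ 1 1 _ n _ n _ _ 1 _ n] P3P3 four_block_one_mat)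
  have t: "transpose_mat (U * ?B P3) = transpose_mat (?B P3) * transpose_mat U"
    using transpose_mult[OF U(1) B] .
  have tBc': "transpose_mat (?B P3) \<in> carrier_mat (Suc n) (Suc n)" using B by simp
  note assoc = assoc_mult_mat[of _ "Suc n" "Suc n" _ "Suc n" _ "Suc n"]
  have UA: "U * X \<in> carrier_mat (Suc n) (Suc n)" "A * X \<in> carrier_mat (Suc n) (Suc n)"
    "transpose_mat U * X \<in> carrier_mat (Suc n) (Suc n)"
    if "X \<in> carrier_mat (Suc n) (Suc n)" for X using U A that by auto
  have "transpose_mat (U * ?B P3) * (U * ?B P3) = transpose_mat (?B P3) * ((transpose_mat U * U) * ?B P3)"
    unfolding t using U(1) B tBc' tU UA by (simp add: assoc del: transpose_carrier_mat)
  also have "\<dots> = 1\<^sub>m (Suc n)" unfolding U(2) left_mult_one_mat[OF B] by (rule one)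
  finally have 1: "transpose_mat (U * ?B P3) * (U * ?B P3) = 1\<^sub>m (Suc n)" .
  have "transpose_mat (U * ?B P3) * A * (U * ?B P3) = transpose_mat (?B P3) * A' * ?B P3"
    unfolding t A'_def using U(1) B tBc' tU A UA by (simp add: assoc del: transpose_carrier_mat)
  then have 2: "transpose_mat (U * ?B P3) * A * (U * ?B P3)
    = mat (Suc n) (Suc n) (\<lambda>(i, j). if i = j then (e # es) ! i else 0)" unfolding mid .
  show ?case
    by (rule exI[of _ "U * ?B P3"], rule exI[of _ "e # es"]) (use 1 2 es UA(1)[OF B] in simp)
qed

text \<open>Trades eigenvalues for domination by the square of one linear form, a condition that can
  be proved term by term for a power series and tested at chosen vectors. A single positive
  eigenvalue supplies the form; conversely, the plane of two positive eigenvectors meets the kernel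
  of any linear form.\<close>

lemma at_most_one_positive_eigenvalue_iff:
  fixes h :: "nat \<Rightarrow> nat \<Rightarrow> real"
  assumes sym: "\<And>i j. i < n \<Longrightarrow> j < n \<Longrightarrow> h i j = h j i"
  shows "at_most_one_positive_eigenvalue (mat n n (\<lambda>(i, j). h i j)) \<longleftrightarrow>
    (\<exists>l. \<forall>x. (\<Sum>i<n. \<Sum>j<n. h i j * x i * x j) \<le> (\<Sum>i<n. l i * x i)\<^sup>2)"
proof -
  define H where "H = mat n n (\<lambda>(i, j). h i j)"
  have H: "H \<in> carrier_mat n n" unfolding H_def by simp
  have "transpose_mat H = H" by (rule eq_matI) (auto simp: H_def sym)
  from symmetric_real_mat_diagonalization[OF H this] obtain P es where
    P: "P \<in> carrier_mat n n" and es: "length es = n" and PP: "transpose_mat P * P = 1\<^sub>m n"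
    and D: "transpose_mat P * H * P = mat n n (\<lambda>(i, j). if i = j then es ! i else 0)" by blast
  define D where "D = mat n n (\<lambda>(i, j). if i = j then es ! i else 0)"
  have Dc: "D \<in> carrier_mat n n" unfolding D_def by simp
  have tP: "transpose_mat P \<in> carrier_mat n n" using P by simp
  have PP': "P * transpose_mat P = 1\<^sub>m n" using mat_mult_left_right_inverse[OF tP P PP] .
  note assoc = assoc_mult_mat[of _ n n _ n _ n]
  have HPD: "H = P * D * transpose_mat P"
  proof -
    have "P * D * transpose_mat P = (P * transpose_mat P) * H * (P * transpose_mat P)"
      unfolding D_def D[symmetric] using P tP H by (simp add: assoc del: transpose_carrier_mat)
    then show ?thesis unfolding PP' using H by simp
  qed
  have "similar_mat_wit H D P (transpose_mat P)"
    by (rule similar_mat_witI[of _ _ n]) (use P tP H Dc PP PP' HPD in auto)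
  then have "char_poly H = char_poly D" by (intro char_poly_similar) (auto simp: similar_mat_def)
  also have "\<dots> = (\<Prod>a\<leftarrow>diag_mat D. [:- a, 1:])"
    by (rule char_poly_upper_triangular[OF Dc]) (auto simp: D_def)
  also have "diag_mat D = es" unfolding diag_mat_def D_def by (intro nth_equalityI) (auto simp: es)
  finally have cp: "char_poly H = (\<Prod>a\<leftarrow>es. [:- a, 1:])" .
  have "proots (\<Prod>a\<leftarrow>xs. [:- a, 1:]) = mset xs" for xs :: "real list"
  proof (induction xs)
    case (Cons a xs)
    have "(\<Prod>a\<leftarrow>xs. [:- a, 1:]) \<noteq> (0 :: real poly)" by (auto simp: prod_list_zero_iff)
    then show ?case using Cons by (simp add: proots_mult proots_linear_factor del: mult_pCons_left)
  qed simp
  then have "proots (char_poly H) = mset es" unfolding cp .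
  then have iff: "at_most_one_positive_eigenvalue H \<longleftrightarrow> card {k. k < n \<and> 0 < es ! k} \<le> 1"
    unfolding at_most_one_positive_eigenvalue_def
    by (simp flip: mset_filter add: length_filter_conv_card es)
  define p where "p = (\<lambda>i j. P $$ (i, j))"
  have orth: "(\<Sum>k<n. p k i * p k j) = (if i = j then 1 else 0)" if "i < n" "j < n" for i j
    using arg_cong[OF PP, of "\<lambda>M. M $$ (i, j)"] that P
    by (simp add: p_def scalar_prod_def lessThan_atLeast0)
  have h: "h i j = (\<Sum>k<n. es ! k * p i k * p j k)" if ij: "i < n" "j < n" for i j
  proof -
    have "h i j = (P * D * transpose_mat P) $$ (i, j)" using ij unfolding HPD[symmetric] H_def by simp
    also have "\<dots> = (\<Sum>k<n. p i k * (\<Sum>m<n. D $$ (k, m) * p j m))"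
      using ij P Dc by (simp add: p_def scalar_prod_def lessThan_atLeast0)
    also have "\<dots> = (\<Sum>k<n. es ! k * p i k * p j k)"
    proof (intro sum.cong refl)
      fix k assume k: "k \<in> {..<n}"
      have "(\<Sum>m<n. D $$ (k, m) * p j m) = (\<Sum>m<n. if m = k then es ! k * p j k else 0)"
        using k by (intro sum.cong refl) (auto simp: D_def)
      then show "p i k * (\<Sum>m<n. D $$ (k, m) * p j m) = es ! k * p i k * p j k" using k by simp
    qed
    finally show ?thesis .
  qed
  have Q: "(\<Sum>i<n. \<Sum>j<n. h i j * x i * x j) = (\<Sum>k<n. es ! k * (\<Sum>i<n. p i k * x i)\<^sup>2)" for x
  proof -
    have "(\<Sum>i<n. \<Sum>j<n. h i j * x i * x j)
      = (\<Sum>i<n. \<Sum>j<n. \<Sum>k<n. es ! k * (p i k * x i) * (p j k * x j))"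
      by (intro sum.cong refl) (simp add: h sum_distrib_left sum_distrib_right mult_ac)
    also have "\<dots> = (\<Sum>i<n. \<Sum>k<n. \<Sum>j<n. es ! k * (p i k * x i) * (p j k * x j))"
      by (rule sum.cong[OF refl]) (rule sum.swap)
    also have "\<dots> = (\<Sum>k<n. \<Sum>i<n. \<Sum>j<n. es ! k * (p i k * x i) * (p j k * x j))"
      by (rule sum.swap)
    also have "\<dots> = (\<Sum>k<n. es ! k * (\<Sum>i<n. p i k * x i)\<^sup>2)"
      by (intro sum.cong refl) (simp add: power2_eq_square sum_product sum_distrib_left mult_ac)
    finally show ?thesis .
  qed
  have "(card {k. k < n \<and> 0 < es ! k} \<le> 1) \<longleftrightarrow>
    (\<exists>l. \<forall>x. (\<Sum>k<n. es ! k * (\<Sum>i<n. p i k * x i)\<^sup>2) \<le> (\<Sum>i<n. l i * x i)\<^sup>2)" (is "?L \<longleftrightarrow> ?R")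
  proof
    assume ?L
    then consider "{k. k < n \<and> 0 < es ! k} = {}" | k0 where "{k. k < n \<and> 0 < es ! k} = {k0}"
      by (metis card_1_singletonE card_0_eq finite_Collect_conjI finite_Collect_less_nat le_Suc_eq le_zero_eq One_nat_def)
    then show ?R
    proof cases
      case 1
      have neg: "es ! k \<le> 0" if "k < n" for k
      proof (rule ccontr)
        assume "\<not> ?thesis"
        then have "k \<in> {k. k < n \<and> 0 < es ! k}" using that by simp
        with 1 show False by blast
      qed
      have "(\<Sum>k<n. es ! k * (\<Sum>i<n. p i k * x i)\<^sup>2) \<le> 0" for x
        by (rule sum_nonpos, rule mult_nonpos_nonneg) (simp_all add: neg)
      then have "(\<Sum>k<n. es ! k * (\<Sum>i<n. p i k * x i)\<^sup>2) \<le> (\<Sum>i<n. 0 * x i)\<^sup>2" for x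
        by simp
      then show ?thesis by (intro exI[of _ "\<lambda>_. 0"]) blast
    next
      case 2
      then have k0: "k0 < n" "0 < es ! k0" by auto
      have "(\<Sum>k<n. es ! k * (\<Sum>i<n. p i k * x i)\<^sup>2) \<le> (\<Sum>i<n. (sqrt (es ! k0) * p i k0) * x i)\<^sup>2" for x
      proof -
        have "(\<Sum>k<n. es ! k * (\<Sum>i<n. p i k * x i)\<^sup>2)
          \<le> (\<Sum>k<n. if k = k0 then es ! k0 * (\<Sum>i<n. p i k0 * x i)\<^sup>2 else 0)"
        proof (rule sum_mono)
          fix k assume "k \<in> {..<n}"
          then have "k \<noteq> k0 \<Longrightarrow> es ! k \<le> 0" using 2
              by (metis (mono_tags, lifting) lessThan_iff mem_Collect_eq not_le singletonD)
          then show "es ! k * (\<Sum>i<n. p i k * x i)\<^sup>2 \<le> (if k = k0 then es ! k0 * (\<Sum>i<n. p i k0 * x i)\<^sup>2 else 0)"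
            by (cases "k = k0") (simp_all add: mult_nonpos_nonneg)
        qed
        also have "\<dots> = (\<Sum>i<n. (sqrt (es ! k0) * p i k0) * x i)\<^sup>2"
          using k0 by (simp add: mult.assoc power_mult_distrib flip: sum_distrib_left)
        finally show ?thesis .
      qed
      then show ?thesis by (intro exI[of _ "\<lambda>i. sqrt (es ! k0) * p i k0"]) blast
    qed
  next
    assume ?R
    then obtain l where l: "\<And>x. (\<Sum>k<n. es ! k * (\<Sum>i<n. p i k * x i)\<^sup>2) \<le> (\<Sum>i<n. l i * x i)\<^sup>2" by blast
    show ?L
    proof (rule ccontr)
      assume "\<not> ?L"
      then have "2 \<le> card {k. k < n \<and> 0 < es ! k}" by simp
      then obtain a b where ab: "a < n" "b < n" "a \<noteq> b" "0 < es ! a" "0 < es ! b"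
        by (auto simp: card_le_Suc_iff numeral_2_eq_2)
      \<comment> \<open>Values of the linear form on the eigenvectors. A nonzero combination of the
        eigenvectors \<open>a\<close> and \<open>b\<close> in its kernel has a positive value of the
        quadratic form against the bound 0.\<close>
      define L where "L = (\<lambda>k. \<Sum>i<n. l i * p i k)"
      obtain s t where st: "s * L a + t * L b = 0" "s \<noteq> 0 \<or> t \<noteq> 0"
      proof (cases "L a = 0 \<and> L b = 0")
        case True then show ?thesis using that[of 1 1] by simp
      next
        case False then show ?thesis using that[of "L b" "- L a"] by auto
      qed
      define x where "x = (\<lambda>i. s * p i a + t * p i b)"
      have "(\<Sum>i<n. l i * x i) = s * L a + t * L b"
        by (simp add: x_def L_def sum_distrib_left sum.distrib algebra_simps)
      moreover have "(\<Sum>i<n. p i k * x i) = (if k = a then s else 0) + (if k = b then t else 0)" if "k < n" for k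
      proof -
        have "(\<Sum>i<n. p i k * x i) = s * (\<Sum>i<n. p i k * p i a) + t * (\<Sum>i<n. p i k * p i b)"
          by (simp add: x_def sum_distrib_left sum.distrib algebra_simps)
        then show ?thesis using that ab by (simp add: orth)
      qed
      then have "(\<Sum>k<n. es ! k * (\<Sum>i<n. p i k * x i)\<^sup>2)
        = (\<Sum>k<n. es ! k * ((if k = a then s else 0) + (if k = b then t else 0))\<^sup>2)"
        by (intro sum.cong refl) (simp only: lessThan_iff)
      moreover have "\<dots> = (\<Sum>k<n. (if k = a then es ! a * s\<^sup>2 else 0) + (if k = b then es ! b * t\<^sup>2 else 0))"
        using ab(3) by (intro sum.cong refl) simp
      moreover have "\<dots> = es ! a * s\<^sup>2 + es ! b * t\<^sup>2" using ab by (simp add: sum.distrib)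
      ultimately have "es ! a * s\<^sup>2 + es ! b * t\<^sup>2 \<le> 0" using l[of x] st by simp
      moreover have "0 < es ! a * s\<^sup>2 + es ! b * t\<^sup>2"
        using ab st(2) by (auto intro: add_pos_nonneg add_nonneg_pos)
      ultimately show False by simp
    qed
  qed
  with iff show ?thesis unfolding H_def[symmetric] Q by simp
qed

section \<open>Powers of Gram determinants\<close>

text \<open>These are the coefficients of (1 - x)^a after the constant term. The first one is -a,
  and passing from n to n + 1 multiplies by (n - a) / (n + 1), which is nonnegative from n = 1
  on.\<close>

lemma gbinomial_alternating_nonpos:
  fixes a :: real
  assumes "0 \<le> a" "a \<le> 1" "0 < n"
  shows "(a gchoose n) * (- 1) ^ n \<le> 0"
  using assms(3)
proof (induction n rule: nat_induct_non_zero)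
  case (Suc n)
  have c: "a gchoose Suc n = (a - real n) * (a gchoose n) / real (Suc n)"
    using gbinomial_mult_1[of a n] by (simp add: field_simps)
  have "(a gchoose Suc n) * (- 1) ^ Suc n = ((a gchoose n) * (- 1) ^ n) * ((real n - a) / real (Suc n))"
    unfolding c by (simp add: field_simps)
  moreover have "0 \<le> (real n - a) / real (Suc n)" using assms Suc.hyps by simp
  ultimately show ?case using Suc.IH by (metis mult_nonpos_nonneg)
qed (use assms in simp)

text \<open>The Schur product theorem for powers of one Gram matrix. Expanding one factor of the
  power absorbs \<open>p j c\<close> into the weight of j, which is why the weights vary in the
  induction.\<close>

lemma gram_power_nonneg:
  fixes p :: "'i \<Rightarrow> 'c \<Rightarrow> real"
  shows "0 \<le> (\<Sum>j\<in>J. \<Sum>k\<in>J. w j * w k * (\<Sum>c\<in>C. p j c * p k c) ^ m)"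
proof (induction m arbitrary: w)
  case 0
  have "(\<Sum>j\<in>J. \<Sum>k\<in>J. w j * w k) = (\<Sum>j\<in>J. w j)\<^sup>2" by (simp add: power2_eq_square sum_product)
  then show ?case by simp
next
  case (Suc m)
  have "(\<Sum>j\<in>J. \<Sum>k\<in>J. w j * w k * (\<Sum>c\<in>C. p j c * p k c) ^ Suc m)
    = (\<Sum>j\<in>J. \<Sum>k\<in>J. \<Sum>c\<in>C. (w j * p j c) * (w k * p k c) * (\<Sum>c\<in>C. p j c * p k c) ^ m)"
    by (intro sum.cong refl) (simp add: sum_distrib_left sum_distrib_right mult_ac)
  also have "\<dots> = (\<Sum>j\<in>J. \<Sum>c\<in>C. \<Sum>k\<in>J. (w j * p j c) * (w k * p k c) * (\<Sum>c\<in>C. p j c * p k c) ^ m)"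
    by (rule sum.cong[OF refl]) (rule sum.swap)
  also have "\<dots> = (\<Sum>c\<in>C. \<Sum>j\<in>J. \<Sum>k\<in>J. (w j * p j c) * (w k * p k c) * (\<Sum>c\<in>C. p j c * p k c) ^ m)"
    by (rule sum.swap)
  also have "\<dots> \<ge> 0" by (rule sum_nonneg) (rule Suc.IH)
  finally show ?case .
qed

text \<open>In the binomial series the constant term gives the square on the right, and every other
  term is a nonpositive coefficient times a form that is nonnegative by
  \<open>gram_power_nonneg\<close>. The factor \<open>r < 1\<close> keeps the argument inside the
  disc of convergence even where the Gram entry has absolute value 1.\<close>

lemma one_minus_gram_powr:
  fixes p :: "'i \<Rightarrow> 'c \<Rightarrow> real"
  assumes "finite J" and a: "0 \<le> a" "a \<le> 1" and r: "0 \<le> r" "r < 1"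
    and u: "\<And>j k. j \<in> J \<Longrightarrow> k \<in> J \<Longrightarrow> \<bar>\<Sum>c\<in>C. p j c * p k c\<bar> \<le> 1"
  shows "(\<Sum>j\<in>J. \<Sum>k\<in>J. w j * w k * (1 - r * (\<Sum>c\<in>C. p j c * p k c)\<^sup>2) powr a) \<le> (\<Sum>j\<in>J. w j)\<^sup>2"
proof -
  define G where "G = (\<lambda>j k. \<Sum>c\<in>C. p j c * p k c)"
  have s: "(\<lambda>n. (a gchoose n) * (- (r * (G j k)\<^sup>2)) ^ n) sums (1 - r * (G j k)\<^sup>2) powr a"
    if "j \<in> J" "k \<in> J" for j k
  proof -
    have "(G j k)\<^sup>2 \<le> 1" using u[OF that] by (simp add: G_def abs_square_le_1)
    then have "r * (G j k)\<^sup>2 \<le> r * 1" using r by (intro mult_left_mono) auto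
    then have "norm (- (r * (G j k)\<^sup>2)) < 1" using r by simp
    from gen_binomial_real[OF this, of a] show ?thesis by simp
  qed
  have s1: "(\<lambda>n. \<Sum>j\<in>J. \<Sum>k\<in>J. w j * w k * ((a gchoose n) * (- (r * (G j k)\<^sup>2)) ^ n))
    sums (\<Sum>j\<in>J. \<Sum>k\<in>J. w j * w k * (1 - r * (G j k)\<^sup>2) powr a)"
    by (intro sums_sum sums_mult s)
  have s2: "(\<lambda>n. if n = 0 then (\<Sum>j\<in>J. w j)\<^sup>2 else 0) sums (\<Sum>j\<in>J. w j)\<^sup>2"
    using sums_single[of 0 "\<lambda>_. (\<Sum>j\<in>J. w j)\<^sup>2"] by simp
  have le: "(\<Sum>j\<in>J. \<Sum>k\<in>J. w j * w k * ((a gchoose n) * (- (r * (G j k)\<^sup>2)) ^ n))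
    \<le> (if n = 0 then (\<Sum>j\<in>J. w j)\<^sup>2 else 0)" for n
  proof (cases "n = 0")
    case True
    then show ?thesis by (simp add: power2_eq_square sum_product)
  next
    case False
    have eq: "(- (r * (G j k)\<^sup>2)) ^ n = (- 1) ^ n * r ^ n * G j k ^ (2 * n)" for j k
      by (subst power_minus) (simp only: power_mult_distrib power_mult mult.assoc)
    have "(\<Sum>j\<in>J. \<Sum>k\<in>J. w j * w k * ((a gchoose n) * (- (r * (G j k)\<^sup>2)) ^ n))
      = ((a gchoose n) * (- 1) ^ n) * r ^ n * (\<Sum>j\<in>J. \<Sum>k\<in>J. w j * w k * G j k ^ (2 * n))"
      unfolding sum_distrib_left
      by (intro sum.cong refl) (simp only: eq mult_ac)
    also have "\<dots> \<le> 0"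
      unfolding G_def using False a r
      by (intro mult_nonpos_nonneg[OF mult_nonpos_nonneg] gbinomial_alternating_nonpos gram_power_nonneg)
        simp_all
    finally show ?thesis using False by simp
  qed
  show ?thesis using sums_le[OF le s1 s2] unfolding G_def .
qed

text \<open>Moving the norms into the weights leaves the kernel 1 - U^2, where U is the cosine of
  the angle between two vectors.\<close>

lemma wedge_kernel_bound:
  fixes p :: "'i \<Rightarrow> 'c \<Rightarrow> real" and C :: "'c set" and s :: real
  defines "G \<equiv> \<lambda>j k. \<Sum>c\<in>C. p j c * p k c"
  assumes J: "finite J" and s: "0 \<le> s" "s \<le> 2"
  shows "(\<Sum>j\<in>J. \<Sum>k\<in>J. w j * w k * (G j j * G k k - (G j k)\<^sup>2) powr (s / 2))
    \<le> (\<Sum>j\<in>J. G j j powr (s / 2) * w j)\<^sup>2"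
proof -
  \<comment> \<open>Division by zero yields 0, so a vector of norm zero gets the normalisation
    0.\<close>
  define q where "q = (\<lambda>j c. p j c / sqrt (G j j))"
  define U where "U = (\<lambda>j k. \<Sum>c\<in>C. q j c * q k c)"
  have G0: "0 \<le> G j j" for j unfolding G_def by (intro sum_nonneg) simp
  have CS: "(G j k)\<^sup>2 \<le> G j j * G k k" for j k
    unfolding G_def using Cauchy_Schwarz_ineq_sum[of "p j" "p k" C] by (simp add: power2_eq_square)
  have U: "U j k = G j k / (sqrt (G j j) * sqrt (G k k))" for j k
    unfolding U_def q_def by (simp add: G_def sum_divide_distrib)
  have U2: "(U j k)\<^sup>2 \<le> 1" for j k
    using CS[of j k] G0[of j] G0[of k]
    by (cases "G j j = 0 \<or> G k k = 0")
      (auto simp: U power_divide power_mult_distrib divide_le_eq_1 zero_less_mult_iff)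
  have factor: "(G j j * G k k - (G j k)\<^sup>2) powr a = G j j powr a * G k k powr a * (1 - (U j k)\<^sup>2) powr a" for j k a
  proof (cases "G j j = 0 \<or> G k k = 0")
    case True
    then have "(G j k)\<^sup>2 = 0" using CS[of j k] by auto
    with True show ?thesis by auto
  next
    case False
    then have "G j j * G k k - (G j k)\<^sup>2 = G j j * G k k * (1 - (U j k)\<^sup>2)"
      using G0[of j] G0[of k] by (simp add: U power_divide power_mult_distrib field_simps)
    then show ?thesis using G0 U2[of j k] by (simp add: powr_mult)
  qed
  \<comment> \<open>The damping factor 1 - 1 / (n + 2) tends to 1. Because the exponent is positive,
    the power is continuous up to base 0, which is reached on the diagonal.\<close>
  have pos: "(\<Sum>j\<in>J. \<Sum>k\<in>J. w j * w k * (1 - (U j k)\<^sup>2) powr a) \<le> (\<Sum>j\<in>J. w j)\<^sup>2"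
    if a: "0 < a" "a \<le> 1" for a and w :: "'i \<Rightarrow> real"
  proof (rule LIMSEQ_le_const2)
    have r: "(\<lambda>n. 1 - 1 / real (n + 2)) \<longlonglongrightarrow> 1" by real_asymp
    show "(\<lambda>n. \<Sum>j\<in>J. \<Sum>k\<in>J. w j * w k * (1 - (1 - 1 / real (n + 2)) * (U j k)\<^sup>2) powr a)
      \<longlonglongrightarrow> (\<Sum>j\<in>J. \<Sum>k\<in>J. w j * w k * (1 - (U j k)\<^sup>2) powr a)"
    proof (intro tendsto_sum tendsto_mult tendsto_const)
      fix j k
      have "(\<lambda>n. 1 - (1 - 1 / real (n + 2)) * (U j k)\<^sup>2) \<longlonglongrightarrow> 1 - 1 * (U j k)\<^sup>2"
        by (intro tendsto_intros r)
      moreover have "0 \<le> 1 - (1 - 1 / real (n + 2)) * (U j k)\<^sup>2" for n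
        using mult_mono[of "1 - 1 / real (n + 2)" 1 "(U j k)\<^sup>2" 1] U2[of j k] by simp
      ultimately show "(\<lambda>n. (1 - (1 - 1 / real (n + 2)) * (U j k)\<^sup>2) powr a) \<longlonglongrightarrow> (1 - (U j k)\<^sup>2) powr a"
        using a by (intro tendsto_powr') auto
    qed
    show "\<exists>N. \<forall>n\<ge>N. (\<Sum>j\<in>J. \<Sum>k\<in>J. w j * w k * (1 - (1 - 1 / real (n + 2)) * (U j k)\<^sup>2) powr a)
      \<le> (\<Sum>j\<in>J. w j)\<^sup>2"
      unfolding U_def using U2 a J
      by (intro exI allI impI one_minus_gram_powr) (auto simp: U_def abs_square_le_1)
  qed
  have bound: "(\<Sum>j\<in>J. \<Sum>k\<in>J. w j * w k * (1 - (U j k)\<^sup>2) powr (s / 2)) \<le> (\<Sum>j\<in>J. w j)\<^sup>2" for w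
  proof (cases "s = 0")
    case False
    then show ?thesis using s by (intro pos) auto
  next
    \<comment> \<open>At s = 0 the kernel is the indicator of U^2 being different from 1, since
      \<open>0 powr 0 = 0\<close>. It is the limit of the kernels with the positive exponents 1 / (n
      + 2).\<close>
    case True
    show ?thesis unfolding True
    proof (rule LIMSEQ_le_const2)
      show "(\<lambda>n. \<Sum>j\<in>J. \<Sum>k\<in>J. w j * w k * (1 - (U j k)\<^sup>2) powr (1 / real (n + 2)))
        \<longlonglongrightarrow> (\<Sum>j\<in>J. \<Sum>k\<in>J. w j * w k * (1 - (U j k)\<^sup>2) powr (0 / 2))"
      proof (intro tendsto_sum tendsto_mult tendsto_const)
        fix j k
        have "(\<lambda>n. 1 / real (n + 2)) \<longlonglongrightarrow> 0" by real_asymp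
        then show "(\<lambda>n. (1 - (U j k)\<^sup>2) powr (1 / real (n + 2))) \<longlonglongrightarrow> (1 - (U j k)\<^sup>2) powr (0 / 2)"
          using tendsto_powr[OF tendsto_const[of "1 - (U j k)\<^sup>2"], of "\<lambda>n. 1 / real (n + 2)" 0 sequentially]
          by (cases "1 - (U j k)\<^sup>2 = 0") simp_all
      qed
      show "\<exists>N. \<forall>n\<ge>N. (\<Sum>j\<in>J. \<Sum>k\<in>J. w j * w k * (1 - (U j k)\<^sup>2) powr (1 / real (n + 2))) \<le> (\<Sum>j\<in>J. w j)\<^sup>2"
        by (intro exI allI impI pos) auto
    qed
  qed
  have "(\<Sum>j\<in>J. \<Sum>k\<in>J. w j * w k * (G j j * G k k - (G j k)\<^sup>2) powr (s / 2))
    = (\<Sum>j\<in>J. \<Sum>k\<in>J. (G j j powr (s / 2) * w j) * (G k k powr (s / 2) * w k) * (1 - (U j k)\<^sup>2) powr (s / 2))"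
    unfolding factor by (intro sum.cong refl) (simp only: mult_ac)
  then show ?thesis using bound[of "\<lambda>j. G j j powr (s / 2) * w j"] by linarith
qed

section \<open>Tropical Pluecker relations of real configurations\<close>

text \<open>With M the sum of the x_i, the bounds x_i <= M and a - 1 <= 0 give x_i M^(a - 1) <=
  x_i^a; summing over i produces M^a on the left.\<close>

lemma powr_sum_subadditive:
  fixes x :: "'i \<Rightarrow> real"
  assumes "finite I" and nn: "\<And>i. i \<in> I \<Longrightarrow> 0 \<le> x i" and y: "0 \<le> y" "y \<le> sum x I"
    and a: "0 \<le> a" "a \<le> 1"
  shows "y powr a \<le> (\<Sum>i\<in>I. x i powr a)"
proof (cases "y = 0")
  case True
  then show ?thesis by (simp add: sum_nonneg)
next
  case False
  define M where "M = sum x I"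
  have M: "0 < M" using False y by (simp add: M_def)
  have xM: "x i \<le> M" if "i \<in> I" for i
    unfolding M_def using that assms by (intro member_le_sum) auto
  have "y powr a \<le> M powr a" using y a by (intro powr_mono2) (auto simp: M_def)
  also have "\<dots> = (\<Sum>i\<in>I. x i) * M powr (a - 1)"
    using M by (simp add: powr_mult_base flip: M_def)
  also have "\<dots> \<le> (\<Sum>i\<in>I. x i powr a)"
    unfolding sum_distrib_right
  proof (rule sum_mono)
    fix i assume i: "i \<in> I"
    show "x i * M powr (a - 1) \<le> x i powr a"
    proof (cases "x i = 0")
      case False
      then have x: "0 < x i" using nn[OF i] by simp
      have "M powr (a - 1) \<le> x i powr (a - 1)" using x xM[OF i] a by (intro powr_mono2') auto
      then have "x i * M powr (a - 1) \<le> x i * x i powr (a - 1)" using x by simp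
      also have "\<dots> = x i powr a" using x by (simp add: powr_mult_base)
      finally show ?thesis .
    qed simp
  qed
  finally show ?thesis .
qed

text \<open>A zero sum cannot have exactly one nonzero term, which settles the two extreme values of
  q. For finite positive q the triangle inequality is followed by subadditivity of the power with
  exponent s / q <= 1.\<close>

lemma tropical_null_abs_powr:
  fixes f :: "'i \<Rightarrow> real"
  assumes "finite I" and sum0: "sum f I = 0" and s: "0 \<le> s" "ennreal s \<le> q"
  shows "tropical_null q I (\<lambda>i. \<bar>f i\<bar> powr s)"
proof -
  have other: "\<exists>j\<in>I. j \<noteq> i \<and> f j \<noteq> 0" if "i \<in> I" "f i \<noteq> 0" for i
  proof (rule ccontr)
    assume "\<not> ?thesis"
    then have "sum f (I - {i}) = 0" by (intro sum.neutral) auto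
    then show False using that sum0 sum.remove[OF assms(1) that(1), of f] by linarith
  qed
  consider "q = 0" | "q = \<infinity>" | r where "q = ennreal r" "0 < r"
  proof (cases q)
    case (real r)
    then show ?thesis using that(1) that(3)[of r] by (cases "r = 0") auto
  next
    case top
    then show ?thesis using that(2) by simp
  qed
  then show ?thesis
  proof cases
    case 1
    \<comment> \<open>At exponent 0 the powers form the indicator of the nonzero terms, so the
      maximum is attained twice as soon as one term is nonzero.\<close>
    then have "s = 0" using s by simp
    then show ?thesis using 1 other
      by (auto simp: tropical_null_def Let_def)
  next
    case 2
    show ?thesis
    proof (cases "\<exists>i\<in>I. f i \<noteq> 0")
      case False
      then show ?thesis using 2 by (auto simp: tropical_null_def Let_def)
    next
      case True
      then obtain i j where ij: "i \<in> I" "f i \<noteq> 0" "j \<in> I" "j \<noteq> i" "f j \<noteq> 0" using other by blast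
      show ?thesis
      proof (cases "\<exists>k\<in>I - {i, j}. f k \<noteq> 0")
        case True
        then obtain k where "k \<in> I" "k \<noteq> i" "k \<noteq> j" "f k \<noteq> 0" by blast
        then have "card {i, j, k} \<le> card {i\<in>I. \<bar>f i\<bar> powr s \<noteq> 0}"
          using ij assms(1) by (intro card_mono) auto
        then have "3 \<le> card {i\<in>I. \<bar>f i\<bar> powr s \<noteq> 0}"
          using ij \<open>k \<noteq> i\<close> \<open>k \<noteq> j\<close> by simp
        then show ?thesis using 2 by (simp add: tropical_null_def Let_def)
      next
        \<comment> \<open>Exactly two nonzero terms: they are opposite, so their common absolute
          value is a maximum attained twice.\<close>
        case False
        then have "sum f (I - {i, j}) = 0" by (intro sum.neutral) auto
        moreover have "sum f I = sum f (I - {i, j}) + sum f {i, j}"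
          using assms(1) ij by (intro sum.subset_diff) auto
        ultimately have "\<bar>f i\<bar> = \<bar>f j\<bar>" using sum0 ij by auto
        moreover have "\<bar>f k\<bar> powr s \<le> \<bar>f i\<bar> powr s" if "k \<in> I" for k
          using False that \<open>\<bar>f i\<bar> = \<bar>f j\<bar>\<close> by (cases "k = i \<or> k = j") auto
        ultimately have "\<exists>i\<in>I. \<exists>j\<in>I. i \<noteq> j \<and> \<bar>f i\<bar> powr s = \<bar>f j\<bar> powr s \<and> (\<forall>k\<in>I. \<bar>f k\<bar> powr s \<le> \<bar>f i\<bar> powr s)"
          using ij by (intro bexI[of _ i] bexI[of _ j]) auto
        then show ?thesis using 2 by (simp add: tropical_null_def Let_def)
      qed
    qed
  next
    case 3
    then have "s \<le> r" using s by simp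
    have "(\<bar>f i\<bar> powr s) powr (1 / r) \<le> (\<Sum>j\<in>I - {i}. (\<bar>f j\<bar> powr s) powr (1 / r))" if i: "i \<in> I" for i
    proof -
      have "f i = - sum f (I - {i})" using sum0 sum.remove[OF assms(1) i, of f] by linarith
      then have "\<bar>f i\<bar> \<le> (\<Sum>j\<in>I - {i}. \<bar>f j\<bar>)" using sum_abs[of f "I - {i}"] by linarith
      then show ?thesis unfolding powr_powr using assms(1) 3 s \<open>s \<le> r\<close>
        by (intro powr_sum_subadditive) auto
    qed
    then show ?thesis using 3 by (simp add: tropical_null_def ennreal_eq_0_iff)
  qed
qed

lemma tropical_null_cong:
  assumes "\<And>i. i \<in> I \<Longrightarrow> b i = b' i"
  shows "tropical_null q I b \<longleftrightarrow> tropical_null q I b'"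
proof -
  have "{i \<in> I. b i \<noteq> 0} = {i \<in> I. b' i \<noteq> 0}" using assms by auto
  moreover have "(\<Sum>j\<in>I - {i}. b j powr e) = (\<Sum>j\<in>I - {i}. b' j powr e)" for i e
    using assms by (intro sum.cong) auto
  ultimately show ?thesis unfolding tropical_null_def Let_def using assms
    by (simp cong: ball_cong bex_cong)
qed

lemma tropical_null_scale:
  assumes k: "0 < k" and b: "\<And>i. i \<in> I \<Longrightarrow> 0 \<le> b i"
  shows "tropical_null q I (\<lambda>i. k * b i) \<longleftrightarrow> tropical_null q I b"
proof -
  have "((k * b i) powr e \<le> (\<Sum>j\<in>I - {i}. (k * b j) powr e)) \<longleftrightarrow> (b i powr e \<le> (\<Sum>j\<in>I - {i}. b j powr e))"
    if "i \<in> I" for i e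
  proof -
    have "(\<Sum>j\<in>I - {i}. (k * b j) powr e) = k powr e * (\<Sum>j\<in>I - {i}. b j powr e)"
      unfolding sum_distrib_left using k b by (intro sum.cong refl) (simp add: powr_mult)
    moreover have "(k * b i) powr e = k powr e * b i powr e" using k b that by (simp add: powr_mult)
    ultimately show ?thesis using k by simp
  qed
  then show ?thesis unfolding tropical_null_def Let_def using k by (simp cong: ball_cong)
qed

lemma plucker_null_cong:
  assumes "\<And>x. x \<in> S2 - S1 \<Longrightarrow> \<rho> (insert x S1) * \<rho> (S2 - {x}) = \<sigma> (insert x S1) * \<sigma> (S2 - {x})"
  shows "plucker_null q \<rho> S1 S2 \<longleftrightarrow> plucker_null q \<sigma> S1 S2"
  unfolding plucker_null_def using assms by (rule tropical_null_cong)

lemma plucker_null_rescale: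
  assumes "finite S1" "finite S2" "\<And>i. i \<in> S1 \<union> S2 \<Longrightarrow> 0 < t i" "\<And>S. 0 \<le> \<rho> S"
  shows "plucker_null q (\<lambda>S. (\<Prod>i\<in>S. t i) * \<rho> S) S1 S2 \<longleftrightarrow> plucker_null q \<rho> S1 S2"
proof -
  let ?k = "(\<Prod>i\<in>S1. t i) * (\<Prod>i\<in>S2. t i)"
  have eq: "(\<Prod>i\<in>insert x S1. t i) * \<rho> (insert x S1) * ((\<Prod>i\<in>S2 - {x}. t i) * \<rho> (S2 - {x}))
    = ?k * (\<rho> (insert x S1) * \<rho> (S2 - {x}))" if "x \<in> S2 - S1" for x
    using that assms(1,2) prod.remove[of S2 x t] by simp
  have "0 < ?k" using assms by (intro mult_pos_pos prod_pos) auto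
  then have "tropical_null q (S2 - S1) (\<lambda>x. ?k * (\<rho> (insert x S1) * \<rho> (S2 - {x}))) \<longleftrightarrow>
    tropical_null q (S2 - S1) (\<lambda>x. \<rho> (insert x S1) * \<rho> (S2 - {x}))"
    using assms(4) by (intro tropical_null_scale) auto
  moreover have "plucker_null q (\<lambda>S. (\<Prod>i\<in>S. t i) * \<rho> S) S1 S2 \<longleftrightarrow>
    tropical_null q (S2 - S1) (\<lambda>x. ?k * (\<rho> (insert x S1) * \<rho> (S2 - {x})))"
    unfolding plucker_null_def by (rule tropical_null_cong) (rule eq)
  ultimately show ?thesis unfolding plucker_null_def by simp
qed

text \<open>The ring is left open because the formula is used over the reals, the complex numbers
  and the golden integers. The first index of \<open>V\<close> selects a vector and the second its
  coordinate, so matrix columns appear as rows.\<close>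

definition det3 :: "(nat \<Rightarrow> nat \<Rightarrow> 'a :: comm_ring_1) \<Rightarrow> nat \<Rightarrow> nat \<Rightarrow> nat \<Rightarrow> 'a" where
  "det3 V a b c = V a 0 * (V b 1 * V c 2 - V b 2 * V c 1)
    - V a 1 * (V b 0 * V c 2 - V b 2 * V c 0) + V a 2 * (V b 0 * V c 1 - V b 1 * V c 0)"

text \<open>A set determines its determinant only up to sign. Sorting merely selects some
  enumeration, whose sign the absolute value discards.\<close>

definition abs_minor :: "(nat \<Rightarrow> nat \<Rightarrow> real) \<Rightarrow> nat set \<Rightarrow> real" where
  "abs_minor V S = (if card S = 3 then
     let l = sorted_list_of_set S in \<bar>det3 V (l ! 0) (l ! 1) (l ! 2)\<bar> else 0)"

lemma det3_perm:
  "det3 V a c b = - det3 V a b c" "det3 V b a c = - det3 V a b c" "det3 V c b a = - det3 V a b c"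
  "det3 V b c a = det3 V a b c" "det3 V c a b = det3 V a b c"
  by (simp_all add: det3_def algebra_simps)

lemma det3_eq_0 [simp]: "det3 V a a b = 0" "det3 V a b a = 0" "det3 V b a a = 0"
  by (simp_all add: det3_def algebra_simps)

lemma abs_minor_triple:
  assumes "a \<noteq> b" "a \<noteq> c" "b \<noteq> c"
  shows "abs_minor V {a, b, c} = \<bar>det3 V a b c\<bar>"
proof -
  have sorted: "abs_minor V {a, b, c} = \<bar>det3 V a b c\<bar>" if "a < b" "b < c" for a b c
  proof -
    have "sorted_list_of_set {a, b, c} = [a, b, c]"
      using that by (intro sorted_list_of_set_unique[THEN iffD1]) auto
    then show ?thesis using that by (simp add: abs_minor_def numeral_2_eq_2)
  qed
  have perm: "abs_minor V {a, b, c} = \<bar>det3 V a b c\<bar>"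
    if "abs_minor V {a', b', c'} = \<bar>det3 V a' b' c'\<bar>" "{a', b', c'} = {a, b, c}"
      "\<bar>det3 V a' b' c'\<bar> = \<bar>det3 V a b c\<bar>" for a' b' c'
    using that by metis
  consider "a < b" "b < c" | "a < c" "c < b" | "b < a" "a < c" | "b < c" "c < a" | "c < a" "a < b" | "c < b" "b < a"
    using assms by linarith
  then show ?thesis
  proof cases
    case 1 then show ?thesis by (rule sorted)
  next
    case 2
    then show ?thesis by (intro perm[OF sorted[of a c b]]) (auto simp: det3_perm(1)[of V a c b])
  next
    case 3
    then show ?thesis by (intro perm[OF sorted[of b a c]]) (auto simp: det3_perm(2)[of V b a c])
  next
    case 4
    then show ?thesis by (intro perm[OF sorted[of b c a]]) (auto simp: det3_perm(4)[of V b c a])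
  next
    case 5
    then show ?thesis by (intro perm[OF sorted[of c a b]]) (auto simp: det3_perm(5)[of V c a b])
  next
    case 6
    then show ?thesis by (intro perm[OF sorted[of c b a]]) (auto simp: det3_perm(3)[of V c b a])
  qed
qed

lemma card_4_iff: "card S = 4 \<longleftrightarrow> (\<exists>a b c d. S = {a, b, c, d} \<and> distinct [a, b, c, d])"
proof
  assume "card S = 4"
  then obtain a T where T: "S = insert a T" "a \<notin> T" "card T = 3"
    using card_eq_SucD[of S 3] by auto
  then obtain b c d where "T = {b, c, d}" "b \<noteq> c" "b \<noteq> d" "c \<noteq> d"
    unfolding card_3_iff by blast
  with T show "\<exists>a b c d. S = {a, b, c, d} \<and> distinct [a, b, c, d]"
    by (intro exI[of _ a] exI[of _ b] exI[of _ c] exI[of _ d]) simp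
next
  assume "\<exists>a b c d. S = {a, b, c, d} \<and> distinct [a, b, c, d]"
  then show "card S = 4" by (elim exE conjE) simp
qed

text \<open>The linear form det(a, b, .) applied to Cramer's dependency between the four vectors c,
  d, e, f of three-space.\<close>

lemma plucker_relation:
  "det3 V a b c * det3 V d e f - det3 V a b d * det3 V c e f
    + det3 V a b e * det3 V c d f - det3 V a b f * det3 V c d e = (0 :: 'a :: comm_ring_1)"
  by (simp add: det3_def algebra_simps)

lemma plucker_null_abs_minor_powr:
  assumes "card S1 = 2" "card S2 = 4" and s: "0 \<le> s" "ennreal s \<le> q"
  shows "plucker_null q (\<lambda>S. abs_minor V S powr s) S1 S2"
proof -
  obtain a b where S1: "S1 = {a, b}" "a \<noteq> b" using assms(1) by (meson card_2_iff)
  obtain c d e f where S2: "S2 = {c, d, e, f}" and dist: "distinct [c, d, e, f]"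
    using assms(2) by (meson card_4_iff)
  define g where "g = (\<lambda>x. det3 V a b x * (if x = c then det3 V d e f else if x = d then - det3 V c e f
    else if x = e then det3 V c d f else - det3 V c d e))"
  have "sum g S2 = 0"
    using plucker_relation[of V a b c d e f] dist by (simp add: S2 g_def)
  \<comment> \<open>Elements of \<open>S1\<close> repeat a vector in \<open>det3 V a b x\<close> and
    contribute 0, so the signed sum already has the index set of
    \<open>plucker_null\<close>.\<close>
  moreover have "sum g (S2 - S1) = sum g S2"
    by (intro sum.mono_neutral_left) (auto simp: S1 S2 g_def)
  ultimately have null: "tropical_null q (S2 - S1) (\<lambda>x. \<bar>g x\<bar> powr s)"
    using s by (intro tropical_null_abs_powr) (auto simp: S2)
  have eq: "\<bar>g x\<bar> powr s = abs_minor V (insert x S1) powr s * abs_minor V (S2 - {x}) powr s"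
    if x: "x \<in> S2 - S1" for x
  proof -
    have "insert x S1 = {a, b, x}" using S1 by auto
    then have 1: "abs_minor V (insert x S1) = \<bar>det3 V a b x\<bar>"
      using x S1 by (simp add: abs_minor_triple)
    consider "x = c" | "x = d" | "x = e" | "x = f" using x S2 by blast
    then have "\<bar>g x\<bar> = \<bar>det3 V a b x\<bar> * abs_minor V (S2 - {x})"
    proof cases
      case 1
      then have "S2 - {x} = {d, e, f}" using S2 dist by auto
      then show ?thesis using 1 dist by (simp add: g_def abs_mult abs_minor_triple)
    next
      case 2
      then have "S2 - {x} = {c, e, f}" using S2 dist by auto
      then show ?thesis using 2 dist by (auto simp: g_def abs_mult abs_minor_triple)
    next
      case 3
      then have "S2 - {x} = {c, d, f}" using S2 dist by auto
      then show ?thesis using 3 dist by (auto simp: g_def abs_mult abs_minor_triple)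
    next
      case 4
      then have "S2 - {x} = {c, d, e}" using S2 dist by auto
      then show ?thesis using 4 dist by (auto simp: g_def abs_mult abs_minor_triple)
    qed
    then show ?thesis using 1 by (simp add: powr_mult abs_minor_def Let_def)
  qed
  have "plucker_null q (\<lambda>S. abs_minor V S powr s) S1 S2 \<longleftrightarrow>
    tropical_null q (S2 - S1) (\<lambda>x. \<bar>g x\<bar> powr s)"
    unfolding plucker_null_def by (rule tropical_null_cong) (rule eq[symmetric])
  with null show ?thesis by simp
qed

lemma abs_det3_powr_lorentzian:
  fixes V :: "nat \<Rightarrow> nat \<Rightarrow> real"
  assumes s: "0 \<le> s" "s \<le> 2"
  shows "\<exists>l. \<forall>w. (\<Sum>j<n. \<Sum>k<n. \<bar>det3 V i j k\<bar> powr s * w j * w k) \<le> (\<Sum>j<n. l j * w j)\<^sup>2"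
proof (cases "(\<Sum>c<3. (V i c)\<^sup>2) = 0")
  case True
  then have "V i 0 = 0" "V i 1 = 0" "V i 2 = 0"
    by (auto simp: numeral_3_eq_3 numeral_2_eq_2 add_nonneg_eq_0_iff)
  then have "det3 V i j k = 0" for j k by (simp add: det3_def)
  then show ?thesis by (intro exI[of _ "\<lambda>_. 0"]) simp
next
  case False
  define N where "N = (\<Sum>c<3. (V i c)\<^sup>2)"
  have N: "0 < N" using False sum_nonneg[of "{..<3}" "\<lambda>c. (V i c)\<^sup>2"] by (simp add: N_def less_le)
  define p where "p = (\<lambda>j c. if c = (0::nat) then V i 1 * V j 2 - V i 2 * V j 1
    else if c = 1 then V i 2 * V j 0 - V i 0 * V j 2 else V i 0 * V j 1 - V i 1 * V j 0)"
  define G where "G = (\<lambda>j k. \<Sum>c<3. p j c * p k c)"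
  \<comment> \<open>\<open>p j\<close> is the cross product v_i x v_j, and (v_i x v_j) x (v_i x v_k)
    = det(v_i, v_j, v_k) v_i; squared lengths are then compared by Lagrange's identity.\<close>
  have gram: "N * (det3 V i j k)\<^sup>2 = G j j * G k k - (G j k)\<^sup>2" for j k
    unfolding N_def G_def p_def det3_def by (simp add: numeral_3_eq_3 numeral_2_eq_2 power2_eq_square algebra_simps)
  have eq: "\<bar>det3 V i j k\<bar> powr s = (G j j * G k k - (G j k)\<^sup>2) powr (s / 2) / N powr (s / 2)" for j k
  proof -
    have "\<bar>d\<bar> powr s = (d\<^sup>2) powr (s / 2)" for d :: real
    proof (cases "d = 0")
      case False
      then have "(\<bar>d\<bar> powr 2) powr (s / 2) = (d\<^sup>2) powr (s / 2)" by (simp add: powr_numeral)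
      then show ?thesis using powr_powr[of "\<bar>d\<bar>" 2 "s / 2"] by simp
    qed simp
    then show ?thesis using N unfolding gram[symmetric] by (simp add: powr_mult)
  qed
  have "(\<Sum>j<n. \<Sum>k<n. \<bar>det3 V i j k\<bar> powr s * w j * w k)
    \<le> (\<Sum>j<n. G j j powr (s / 2) / sqrt (N powr (s / 2)) * w j)\<^sup>2" for w
  proof -
    have "(\<Sum>j<n. \<Sum>k<n. \<bar>det3 V i j k\<bar> powr s * w j * w k)
      = (\<Sum>j<n. \<Sum>k<n. w j * w k * (G j j * G k k - (G j k)\<^sup>2) powr (s / 2)) / N powr (s / 2)"
      unfolding eq sum_divide_distrib by (intro sum.cong refl) simp
    also have "\<dots> \<le> (\<Sum>j<n. G j j powr (s / 2) * w j)\<^sup>2 / N powr (s / 2)"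
      using wedge_kernel_bound[OF _ s, of "{..<n}" w p "{..<3}"] unfolding G_def
      by (intro divide_right_mono) auto
    also have "\<dots> = ((\<Sum>j<n. G j j powr (s / 2) * w j) / sqrt (N powr (s / 2)))\<^sup>2"
      by (simp add: power_divide)
    finally show ?thesis by (simp add: sum_divide_distrib)
  qed
  then show ?thesis by (intro exI[of _ "\<lambda>j. G j j powr (s / 2) / sqrt (N powr (s / 2))"]) blast
qed

section \<open>Lorentzian cubics\<close>

lemma lookup_mpoly_deriv:
  "Poly_Mapping.lookup (mpoly_deriv i f) \<beta> =
    of_nat (Poly_Mapping.lookup \<beta> i + 1) * Poly_Mapping.lookup f (\<beta> + Poly_Mapping.single i 1)"
proof -
  let ?b = "\<beta> + Poly_Mapping.single i 1"
  have *: "\<alpha> - Poly_Mapping.single i 1 = \<beta> \<longleftrightarrow> \<alpha> = ?b" if "Poly_Mapping.lookup \<alpha> i \<noteq> 0" for \<alpha>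
  proof
    assume "\<alpha> - Poly_Mapping.single i 1 = \<beta>"
    then have "Poly_Mapping.lookup ?b j = Poly_Mapping.lookup \<alpha> j" for j
      using that by (auto simp: lookup_add lookup_minus lookup_single when_def)
    then show "\<alpha> = ?b" by (intro poly_mapping_eqI) simp
  qed (simp add: poly_mapping_eq_iff fun_eq_iff lookup_add lookup_minus)
  have "Poly_Mapping.lookup (mpoly_deriv i f) \<beta> = (\<Sum>\<alpha>\<in>Poly_Mapping.keys f.
      (of_nat (Poly_Mapping.lookup \<alpha> i) * Poly_Mapping.lookup f \<alpha> when \<alpha> - Poly_Mapping.single i 1 = \<beta>))"
    unfolding mpoly_deriv_def by (simp add: lookup_sum lookup_single)
  also have "\<dots> = (\<Sum>\<alpha>\<in>Poly_Mapping.keys f.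
      if \<alpha> = ?b then of_nat (Poly_Mapping.lookup ?b i) * Poly_Mapping.lookup f ?b else 0)"
  proof (rule sum.cong[OF refl])
    fix \<alpha>
    show "(of_nat (Poly_Mapping.lookup \<alpha> i) * Poly_Mapping.lookup f \<alpha> when \<alpha> - Poly_Mapping.single i 1 = \<beta>)
      = (if \<alpha> = ?b then of_nat (Poly_Mapping.lookup ?b i) * Poly_Mapping.lookup f ?b else 0)"
    proof (cases "Poly_Mapping.lookup \<alpha> i = 0")
      case True
      then have "\<alpha> \<noteq> ?b" by (auto simp: lookup_add)
      with True show ?thesis by simp
    next
      case False
      then show ?thesis using *[OF False] by (simp add: when_def)
    qed
  qed
  also have "\<dots> = of_nat (Poly_Mapping.lookup ?b i) * Poly_Mapping.lookup f ?b"
    by (auto simp: in_keys_iff)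
  finally show ?thesis by (simp add: lookup_add)
qed

definition total_degree :: "(nat \<Rightarrow>\<^sub>0 nat) \<Rightarrow> nat" where
  "total_degree \<alpha> = (\<Sum>i\<in>Poly_Mapping.keys \<alpha>. Poly_Mapping.lookup \<alpha> i)"

lemma total_degree_superset:
  assumes "finite A" "Poly_Mapping.keys \<alpha> \<subseteq> A"
  shows "total_degree \<alpha> = (\<Sum>i\<in>A. Poly_Mapping.lookup \<alpha> i)"
  unfolding total_degree_def using assms
  by (intro sum.mono_neutral_left) (auto simp: in_keys_iff)

lemma total_degree_add: "total_degree (\<alpha> + \<beta>) = total_degree \<alpha> + total_degree \<beta>"
proof -
  let ?A = "Poly_Mapping.keys \<alpha> \<union> Poly_Mapping.keys \<beta>"
  have "total_degree \<gamma> = (\<Sum>i\<in>?A. Poly_Mapping.lookup \<gamma> i)" if "Poly_Mapping.keys \<gamma> \<subseteq> ?A" for \<gamma>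
    using that by (intro total_degree_superset) auto
  then show ?thesis using Poly_Mapping.keys_add[of \<alpha> \<beta>] by (simp add: lookup_add sum.distrib)
qed

lemma total_degree_single [simp]: "total_degree (Poly_Mapping.single i k) = k"
  by (simp add: total_degree_def)

definition homogeneous :: "nat \<Rightarrow> real_mpoly \<Rightarrow> bool" where
  "homogeneous d f \<longleftrightarrow> (\<forall>\<alpha>\<in>Poly_Mapping.keys f. total_degree \<alpha> = d)"

lemma homogeneous_mpoly_deriv:
  assumes "homogeneous d f"
  shows "homogeneous (d - 1) (mpoly_deriv i f)"
  unfolding homogeneous_def
proof
  fix \<beta> assume "\<beta> \<in> Poly_Mapping.keys (mpoly_deriv i f)"
  then have "\<beta> + Poly_Mapping.single i 1 \<in> Poly_Mapping.keys f"
    by (auto simp: in_keys_iff lookup_mpoly_deriv)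
  then have "total_degree (\<beta> + Poly_Mapping.single i 1) = d"
    using assms by (auto simp: homogeneous_def)
  then show "total_degree \<beta> = d - 1" by (simp add: total_degree_add)
qed

lemma homogeneous_mpoly_deriv_funpow:
  assumes "homogeneous d f"
  shows "homogeneous (d - k) ((mpoly_deriv i ^^ k) f)"
  using assms
proof (induction k)
  case (Suc k)
  then show ?case using homogeneous_mpoly_deriv[of "d - k" "(mpoly_deriv i ^^ k) f" i] by simp
qed simp

lemma homogeneous_fold_mpoly_deriv:
  assumes "homogeneous d f"
  shows "homogeneous (d - sum_list (map \<alpha> is)) (fold (\<lambda>i. mpoly_deriv i ^^ \<alpha> i) is f)"
  using assms
proof (induction "is" arbitrary: d f)
  case (Cons i "is")
  from Cons.IH[OF homogeneous_mpoly_deriv_funpow[OF Cons.prems, of "\<alpha> i" i]]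
  show ?case by simp
qed simp

text \<open>The 0 inserted into the maximum is a default for the zero polynomial; a positive degree
  is therefore attained at an actual exponent.\<close>

lemma homogeneous_mpoly_degree:
  assumes "homogeneous d f" "mpoly_degree f = e" "0 < e"
  shows "d = e"
proof -
  have "mpoly_degree f = Max (insert 0 (total_degree ` Poly_Mapping.keys f))"
    unfolding mpoly_degree_def total_degree_def ..
  moreover have "Max (insert 0 (total_degree ` Poly_Mapping.keys f)) \<in> insert 0 (total_degree ` Poly_Mapping.keys f)"
    by (intro Max_in) auto
  ultimately have "e \<in> total_degree ` Poly_Mapping.keys f" using assms by auto
  then show ?thesis using assms(1) by (auto simp: homogeneous_def)
qed

lemma fold_mpoly_deriv_single:
  assumes "sum_list (map \<alpha> is) = 1"
  shows "\<exists>i\<in>set is. fold (\<lambda>i. mpoly_deriv i ^^ \<alpha> i) is f = mpoly_deriv i f"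
  using assms
proof (induction "is" arbitrary: f)
  case (Cons i "is")
  show ?case
  proof (cases "\<alpha> i = 0")
    case True
    then show ?thesis using Cons by simp
  next
    case False
    moreover have "\<alpha> i + sum_list (map \<alpha> is) = 1" using Cons.prems by simp
    ultimately have 1: "\<alpha> i = 1" "sum_list (map \<alpha> is) = 0" by linarith+
    then have "fold (\<lambda>i. mpoly_deriv i ^^ \<alpha> i) is g = g" for g
      by (induction "is") auto
    then show ?thesis using 1 by simp
  qed
qed simp

lemma lookup_indicator_vector: "finite S \<Longrightarrow> Poly_Mapping.lookup (indicator_vector S) i = (if i \<in> S then 1 else 0)"
  by (simp add: indicator_vector_def lookup_sum lookup_single when_def)

lemma keys_indicator_vector: "finite S \<Longrightarrow> Poly_Mapping.keys (indicator_vector S) = S"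
  by (auto simp: in_keys_iff lookup_indicator_vector split: if_splits)

lemma indicator_vector_eq_iff: "finite S \<Longrightarrow> finite T \<Longrightarrow> indicator_vector S = indicator_vector T \<longleftrightarrow> S = T"
  using keys_indicator_vector by metis

lemma total_degree_indicator_vector: "finite S \<Longrightarrow> total_degree (indicator_vector S) = card S"
  by (simp add: total_degree_def keys_indicator_vector lookup_indicator_vector)

text \<open>For a multiaffine cubic this is the Hessian of the i-th partial derivative, i.e. the
  coefficients on the link of i. The cardinality guard clears entries with a repeated index, where
  the set collapses.\<close>

definition contraction_matrix :: "(nat set \<Rightarrow> real) \<Rightarrow> nat \<Rightarrow> nat \<Rightarrow> nat \<Rightarrow> real" where
  "contraction_matrix \<rho> i j k = (if card {i, j, k} = 3 then \<rho> {i, j, k} else 0)"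

lemma contraction_matrix_sym: "contraction_matrix \<rho> i j k = contraction_matrix \<rho> i k j"
  by (simp add: contraction_matrix_def insert_commute)

context
  fixes n :: nat and B :: "nat set set" and f :: real_mpoly
  assumes B: "\<And>S. S \<in> B \<Longrightarrow> S \<subseteq> {..<n} \<and> card S = 3"
    and keys: "Poly_Mapping.keys f = indicator_vector ` B"
begin

lemma finite_basis: "S \<in> B \<Longrightarrow> finite S"
  using B finite_subset by blast

lemma homogeneous_3: "homogeneous 3 f"
  unfolding homogeneous_def keys using B by (auto simp: total_degree_indicator_vector finite_basis)

lemma indicator_vector_in_keys: "finite S \<Longrightarrow> indicator_vector S \<in> Poly_Mapping.keys f \<longleftrightarrow> S \<in> B"
  unfolding keys using finite_basis indicator_vector_eq_iff by (auto simp: image_iff)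

lemma coeff_function_support: "{S. coeff_function f S \<noteq> 0} = B"
  using indicator_vector_in_keys finite_basis by (auto simp: coeff_function_def in_keys_iff)

lemma hessian_mpoly_deriv:
  "hessian n (mpoly_deriv i f) = mat n n (\<lambda>(j, k). contraction_matrix (coeff_function f) i j k)"
proof (rule eq_matI)
  fix j k assume "j < dim_row (mat n n (\<lambda>(j, k). contraction_matrix (coeff_function f) i j k))"
    "k < dim_col (mat n n (\<lambda>(j, k). contraction_matrix (coeff_function f) i j k))"
  then have jk: "j < n" "k < n" by auto
  let ?v = "Poly_Mapping.single j 1 + Poly_Mapping.single k 1 + Poly_Mapping.single i (1::nat)"
  have "Poly_Mapping.lookup (mpoly_deriv j (mpoly_deriv k (mpoly_deriv i f))) 0
    = contraction_matrix (coeff_function f) i j k"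
  proof (cases "card {i, j, k} = 3")
    case True
    then have d: "i \<noteq> j" "i \<noteq> k" "j \<noteq> k" by (auto simp: card_insert_if split: if_splits)
    then have "indicator_vector {i, j, k} = ?v"
      by (simp add: indicator_vector_def add_ac)
    then show ?thesis using True d
      by (simp add: contraction_matrix_def lookup_mpoly_deriv coeff_function_def lookup_add lookup_single)
  next
    case False
    have "?v \<notin> Poly_Mapping.keys f"
    proof
      assume "?v \<in> Poly_Mapping.keys f"
      then obtain S where S: "S \<in> B" "?v = indicator_vector S" unfolding keys by auto
      have "card {i, j, k} = 3"
      proof (rule ccontr)
        assume "card {i, j, k} \<noteq> 3"
        then have "i = j \<or> i = k \<or> j = k" using card_3_iff[of "{i, j, k}"] by blast
        then have "2 \<le> Poly_Mapping.lookup ?v i \<or> 2 \<le> Poly_Mapping.lookup ?v j"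
          by (elim disjE) (simp_all add: lookup_add lookup_single)
        then show False unfolding S(2) using finite_basis[OF S(1)]
            by (simp add: lookup_indicator_vector split: if_splits)
      qed
      with False show False ..
    qed
    then show ?thesis using False
      by (simp add: contraction_matrix_def lookup_mpoly_deriv in_keys_iff)
  qed
  then show "hessian n (mpoly_deriv i f) $$ (j, k) = mat n n (\<lambda>(j, k). contraction_matrix (coeff_function f) i j k) $$ (j, k)"
    using jk by (simp add: hessian_def)
qed (auto simp: hessian_def)

text \<open>The Hessian condition speaks only about derivatives of degree 2. A vanishing derivative
  has degree 0 and is treated apart; its matrix is zero.\<close>

lemma lorentzian_quadratic_bound:
  assumes "lorentzian n f" and "i < n"
  shows "\<exists>l. \<forall>x. (\<Sum>j<n. \<Sum>k<n. contraction_matrix (coeff_function f) i j k * x j * x k) \<le> (\<Sum>j<n. l j * x j)\<^sup>2"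
proof (cases "mpoly_deriv i f = 0")
  case True
  have "contraction_matrix (coeff_function f) i j k = 0" if "j < n" "k < n" for j k
  proof -
    have "hessian n (mpoly_deriv i f) $$ (j, k) = 0"
      using that by (simp add: hessian_def True lookup_mpoly_deriv)
    then show ?thesis using that by (simp add: hessian_mpoly_deriv)
  qed
  then show ?thesis by (intro exI[of _ "\<lambda>_. 0"]) simp
next
  case False
  let ?\<alpha> = "\<lambda>j. if j = i then 1 else (0::nat)"
  have "[0..<n] = [0..<i] @ i # [Suc i..<n]"
    using assms(2) upt_add_eq_append[of 0 i "n - i"] upt_conv_Cons[of i n] by simp
  moreover have "fold (\<lambda>j. mpoly_deriv j ^^ ?\<alpha> j) is g = g" if "i \<notin> set is" for "is" g
    using that by (induction "is") auto
  ultimately have D: "mpoly_derivs n ?\<alpha> f = mpoly_deriv i f"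
    unfolding mpoly_derivs_def by simp
  have hom: "homogeneous 2 (mpoly_deriv i f)" using homogeneous_mpoly_deriv[OF homogeneous_3] by simp
  have "Poly_Mapping.keys (mpoly_deriv i f) \<noteq> {}" using False by simp
  then have "total_degree ` Poly_Mapping.keys (mpoly_deriv i f) = {2}"
    using hom by (simp add: homogeneous_def image_constant_conv cong: image_cong)
  then have "mpoly_degree (mpoly_derivs n ?\<alpha> f) = 2"
    unfolding D mpoly_degree_def total_degree_def[symmetric] by simp
  then have "at_most_one_positive_eigenvalue (hessian n (mpoly_deriv i f))"
    using assms(1) D unfolding lorentzian_def by metis
  then show ?thesis
    unfolding hessian_mpoly_deriv using at_most_one_positive_eigenvalue_iff[OF contraction_matrix_sym] by simp
qed

text \<open>Homogeneity of degree 3 leaves only first-order derivatives to inspect, that is, one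
  quadratic form for each link.\<close>

lemma lorentzianI:
  assumes nonneg: "\<And>\<alpha>. 0 \<le> Poly_Mapping.lookup f \<alpha>" and ne: "B \<noteq> {}"
    and exch: "\<And>S T i. S \<in> B \<Longrightarrow> T \<in> B \<Longrightarrow> i \<in> S - T \<Longrightarrow> \<exists>j\<in>T - S. insert j (S - {i}) \<in> B"
    and quad: "\<And>i. i < n \<Longrightarrow>
      \<exists>l. \<forall>x. (\<Sum>j<n. \<Sum>k<n. contraction_matrix (coeff_function f) i j k * x j * x k) \<le> (\<Sum>j<n. l j * x j)\<^sup>2"
  shows "lorentzian n f"
  unfolding lorentzian_def
proof (intro conjI allI impI)
  show "in_variables n f"
    unfolding in_variables_def keys using B finite_basis by (auto simp: keys_indicator_vector)
  show "f \<noteq> 0" using keys ne by auto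
  show "0 \<le> Poly_Mapping.lookup f \<alpha>" for \<alpha> by (rule nonneg)
  show "M_convex (Poly_Mapping.keys f)"
    unfolding M_convex_def keys
  proof (intro ballI allI impI)
    fix \<alpha> \<beta> i assume "\<alpha> \<in> indicator_vector ` B" "\<beta> \<in> indicator_vector ` B"
    then obtain S T where ST: "S \<in> B" "T \<in> B" "\<alpha> = indicator_vector S" "\<beta> = indicator_vector T" by auto
    assume "Poly_Mapping.lookup \<beta> i < Poly_Mapping.lookup \<alpha> i"
    then have i: "i \<in> S - T" using ST by (auto simp: lookup_indicator_vector finite_basis split: if_splits)
    from exch[OF ST(1,2) i] obtain j where j: "j \<in> T - S" "insert j (S - {i}) \<in> B" by blast
    have "\<alpha> - Poly_Mapping.single i 1 + Poly_Mapping.single j 1 = indicator_vector (insert j (S - {i}))"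
      using finite_basis[OF ST(1)] i j unfolding ST(3)
      by (intro poly_mapping_eqI) (auto simp: lookup_add lookup_minus lookup_indicator_vector lookup_single when_def)
    then show "\<exists>j. Poly_Mapping.lookup \<alpha> j < Poly_Mapping.lookup \<beta> j \<and>
        \<alpha> - Poly_Mapping.single i 1 + Poly_Mapping.single j 1 \<in> indicator_vector ` B"
      using j ST by (intro exI[of _ j]) (auto simp: lookup_indicator_vector finite_basis)
  qed
  fix \<alpha> assume deg: "mpoly_degree (mpoly_derivs n \<alpha> f) = 2"
  have "homogeneous (3 - sum_list (map \<alpha> [0..<n])) (mpoly_derivs n \<alpha> f)"
    unfolding mpoly_derivs_def by (rule homogeneous_fold_mpoly_deriv[OF homogeneous_3])
  from homogeneous_mpoly_degree[OF this deg] have "sum_list (map \<alpha> [0..<n]) = 1" by linarith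
  from fold_mpoly_deriv_single[OF this, of f] obtain i where
    i: "i < n" "mpoly_derivs n \<alpha> f = mpoly_deriv i f" unfolding mpoly_derivs_def by auto
  show "at_most_one_positive_eigenvalue (hessian n (mpoly_derivs n \<alpha> f))"
    unfolding i(2) hessian_mpoly_deriv
    using at_most_one_positive_eigenvalue_iff[OF contraction_matrix_sym] quad[OF i(1)] by simp
qed

end

section \<open>Stable cubics\<close>

text \<open>With \<open>subset_sum_insert\<close> as a rewrite rule, a sum over the k-subsets of an
  explicitly listed set unfolds completely, so identities for concrete configurations become
  calculations.\<close>

definition subset_sum :: "nat \<Rightarrow> 'a set \<Rightarrow> ('a set \<Rightarrow> 'b :: comm_monoid_add) \<Rightarrow> 'b" where
  "subset_sum k P g = (\<Sum>S | S \<subseteq> P \<and> card S = k. g S)"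

lemma subset_sum_0 [simp]: "finite P \<Longrightarrow> subset_sum 0 P g = g {}"
proof -
  assume "finite P"
  then have "{S. S \<subseteq> P \<and> card S = 0} = {{}}" using finite_subset by fastforce
  then show ?thesis by (simp add: subset_sum_def)
qed

lemma subset_sum_Suc_empty [simp]: "subset_sum (Suc k) {} g = 0"
  unfolding subset_sum_def by (rule sum.neutral) auto

lemma subset_sum_insert:
  assumes "finite P" "a \<notin> P"
  shows "subset_sum (Suc k) (insert a P) g = subset_sum (Suc k) P g + subset_sum k P (\<lambda>S. g (insert a S))"
proof -
  have fin: "finite {S. S \<subseteq> P \<and> card S = m}" for m using assms(1) by simp
  have eq: "{S. S \<subseteq> insert a P \<and> card S = Suc k}
    = {S. S \<subseteq> P \<and> card S = Suc k} \<union> insert a ` {S. S \<subseteq> P \<and> card S = k}"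
  proof (intro equalityI subsetI)
    fix S assume S: "S \<in> {S. S \<subseteq> insert a P \<and> card S = Suc k}"
    show "S \<in> {S. S \<subseteq> P \<and> card S = Suc k} \<union> insert a ` {S. S \<subseteq> P \<and> card S = k}"
    proof (cases "a \<in> S")
      case True
      then have "S = insert a (S - {a})" by blast
      moreover have "S - {a} \<subseteq> P" "card (S - {a}) = k" using S True by auto
      ultimately show ?thesis by blast
    qed (use S in auto)
  next
    fix S assume "S \<in> {S. S \<subseteq> P \<and> card S = Suc k} \<union> insert a ` {S. S \<subseteq> P \<and> card S = k}"
    then show "S \<in> {S. S \<subseteq> insert a P \<and> card S = Suc k}"
    proof
      assume "S \<in> insert a ` {S. S \<subseteq> P \<and> card S = k}"
      then obtain T where "S = insert a T" "T \<subseteq> P" "card T = k" by blast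
      moreover from this have "finite T" "a \<notin> T" using assms finite_subset by blast+
      ultimately show ?thesis by auto
    qed auto
  qed
  have inj: "inj_on (insert a) {S. S \<subseteq> P \<and> card S = k}"
    using assms(2) by (intro inj_onI) (metis (no_types, lifting) insert_ident mem_Collect_eq subsetD)
  show ?thesis
    unfolding subset_sum_def eq
    by (subst sum.union_disjoint) (use assms fin inj in \<open>auto simp: sum.reindex o_def\<close>)
qed

lemma subset_sum_cong:
  "(\<And>S. S \<subseteq> P \<Longrightarrow> card S = k \<Longrightarrow> g S = h S) \<Longrightarrow> subset_sum k P g = subset_sum k P h"
  unfolding subset_sum_def by (rule sum.cong) auto

lemma subset_sum_mono_neutral:
  assumes "finite Q" "P \<subseteq> Q" "\<And>S. S \<subseteq> Q \<Longrightarrow> \<not> S \<subseteq> P \<Longrightarrow> g S = 0"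
  shows "subset_sum k Q g = subset_sum k P g"
  unfolding subset_sum_def by (rule sum.mono_neutral_right) (use assms in auto)

lemma subset_sum_mult_left: "subset_sum k P (\<lambda>S. a * g S :: 'b :: comm_semiring_0) = a * subset_sum k P g"
  by (simp add: subset_sum_def sum_distrib_left)

definition cubic :: "(nat set \<Rightarrow> real) \<Rightarrow> nat \<Rightarrow> (nat \<Rightarrow> complex) \<Rightarrow> complex" where
  "cubic c n z = subset_sum 3 {..<n} (\<lambda>S. of_real (c S) * (\<Prod>i\<in>S. z i))"

definition stable_cubic :: "(nat set \<Rightarrow> real) \<Rightarrow> nat \<Rightarrow> bool" where
  "stable_cubic c n \<longleftrightarrow> (\<forall>z. (\<forall>i<n. 0 < Im (z i)) \<longrightarrow> cubic c n z \<noteq> 0)"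

lemma stable_cubic_rescale:
  assumes "stable_cubic c n" "\<forall>i<n. 0 < t i"
  shows "stable_cubic (\<lambda>S. (\<Prod>i\<in>S. t i) * c S) n"
  unfolding stable_cubic_def
proof (intro allI impI)
  fix z :: "nat \<Rightarrow> complex" assume "\<forall>i<n. 0 < Im (z i)"
  then have "\<forall>i<n. 0 < Im (of_real (t i) * z i)" using assms(2) by simp
  then have "cubic c n (\<lambda>i. of_real (t i) * z i) \<noteq> 0"
    by (intro assms(1)[unfolded stable_cubic_def, rule_format]) blast
  moreover have "cubic (\<lambda>S. (\<Prod>i\<in>S. t i) * c S) n z = cubic c n (\<lambda>i. of_real (t i) * z i)"
    unfolding cubic_def
    by (rule subset_sum_cong) (simp only: of_real_mult of_real_prod prod.distrib mult_ac)
  ultimately show "cubic (\<lambda>S. (\<Prod>i\<in>S. t i) * c S) n z \<noteq> 0" by simp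
qed

text \<open>
  A root with nonnegative imaginary parts can be moved into the open upper half-planes as long as
  the partial derivative in a variable with positive imaginary part does not vanish there.
\<close>

lemma stable_cubic_boundary:
  assumes stab: "stable_cubic c n" and j: "j < n" and im: "\<And>i. i < n \<Longrightarrow> i \<noteq> j \<Longrightarrow> 0 \<le> Im (z i)"
  defines "p \<equiv> subset_sum 3 ({..<n} - {j}) (\<lambda>S. of_real (c S) * (\<Prod>i\<in>S. z i))"
    and "q \<equiv> subset_sum 2 ({..<n} - {j}) (\<lambda>S. of_real (c (insert j S)) * (\<Prod>i\<in>S. z i))"
  shows "Im (- p / q) \<le> 0"
proof (rule ccontr)
  assume contra: "\<not> ?thesis"
  define zz where "zz = (\<lambda>e i. z i + \<i> * of_real e)"
  define P where "P = (\<lambda>e::real. subset_sum 3 ({..<n} - {j}) (\<lambda>S. of_real (c S) * (\<Prod>i\<in>S. zz e i)))"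
  define Q where "Q = (\<lambda>e::real. subset_sum 2 ({..<n} - {j}) (\<lambda>S. of_real (c (insert j S)) * (\<Prod>i\<in>S. zz e i)))"
  \<comment> \<open>For q = 0 the quotient is 0 by convention, and its imaginary part is not
    positive.\<close>
  have "q \<noteq> 0" using contra by auto
  have zz: "((\<lambda>e. zz e i) \<longlongrightarrow> z i) (at_right 0)" for i
  proof -
    have "((\<lambda>e. z i + \<i> * complex_of_real e) \<longlongrightarrow> z i + \<i> * complex_of_real 0) (at_right 0)"
      by (intro tendsto_intros)
    then show ?thesis by (simp add: zz_def)
  qed
  have "(P \<longlongrightarrow> p) (at_right 0)" "(Q \<longlongrightarrow> q) (at_right 0)"
    unfolding P_def Q_def p_def q_def subset_sum_def by (intro tendsto_intros zz)+
  then have "((\<lambda>e. Im (- P e / Q e)) \<longlongrightarrow> Im (- p / q)) (at_right 0)"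
    using \<open>q \<noteq> 0\<close> by (intro tendsto_intros)
  then have "eventually (\<lambda>e. 0 < Im (- P e / Q e)) (at_right 0)"
    using contra by (intro order_tendstoD(1)) auto
  moreover have "eventually (\<lambda>e::real. 0 < e) (at_right 0)" by (simp add: eventually_at_filter)
  ultimately have "eventually (\<lambda>e. 0 < Im (- P e / Q e) \<and> 0 < e) (at_right 0)"
    by (rule eventually_conj)
  then obtain e where e: "0 < Im (- P e / Q e)" "0 < e"
    using eventually_happens[of _ "at_right (0::real)"] by auto
  \<comment> \<open>The cubic is affine in variable j, with constant term \<open>P e\<close> and
    slope \<open>Q e\<close>. Coordinate j is set to the root, which lies in the open upper
    half-plane.\<close>
  define y where "y = (zz e)(j := - P e / Q e)"
  have Q0: "Q e \<noteq> 0" using e(1) by auto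
  have "{..<n} = insert j ({..<n} - {j})" using j by auto
  then have "cubic c n y = subset_sum (Suc 2) (insert j ({..<n} - {j})) (\<lambda>S. of_real (c S) * (\<Prod>i\<in>S. y i))"
    by (simp add: cubic_def numeral_3_eq_3 numeral_2_eq_2)
  also have "\<dots> = subset_sum 3 ({..<n} - {j}) (\<lambda>S. of_real (c S) * (\<Prod>i\<in>S. y i))
    + subset_sum 2 ({..<n} - {j}) (\<lambda>S. of_real (c (insert j S)) * (\<Prod>i\<in>insert j S. y i))"
    by (subst subset_sum_insert) (auto simp: numeral_3_eq_3 numeral_2_eq_2)
  also have "subset_sum 3 ({..<n} - {j}) (\<lambda>S. of_real (c S) * (\<Prod>i\<in>S. y i)) = P e"
    unfolding P_def by (rule subset_sum_cong) (auto simp: y_def intro!: prod.cong)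
  also have "subset_sum 2 ({..<n} - {j}) (\<lambda>S. of_real (c (insert j S)) * (\<Prod>i\<in>insert j S. y i)) = y j * Q e"
    unfolding Q_def subset_sum_mult_left[symmetric]
  proof (rule subset_sum_cong)
    fix S assume S: "S \<subseteq> {..<n} - {j}" "card S = 2"
    then have "finite S" "j \<notin> S" using finite_subset by blast+
    moreover have "(\<Prod>i\<in>S. y i) = (\<Prod>i\<in>S. zz e i)" using \<open>j \<notin> S\<close> by (intro prod.cong) (auto simp: y_def)
    ultimately show "of_real (c (insert j S)) * (\<Prod>i\<in>insert j S. y i) = y j * (of_real (c (insert j S)) * (\<Prod>i\<in>S. zz e i))"
      by simp
  qed
  also have "P e + y j * Q e = 0" using Q0 by (simp add: y_def)
  finally have "cubic c n y = 0" .
  moreover have "0 < Im (y i)" if "i < n" for i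
    using e im[OF that] by (cases "i = j") (simp_all add: y_def zz_def)
  ultimately show False using stab unfolding stable_cubic_def by blast
qed

text \<open>Variables outside \<open>P\<close> are set to 0, a boundary point of the half-plane,
  which erases every monomial that involves them.\<close>

lemma stable_cubic_boundary_support:
  assumes stab: "stable_cubic c n" and P: "P \<subseteq> {..<n}" and j: "j < n" "j \<notin> P"
    and im: "\<And>i. i \<in> P \<Longrightarrow> 0 \<le> Im (z i)"
  shows "Im (- subset_sum 3 P (\<lambda>S. of_real (c S) * (\<Prod>i\<in>S. z i))
    / subset_sum 2 P (\<lambda>S. of_real (c (insert j S)) * (\<Prod>i\<in>S. z i))) \<le> 0"
proof -
  define y where "y = (\<lambda>i. if i \<in> P then z i else 0)"
  have *: "subset_sum k ({..<n} - {j}) (\<lambda>S. of_real (g S) * (\<Prod>i\<in>S. y i))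
    = subset_sum k P (\<lambda>S. of_real (g S) * (\<Prod>i\<in>S. z i))" for k and g :: "nat set \<Rightarrow> real"
  proof -
    have "subset_sum k ({..<n} - {j}) (\<lambda>S. of_real (g S) * (\<Prod>i\<in>S. y i))
      = subset_sum k P (\<lambda>S. of_real (g S) * (\<Prod>i\<in>S. y i))"
    proof (rule subset_sum_mono_neutral)
      fix S assume "S \<subseteq> {..<n} - {j}" "\<not> S \<subseteq> P"
      moreover from this have "finite S" by (meson finite_Diff finite_lessThan finite_subset)
      ultimately have "(\<Prod>i\<in>S. y i) = 0" by (intro prod_zero) (auto simp: y_def)
      then show "of_real (g S) * (\<Prod>i\<in>S. y i) = 0" by simp
    qed (use P j in auto)
    also have "\<dots> = subset_sum k P (\<lambda>S. of_real (g S) * (\<Prod>i\<in>S. z i))"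
      by (rule subset_sum_cong) (auto simp: y_def intro!: prod.cong)
    finally show ?thesis .
  qed
  have "0 \<le> Im (y i)" for i using im by (simp add: y_def)
  then show ?thesis using stable_cubic_boundary[OF stab j(1), of y] unfolding * by blast
qed

lemma quadratic_nonneg_leading:
  fixes a b c :: real
  assumes "\<And>x. 0 \<le> a * x\<^sup>2 + b * x + c"
  shows "0 \<le> a"
proof (rule ccontr)
  assume "\<not> ?thesis"
  then have a: "a < 0" by simp
  \<comment> \<open>Makes -a x larger than |b| + |c| and x at least 1, so that the leading term
    outweighs the other two.\<close>
  define x where "x = (\<bar>b\<bar> + \<bar>c\<bar> + 1) / (- a) + 1"
  have "0 \<le> (\<bar>b\<bar> + \<bar>c\<bar> + 1) / (- a)" using a by (intro divide_nonneg_pos) auto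
  then have x1: "1 \<le> x" unfolding x_def by linarith
  have "- a * x = \<bar>b\<bar> + \<bar>c\<bar> + 1 - a" using a by (simp add: x_def field_simps)
  then have "- a * x\<^sup>2 = (\<bar>b\<bar> + \<bar>c\<bar> + 1 - a) * x" by (simp add: power2_eq_square flip: mult.assoc)
  moreover have "b * x \<le> \<bar>b\<bar> * x" using x1 by (intro mult_right_mono) auto
  moreover have "c \<le> \<bar>c\<bar> * x" using mult_left_mono[OF x1, of "\<bar>c\<bar>"] by simp
  moreover have "0 < (1 - a) * x" using a x1 by simp
  ultimately have "a * x\<^sup>2 + b * x + c < 0" by (simp add: algebra_simps)
  with assms[of x] show False by simp
qed

text \<open>The Rayleigh inequality F F_ij <= F_i F_j for the derivative F of the cubic in variable
  m, at z_i = z_j = 0, z_k = x, z_l = y. Taking z_i to be the imaginary unit and z_m = T real gives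
  a quadratic in T that is nonnegative for all T; its leading coefficient isolates the link of m.
  Real points are boundary points, so x and y are arbitrary reals.\<close>

lemma stable_cubic_rayleigh:
  assumes stab: "stable_cubic c n" and lt: "m < n" "i < n" "j < n" "k < n" "l < n"
    and d: "distinct [m, i, j, k, l]"
  shows "c {m, k, l} * c {m, i, j} * (x * y)
    \<le> (c {m, i, k} * x + c {m, i, l} * y) * (c {m, j, k} * x + c {m, j, l} * y)"
proof -
  have ne: "m \<noteq> i" "m \<noteq> j" "m \<noteq> k" "m \<noteq> l" "i \<noteq> m" "i \<noteq> j" "i \<noteq> k"
      "i \<noteq> l" "j \<noteq> m" "j \<noteq> i" "j \<noteq> k" "j \<noteq> l" "k \<noteq> m" "k \<noteq> i" "k \<noteq> j" "k \<noteq> l" "l \<noteq> m" "l \<noteq> i" "l \<noteq> j" "l \<noteq> k"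
    using d by auto
  define a b d' e where "a = c {m, k, l} * x * y" and "b = c {m, i, k} * x + c {m, i, l} * y"
    and "d' = c {m, j, k} * x + c {m, j, l} * y" and "e = c {m, i, j}"
  \<comment> \<open>The unprimed quantities collect the terms that contain \<open>m\<close> and get
    multiplied by T; the primed ones collect the terms free of \<open>m\<close>.\<close>
  define b' c' e' where "b' = c {i, k, l} * x * y" and "c' = c {j, k, l} * x * y"
    and "e' = c {i, j, k} * x + c {i, j, l} * y"
  have "0 \<le> (b' + T * b) * (c' + T * d') - (T * a) * (e' + T * e)" for T :: real
  proof (rule ccontr)
    assume neg: "\<not> ?thesis"
    define z where "z = (\<lambda>v. if v = i then \<i> else complex_of_real (if v = m then T else if v = k then x else y))"
    let ?P = "insert m (insert k (insert l {i}))"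
    have p: "subset_sum 3 ?P (\<lambda>S. of_real (c S) * (\<Prod>i\<in>S. z i)) = of_real (T * a) + of_real (b' + T * b) * \<i>"
      unfolding numeral_3_eq_3
      by (simp add: ne subset_sum_insert z_def a_def b_def b'_def) (simp add: insert_commute algebra_simps)
    have q: "subset_sum 2 ?P (\<lambda>S. of_real (c (insert j S)) * (\<Prod>i\<in>S. z i)) = of_real (c' + T * d') + of_real (e' + T * e) * \<i>"
      unfolding numeral_2_eq_2
      by (simp add: ne subset_sum_insert z_def c'_def d'_def e'_def e_def) (simp add: insert_commute algebra_simps)
    have "Im (- (of_real (T * a) + of_real (b' + T * b) * \<i>) / (of_real (c' + T * d') + of_real (e' + T * e) * \<i>)) \<le> 0"
      unfolding p[symmetric] q[symmetric] using lt d
      by (intro stable_cubic_boundary_support[OF stab]) (auto simp: z_def)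
    moreover have "Im (- (of_real A + of_real B * \<i>) / (of_real C + of_real D * \<i>))
        = (A * D - B * C) / (C\<^sup>2 + D\<^sup>2)" for A B C D :: real
      by (simp add: Im_divide algebra_simps)
    ultimately have "((T * a) * (e' + T * e) - (b' + T * b) * (c' + T * d')) / ((c' + T * d')\<^sup>2 + (e' + T * e)\<^sup>2) \<le> 0"
      by (simp only:)
    moreover have "0 < (c' + T * d')\<^sup>2 + (e' + T * e)\<^sup>2"
      using neg by (auto simp: sum_power2_gt_zero_iff)
    ultimately show False using neg by (simp add: divide_le_0_iff)
  qed
  then have "0 \<le> (b * d' - a * e) * T\<^sup>2 + (b' * d' + b * c' - a * e') * T + b' * c'" for T
    by (simp add: algebra_simps power2_eq_square)
  from quadratic_nonneg_leading[OF this] show ?thesis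
    unfolding a_def b_def d'_def e_def by (simp add: mult_ac)
qed

text \<open>
  The points \<open>a, b, c, d\<close> are the vertices of a parallelogram with \<open>x\<close> and \<open>y\<close> the directions of
  its sides, and \<open>z\<close> is a third direction. For the squares of the minors of such a configuration
  the conclusion is the parallelogram law and holds with equality.
\<close>

lemma stable_cubic_parallelogram:
  fixes r :: "nat set \<Rightarrow> real"
  assumes stab: "stable_cubic r n"
    and lt: "{a, b, c, d, x, y, z} \<subseteq> {..<n}" and dist: "distinct [a, b, c, d, x, y, z]"
    and pos: "0 < u" "0 < p" "0 < q"
    and abcd: "r {a, b, c} = 1" "r {a, b, d} = 1" "r {a, c, d} = 1" "r {b, c, d} = 1"
    and x: "r {a, b, x} = 0" "r {a, c, x} = 1" "r {a, d, x} = 1" "r {b, c, x} = 1" "r {b, d, x} = 1" "r {c, d, x} = 0"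
    and y: "r {a, b, y} = 1" "r {a, c, y} = 1" "r {a, d, y} = 0" "r {b, c, y} = 0" "r {b, d, y} = 1" "r {c, d, y} = 1"
    and xy: "r {a, x, y} = 1" "r {b, x, y} = 1" "r {c, x, y} = 1" "r {d, x, y} = 1"
    and z: "r {z, a, b} = u" "r {z, a, c} = p" "r {z, a, d} = 1" "r {z, b, c} = 1" "r {z, b, d} = q" "r {z, c, d} = u"
    and xz: "r {z, a, x} = u" "r {z, b, x} = u" "r {z, c, x} = u" "r {z, d, x} = u"
    and yz: "r {z, a, y} = 1" "r {z, b, y} = 1" "r {z, c, y} = 1" "r {z, d, y} = 1"
    and xyz: "r {z, x, y} = 0"
  shows "2 * u + 2 \<le> p + q"
proof (rule ccontr)
  assume contra: "\<not> ?thesis"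
  have ne: "a \<noteq> b" "a \<noteq> c" "a \<noteq> d" "a \<noteq> x" "a \<noteq> y" "b \<noteq> a" "b \<noteq> c"
      "b \<noteq> d" "b \<noteq> x" "b \<noteq> y" "c \<noteq> a" "c \<noteq> b" "c \<noteq> d" "c \<noteq> x"
      "c \<noteq> y" "d \<noteq> a" "d \<noteq> b" "d \<noteq> c" "d \<noteq> x" "d \<noteq> y" "x \<noteq> a"
      "x \<noteq> b" "x \<noteq> c" "x \<noteq> d" "x \<noteq> y" "y \<noteq> a" "y \<noteq> b" "y \<noteq> c" "y \<noteq> d" "y \<noteq> x"
    using dist by auto
  define k where "k = (2 * u + 2 - p - q) / 4"
  have k: "0 < k" using contra by (simp add: k_def)
  \<comment> \<open>Chosen so that 4 k g^2 cancels -32 (u + 1) in the coefficient of X^2 in the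
    final numerator, which leaves \<open>l > 0\<close>.\<close>
  define g where "g = sqrt (8 * (u + 1) / k)"
  have g: "g\<^sup>2 * k = 8 * (u + 1)" using k pos by (simp add: g_def)
  define N where "N = - (2 * u + 2 + p + q) - k * g\<^sup>2"
  define l where "l = 4 * (2 * u + 2 + p + q)"
  have "\<exists>X. 0 < l * X\<^sup>2 + (- 8 * g * (p - q)) * X + (4 + g\<^sup>2) * N"
  proof (rule ccontr)
    assume "\<not> ?thesis"
    then have "0 \<le> (- l) * X\<^sup>2 + (8 * g * (p - q)) * X + (- (4 + g\<^sup>2) * N)" for X
      by (simp add: not_less algebra_simps)
    from quadratic_nonneg_leading[OF this] show False using pos by (simp add: l_def)
  qed
  then obtain X where X: "0 < l * X\<^sup>2 + (- 8 * g * (p - q)) * X + (4 + g\<^sup>2) * N" by blast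
  \<comment> \<open>Opposite vertices receive the same value. Since A + B is twice the imaginary
    unit and A B = -(1 + g^2 / 4), the real part \<open>N\<close> of the denominator is independent
    of X and contains the defect k with factor g^2.\<close>
  define A where "A = Complex (g / 2) 1"
  define B where "B = Complex (- g / 2) 1"
  define w where "w = (\<lambda>i. if i = a \<or> i = c then A else if i = b \<or> i = d then B else of_real X)"
  have w: "w a = A" "w c = A" "w b = B" "w d = B" "w x = of_real X" "w y = of_real X"
    using ne by (simp_all add: w_def)
  let ?P = "insert a (insert b (insert c (insert d (insert x {y}))))"
  have P: "subset_sum 3 ?P (\<lambda>S. of_real (r S) * (\<Prod>i\<in>S. w i))
    = 2 * A * B * (A + B) + 2 * of_real X * (A + B)\<^sup>2 + 2 * (A + B) * (of_real X)\<^sup>2"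
    unfolding numeral_3_eq_3
    by (simp add: ne subset_sum_insert abcd x y xy w) (simp add: power2_eq_square algebra_simps)
  have Q: "subset_sum 2 ?P (\<lambda>S. of_real (r (insert z S)) * (\<Prod>i\<in>S. w i))
    = 2 * of_real (u + 1) * A * B + of_real p * A\<^sup>2 + of_real q * B\<^sup>2 + 2 * (A + B) * of_real X * of_real (u + 1)"
    unfolding numeral_2_eq_2
    by (simp add: ne subset_sum_insert z xz yz xyz w) (simp add: power2_eq_square algebra_simps)
  have P': "subset_sum 3 ?P (\<lambda>S. of_real (r S) * (\<Prod>i\<in>S. w i)) = Complex (- 8 * X) (4 * X\<^sup>2 - 4 - g\<^sup>2)"
    unfolding P by (simp add: complex_eq_iff A_def B_def power2_eq_square algebra_simps)
  have Q': "subset_sum 2 ?P (\<lambda>S. of_real (r (insert z S)) * (\<Prod>i\<in>S. w i)) = Complex N (g * (p - q) + 4 * X * (u + 1))"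
    unfolding Q by (simp add: complex_eq_iff A_def B_def N_def k_def power2_eq_square field_simps)
  have "Im (- Complex (- 8 * X) (4 * X\<^sup>2 - 4 - g\<^sup>2) / Complex N (g * (p - q) + 4 * X * (u + 1))) \<le> 0"
    unfolding P'[symmetric] Q'[symmetric]
    by (rule stable_cubic_boundary_support[OF stab]) (use lt dist in \<open>auto simp: w_def A_def B_def\<close>)
  moreover have "Im (- Complex s t / Complex s' t') = (s * t' - t * s') / (s'\<^sup>2 + t'\<^sup>2)" for s t s' t'
    by (simp add: Im_divide diff_divide_distrib algebra_simps)
  moreover have "- 8 * X * (g * (p - q) + 4 * X * (u + 1)) - (4 * X\<^sup>2 - 4 - g\<^sup>2) * N
    = l * X\<^sup>2 + (- 8 * g * (p - q)) * X + (4 + g\<^sup>2) * N"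
  proof -
    have "- (4 * X\<^sup>2) * N = (l + 4 * (g\<^sup>2 * k)) * X\<^sup>2" by (simp add: N_def l_def algebra_simps)
    then show ?thesis unfolding g by (simp add: power2_eq_square algebra_simps)
  qed
  ultimately have "(l * X\<^sup>2 + (- 8 * g * (p - q)) * X + (4 + g\<^sup>2) * N) / (N\<^sup>2
      + (g * (p - q) + 4 * X * (u + 1))\<^sup>2) \<le> 0"
    by (simp only:)
  moreover have "0 \<le> k * g\<^sup>2" using k by simp
  then have "N < 0" unfolding N_def using pos by linarith
  then have "0 < N\<^sup>2 + (g * (p - q) + 4 * X * (u + 1))\<^sup>2" by (intro add_pos_nonneg) auto
  ultimately show False using X by (simp only: divide_le_0_iff) linarith
qed

text \<open>Cauchy-Binet for the weighted sum of the matrices v_k v_k^T, by adding one index at a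
  time. The auxiliary facts are the forms that occur as derivatives along rank-one matrices: fact 2
  is v_a^T adj(M) v_a, and fact 1 is c^T M c with c = v_a x v_b.\<close>

lemma weighted_gram_det:
  fixes z :: "nat \<Rightarrow> complex" and V :: "nat \<Rightarrow> nat \<Rightarrow> real" and P :: "nat set"
  defines "M \<equiv> \<lambda>P i j. \<Sum>k\<in>P. z k * complex_of_real (V k i) * complex_of_real (V k j)"
  assumes P: "finite P"
  shows "subset_sum 3 P (\<lambda>S. complex_of_real ((abs_minor V S)\<^sup>2) * (\<Prod>i\<in>S. z i)) = det3 (M P) 0 1 2"
proof -
  define v where "v = (\<lambda>i j. complex_of_real (V i j))"
  define D where "D = (\<lambda>S. complex_of_real ((abs_minor V S)\<^sup>2))"
  have D: "D {i, j, k} = (det3 v i j k)\<^sup>2" if "i \<noteq> j" "i \<noteq> k" "j \<noteq> k" for i j k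
  proof -
    have "(abs_minor V {i, j, k})\<^sup>2 = (det3 V i j k)\<^sup>2" using that by (simp add: abs_minor_triple)
    moreover have "complex_of_real (det3 V i j k) = det3 v i j k" by (simp add: det3_def v_def)
    ultimately show ?thesis unfolding D_def by (simp only: of_real_power)
  qed
  have M: "M (insert k Q) i j = z k * v k i * v k j + M Q i j" if "finite Q" "k \<notin> Q" for Q k i j
    using that by (simp add: M_def v_def)
  have M0: "M {} i j = 0" for i j by (simp add: M_def)
  have pr: "subset_sum m Q (\<lambda>S. G (insert k S) * (\<Prod>i\<in>insert k S. z i)) = z k * subset_sum m Q (\<lambda>S. G (insert k S) * (\<Prod>i\<in>S. z i))"
    if "finite Q" "k \<notin> Q" for m Q k and G :: "nat set \<Rightarrow> complex"
    unfolding subset_sum_mult_left[symmetric]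
  proof (rule subset_sum_cong)
    fix S assume "S \<subseteq> Q"
    then have "finite S" "k \<notin> S" using that finite_subset by blast+
    then show "G (insert k S) * (\<Prod>i\<in>insert k S. z i) = z k * (G (insert k S) * (\<Prod>i\<in>S. z i))" by simp
  qed
  have 1: "subset_sum 1 P (\<lambda>S. D (insert a (insert b S)) * (\<Prod>i\<in>S. z i)) =
      (let x = v a 1 * v b 2 - v a 2 * v b 1; y = v a 2 * v b 0 - v a 0 * v b 2; w = v a 0 * v b 1 - v a 1 * v b 0
       in x\<^sup>2 * M P 0 0 + y\<^sup>2 * M P 1 1 + w\<^sup>2 * M P 2 2 + 2 * x * y * M P 0 1 + 2 * x * w * M P 0 2 + 2 * y * w * M P 1 2)"
    if "a \<notin> P" "b \<notin> P" "a \<noteq> b" "finite P" for a b P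
    using that(4,1,2)
  proof (induction P rule: finite_induct)
    case empty
    then show ?case by (simp add: M0 Let_def)
  next
    case (insert k Q)
    then have "D {a, b, k} = (det3 v a b k)\<^sup>2" using that(3) by (intro D) auto
    then show ?case using insert
      by (simp add: subset_sum_insert M Let_def) (simp add: det3_def power2_eq_square algebra_simps)
  qed
  have 2: "subset_sum 2 P (\<lambda>S. D (insert a S) * (\<Prod>i\<in>S. z i)) =
      (v a 0)\<^sup>2 * (M P 1 1 * M P 2 2 - (M P 1 2)\<^sup>2) + (v a 1)\<^sup>2 * (M P 0 0 * M P 2 2 - (M P 0 2)\<^sup>2)
      + (v a 2)\<^sup>2 * (M P 0 0 * M P 1 1 - (M P 0 1)\<^sup>2)
      + 2 * v a 0 * v a 1 * (M P 0 2 * M P 1 2 - M P 0 1 * M P 2 2)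
      + 2 * v a 0 * v a 2 * (M P 0 1 * M P 1 2 - M P 0 2 * M P 1 1)
      + 2 * v a 1 * v a 2 * (M P 0 1 * M P 0 2 - M P 1 2 * M P 0 0)"
    if "a \<notin> P" "finite P" for a P
    using that(2,1)
  proof (induction P rule: finite_induct)
    case empty
    then show ?case by (simp add: M0 numeral_2_eq_2)
  next
    case (insert k Q)
    have "subset_sum 2 (insert k Q) (\<lambda>S. D (insert a S) * (\<Prod>i\<in>S. z i)) =
      subset_sum 2 Q (\<lambda>S. D (insert a S) * (\<Prod>i\<in>S. z i))
      + z k * subset_sum 1 Q (\<lambda>S. D (insert a (insert k S)) * (\<Prod>i\<in>S. z i))"
      by (simp only: subset_sum_insert[OF insert(1,2), of 1, unfolded Suc_1]
          pr[OF insert(1,2), where G = "\<lambda>S. D (insert a S)"])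
    moreover have "a \<notin> Q" "a \<noteq> k" using insert.prems by auto
    ultimately show ?case
      unfolding M[OF insert(1,2)]
      by (simp only: insert.IH[OF \<open>a \<notin> Q\<close>] 1[OF \<open>a \<notin> Q\<close> insert(2) \<open>a \<noteq> k\<close> insert(1)] Let_def)
        (simp add: power2_eq_square algebra_simps)
  qed
  have three: "Suc 2 = 3" by simp
  have 3: "subset_sum 3 P (\<lambda>S. D S * (\<Prod>i\<in>S. z i)) = det3 (M P) 0 1 2"
    using P
  proof (induction P rule: finite_induct)
    case empty
    then show ?case by (simp add: M0 det3_def numeral_3_eq_3)
  next
    case (insert k Q)
    have "subset_sum 3 (insert k Q) (\<lambda>S. D S * (\<Prod>i\<in>S. z i)) =
      subset_sum 3 Q (\<lambda>S. D S * (\<Prod>i\<in>S. z i)) + z k * subset_sum 2 Q (\<lambda>S. D (insert k S) * (\<Prod>i\<in>S. z i))"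
      by (simp only: subset_sum_insert[OF insert(1,2), of 2, unfolded three] pr[OF insert(1,2), where G = D])
    moreover have "M Q 1 0 = M Q 0 1" "M Q 2 0 = M Q 0 2" "M Q 2 1 = M Q 1 2"
      by (simp_all add: M_def mult_ac)
    ultimately show ?case
      unfolding det3_def M[OF insert(1,2)]
      by (simp only: insert.IH 2[OF insert(2,1)] det3_def) (simp add: power2_eq_square algebra_simps)
  qed
  show ?thesis using 3 unfolding D_def .
qed

section \<open>Lorentzian and stable coefficients as weak representations\<close>

lemma mpoly_eval_eq_cubic:
  assumes B: "\<And>S. S \<in> B \<Longrightarrow> S \<subseteq> {..<n} \<and> card S = 3"
    and keys: "Poly_Mapping.keys f = indicator_vector ` B"
  shows "mpoly_eval f z = cubic (coeff_function f) n z"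
proof -
  have fin: "finite S" if "S \<in> B" for S using B[OF that] finite_subset by blast
  have inj: "inj_on indicator_vector B"
    using fin indicator_vector_eq_iff by (auto intro!: inj_onI)
  have "mpoly_eval f z = (\<Sum>S\<in>B. of_real (coeff_function f S) * (\<Prod>i\<in>S. z i))"
    unfolding mpoly_eval_def keys sum.reindex[OF inj] o_def
    by (intro sum.cong refl)
      (simp add: fin coeff_function_def keys_indicator_vector lookup_indicator_vector)
  also have "\<dots> = cubic (coeff_function f) n z"
    unfolding cubic_def subset_sum_def
  proof (rule sum.mono_neutral_left)
    show "\<forall>S\<in>{S. S \<subseteq> {..<n} \<and> card S = 3} - B. complex_of_real (coeff_function f S) * (\<Prod>i\<in>S. z i) = 0"
      using coeff_function_support[OF B keys] by auto
  qed (use B in auto)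
  finally show ?thesis .
qed

lemma quadratic_form_discriminant:
  fixes a c e :: real
  assumes nn: "0 \<le> a" "0 \<le> c"
    and form: "\<And>x y. 0 < x \<Longrightarrow> 0 < y \<Longrightarrow> e * (x * y) \<le> a * x\<^sup>2 + c * y\<^sup>2"
  shows "e \<le> 2 * sqrt (a * c)"
proof -
  have le: "e \<le> 2 * sqrt ((a + r) * (c + r))" if r: "0 < r" for r
  proof -
    \<comment> \<open>At this point both perturbed squares equal (a + r)(c + r), so the comparison
      is sharp. The perturbation keeps x and y positive when a or c is 0.\<close>
    define x y where "x = sqrt (c + r)" and "y = sqrt (a + r)"
    have x: "0 < x" "x\<^sup>2 = c + r" and y: "0 < y" "y\<^sup>2 = a + r" using nn r by (simp_all add: x_def y_def)
    have "e * (x * y) \<le> a * x\<^sup>2 + c * y\<^sup>2" using x y by (intro form) auto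
    also have "\<dots> \<le> (a + r) * x\<^sup>2 + (c + r) * y\<^sup>2" using r by (intro add_mono mult_right_mono) auto
    also have "\<dots> = (2 * (x * y)) * (x * y)" unfolding x(2)[symmetric] y(2)[symmetric] by (simp add: power2_eq_square)
    finally have "e \<le> 2 * (x * y)" using x y by (simp add: mult_le_cancel_right)
    then show ?thesis by (simp add: x_def y_def real_sqrt_mult mult.commute)
  qed
  have "((\<lambda>r. 2 * sqrt ((a + r) * (c + r))) \<longlongrightarrow> 2 * sqrt ((a + 0) * (c + 0))) (at_right 0)"
    by (intro tendsto_intros)
  moreover have "eventually (\<lambda>r. e \<le> 2 * sqrt ((a + r) * (c + r))) (at_right 0)"
    using le by (auto simp: eventually_at_filter)
  ultimately show ?thesis using tendsto_lowerbound by fastforce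
qed

text \<open>Only the mixed term carries K. Comparison with the pure squares gives K <= a d + b c + 2
  sqrt(a b c d), and the right-hand side is a perfect square. For q = 2, nullity of three terms is
  exactly the triangle inequality for their square roots.\<close>

lemma sqrt_triangle_from_form:
  fixes a b c d K :: real
  assumes nn: "0 \<le> a" "0 \<le> b" "0 \<le> c" "0 \<le> d" "0 \<le> K"
    and form: "\<And>x y. 0 < x \<Longrightarrow> 0 < y \<Longrightarrow> K * (x * y) \<le> (a * x + b * y) * (c * x + d * y)"
  shows "sqrt K \<le> sqrt (a * d) + sqrt (b * c)"
proof -
  have "(K - a * d - b * c) * (x * y) \<le> (a * c) * x\<^sup>2 + (b * d) * y\<^sup>2" if "0 < x" "0 < y" for x y
    using form[OF that] by (simp add: power2_eq_square algebra_simps)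
  then have "K - a * d - b * c \<le> 2 * sqrt ((a * c) * (b * d))"
    using nn by (intro quadratic_form_discriminant) auto
  also have "(a * c) * (b * d) = (a * d) * (b * c)" by simp
  also have "sqrt ((a * d) * (b * c)) = sqrt (a * d) * sqrt (b * c)" by (rule real_sqrt_mult)
  finally have "K \<le> (sqrt (a * d))\<^sup>2 + (sqrt (b * c))\<^sup>2 + 2 * (sqrt (a * d) * sqrt (b * c))"
    using nn by (simp only: real_sqrt_pow2 mult_nonneg_nonneg)
  then have "K \<le> (sqrt (a * d) + sqrt (b * c))\<^sup>2" by (simp only: power2_sum mult.assoc)
  then show ?thesis using nn by (intro real_le_lsqrt) auto
qed

lemma three_term_sets:
  assumes "card S1 + 1 = (3::nat)" "card S2 = 3 + 1" "card (S2 - S1) = 3"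
  obtains m i j k l where "distinct [m, i, j, k, l]" "S1 = {m, i}" "S2 = {m, j, k, l}"
proof -
  have fin: "finite S1" "finite S2" using assms by (auto intro: card_ge_0_finite)
  have "card (S2 \<inter> S1) = 1" using card_Diff_subset_Int[of S2 S1] fin assms by simp
  then obtain m where m: "S2 \<inter> S1 = {m}" by (rule card_1_singletonE)
  have "card (S1 - {m}) = 1" using m assms(1) fin by (subst card_Diff_singleton) auto
  then obtain i where i: "S1 - {m} = {i}" by (rule card_1_singletonE)
  obtain j k l where jkl: "S2 - S1 = {j, k, l}" "j \<noteq> k" "j \<noteq> l" "k \<noteq> l"
    using assms(3) unfolding card_3_iff by blast
  have 1: "S1 = {m, i}" using m i by blast
  have 2: "S2 = {m, j, k, l}" using m jkl(1) by blast
  have "j \<notin> S1" "k \<notin> S1" "l \<notin> S1" "i \<noteq> m" using jkl(1) i by blast+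
  then have "distinct [m, i, j, k, l]" using jkl 1 by auto
  then show ?thesis using that 1 2 by blast
qed

lemma plucker_null_three_term:
  assumes d: "distinct [m, i, j, k, l]"
  shows "plucker_null q \<rho> {m, i} {m, j, k, l} \<longleftrightarrow>
    tropical_null q {j, k, l} (\<lambda>x. if x = j then \<rho> {m, i, j} * \<rho> {m, k, l}
      else if x = k then \<rho> {m, i, k} * \<rho> {m, j, l} else \<rho> {m, i, l} * \<rho> {m, j, k})"
proof -
  have sets: "{m, j, k, l} - {m, i} = {j, k, l}" "{m, j, k, l} - {j} = {m, k, l}"
    "{m, j, k, l} - {k} = {m, j, l}" "{m, j, k, l} - {l} = {m, j, k}" "insert x {m, i} = {m, i, x}" for x
    using d by auto
  show ?thesis unfolding plucker_null_def sets(1)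
    by (rule tropical_null_cong) (use d in \<open>auto simp: sets\<close>)
qed

text \<open>The hypothesis ranges over all labellings, so permuting j, k, l in it yields the three
  triangle inequalities of one relation.\<close>

lemma weak_reps_2I:
  assumes nn: "\<And>S. 0 \<le> \<rho> S" and supp: "{S. \<rho> S \<noteq> 0} = B"
    and form: "\<And>m i j k l x y. distinct [m, i, j, k, l] \<Longrightarrow> {m, i, j, k, l} \<subseteq> {..<n} \<Longrightarrow> 0 < x \<Longrightarrow> 0 < y \<Longrightarrow>
      \<rho> {m, k, l} * \<rho> {m, i, j} * (x * y)
        \<le> (\<rho> {m, i, k} * x + \<rho> {m, i, l} * y) * (\<rho> {m, j, k} * x + \<rho> {m, j, l} * y)"
  shows "\<rho> \<in> weak_reps n 3 B 2"
proof -
  have "plucker_null 2 \<rho> S1 S2"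
    if S: "S1 \<subseteq> {..<n}" "S2 \<subseteq> {..<n}" "card S1 + 1 = 3" "card S2 = 3 + 1" "card (S2 - S1) = 3" for S1 S2
  proof -
    obtain m i j k l where d: "distinct [m, i, j, k, l]" and eq: "S1 = {m, i}" "S2 = {m, j, k, l}"
      using three_term_sets[OF S(3-5)] by blast
    have sub: "{m, i, j, k, l} \<subseteq> {..<n}" using S(1,2) eq by auto
    have ne: "j \<noteq> k" "k \<noteq> j" "j \<noteq> l" "l \<noteq> j" "k \<noteq> l" "l \<noteq> k" using d by auto
    have tri: "sqrt (\<rho> {m, i, a} * \<rho> {m, b, c}) \<le> sqrt (\<rho> {m, i, b} * \<rho> {m, a, c}) + sqrt (\<rho> {m, i, c} * \<rho> {m, a, b})"
      if "distinct [m, i, a, b, c]" "{m, i, a, b, c} \<subseteq> {..<n}" for a b c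
      using sqrt_triangle_from_form[OF nn nn nn nn mult_nonneg_nonneg[OF nn nn] form[OF that]]
      by (simp add: mult.commute)
    have comm: "{m, c, b} = {m, b, c}" for b c by auto
    have "sqrt (\<rho> {m, i, j} * \<rho> {m, k, l}) \<le> sqrt (\<rho> {m, i, k} * \<rho> {m, j, l}) + sqrt (\<rho> {m, i, l} * \<rho> {m, j, k})"
      by (rule tri) (use d sub in auto)
    moreover have "sqrt (\<rho> {m, i, k} * \<rho> {m, j, l})
        \<le> sqrt (\<rho> {m, i, j} * \<rho> {m, k, l}) + sqrt (\<rho> {m, i, l} * \<rho> {m, j, k})"
      using tri[of k j l] d sub by (auto simp: comm[of k j])
    moreover have "sqrt (\<rho> {m, i, l} * \<rho> {m, j, k})
        \<le> sqrt (\<rho> {m, i, j} * \<rho> {m, k, l}) + sqrt (\<rho> {m, i, k} * \<rho> {m, j, l})"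
      using tri[of l j k] d sub by (auto simp: comm[of l j] comm[of l k])
    moreover have "(2::ennreal) = ennreal 2" by simp
    then have "(2::ennreal) \<noteq> 0" "(2::ennreal) \<noteq> \<infinity>" "enn2real 2 = 2" by simp_all
    moreover have "{j, k, l} - {j} = {k, l}" "{j, k, l} - {k} = {j, l}" "{j, k, l} - {l} = {j, k}" using d by auto
    ultimately show ?thesis
      unfolding eq plucker_null_three_term[OF d] tropical_null_def Let_def
      using ne nn by (simp add: powr_half_sqrt)
  qed
  then show ?thesis using nn supp by (auto simp: weak_reps_def)
qed

text \<open>The vector (v, -u) kills the linear form on the right, so the quadratic form is
  nonpositive there. If p q > b^2, completing the square forces u = v = 0, which the vector (1, 0)
  refutes.\<close>

lemma reverse_cauchy_schwarz:
  fixes p q b u v :: real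
  assumes "\<And>x y. x\<^sup>2 * p + 2 * x * y * b + y\<^sup>2 * q \<le> (x * u + y * v)\<^sup>2" and "0 < p" "0 < q"
  shows "p * q \<le> b\<^sup>2"
proof (rule ccontr)
  assume neg: "\<not> ?thesis"
  have "v\<^sup>2 * p - 2 * v * u * b + u\<^sup>2 * q \<le> 0"
    using assms(1)[of v "- u"] by (simp add: mult.commute)
  then have "p * (v\<^sup>2 * p - 2 * v * u * b + u\<^sup>2 * q) \<le> 0" using \<open>0 < p\<close> by (simp add: mult_le_0_iff)
  then have le: "(p * v - b * u)\<^sup>2 + (p * q - b\<^sup>2) * u\<^sup>2 \<le> 0"
    by (simp add: power2_eq_square algebra_simps)
  have "0 \<le> (p * q - b\<^sup>2) * u\<^sup>2" using neg by (intro mult_nonneg_nonneg) auto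
  then have "(p * q - b\<^sup>2) * u\<^sup>2 = 0" "(p * v - b * u)\<^sup>2 = 0"
    using le zero_le_power2[of "p * v - b * u"] by linarith+
  then have "u = 0" "v = 0" using neg \<open>0 < p\<close> by auto
  then show False using assms(1)[of 1 0] \<open>0 < p\<close> by simp
qed

text \<open>Reverse Cauchy-Schwarz for the vectors x e_k + y e_l and e_i + s e_j gives 4 s K <= (P +
  s R)^2 for every s > 0. The best choice of s turns this into K <= P R.\<close>

lemma quadratic_bound_form:
  fixes h :: "nat \<Rightarrow> nat \<Rightarrow> real"
  assumes bound: "\<And>w. (\<Sum>p<n. \<Sum>q<n. h p q * w p * w q) \<le> (\<Sum>p<n. l' p * w p)\<^sup>2"
    and sym: "\<And>p q. h p q = h q p" and diag: "\<And>p. h p p = 0" and nn: "\<And>p q. 0 \<le> h p q"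
    and lt: "{i, j, k, l} \<subseteq> {..<n}" and d: "distinct [i, j, k, l]" and xy: "0 < x" "0 < y"
  shows "h k l * h i j * (x * y) \<le> (h i k * x + h i l * y) * (h j k * x + h j l * y)"
proof -
  define P where "P = h i k * x + h i l * y"
  define R where "R = h j k * x + h j l * y"
  define K where "K = h k l * h i j * (x * y)"
  have P0: "0 \<le> P" and R0: "0 \<le> R" using nn xy by (simp_all add: P_def R_def)
  have key: "4 * s * K \<le> (P + s * R)\<^sup>2" if s: "0 < s" for s
  proof (cases "0 < h k l \<and> 0 < h i j")
    case False
    then have "h k l = 0 \<or> h i j = 0" using nn[of k l] nn[of i j] by linarith
    then have "K = 0" by (auto simp: K_def)
    then show ?thesis by simp
  next
    case True
    have "\<alpha>\<^sup>2 * (2 * (x * y) * h k l) + 2 * \<alpha> * \<beta> * (P + s * R) + \<beta>\<^sup>2 * (2 * s * h i j)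
      \<le> (\<alpha> * (l' k * x + l' l * y) + \<beta> * (l' i + s * l' j))\<^sup>2" for \<alpha> \<beta>
    proof -
      define w where "w = (\<lambda>p. if p = k then \<alpha> * x else if p = l then \<alpha> * y else if p = i then \<beta>
        else if p = j then \<beta> * s else 0)"
      have wv: "w k = \<alpha> * x" "w l = \<alpha> * y" "w i = \<beta>" "w j = \<beta> * s" using d by (auto simp: w_def)
      have red: "(\<Sum>p<n. g p * w p) = g i * w i + g j * w j + g k * w k + g l * w l" for g :: "nat \<Rightarrow> real"
      proof -
        have "(\<Sum>p<n. g p * w p) = (\<Sum>p\<in>{i, j, k, l}. g p * w p)"
          by (rule sum.mono_neutral_right) (use lt in \<open>auto simp: w_def\<close>)
        then show ?thesis using d by (simp add: add.assoc)
      qed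
      have "(\<Sum>p<n. \<Sum>q<n. h p q * w p * w q) = (\<Sum>p<n. (\<Sum>q<n. h p q * w q) * w p)"
        by (simp add: sum_distrib_left sum_distrib_right mult_ac)
      also have "\<dots> = \<alpha>\<^sup>2 * (2 * (x * y) * h k l) + 2 * \<alpha> * \<beta> * (P + s * R) + \<beta>\<^sup>2 * (2 * s * h i j)"
        unfolding red wv P_def R_def
        by (simp add: diag sym[of j i] sym[of k i] sym[of l i] sym[of k j] sym[of l j] sym[of l k] power2_eq_square algebra_simps)
      finally show ?thesis using bound[of w] unfolding red wv by (simp add: algebra_simps)
    qed
    from reverse_cauchy_schwarz[OF this] True s xy
    show ?thesis by (simp add: K_def mult_ac)
  qed
  have "K \<le> P * R"
  proof (rule ccontr)
    assume "\<not> K \<le> P * R"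
    then have PR: "P * R < K" by simp
    then have K: "0 < K" using P0 R0 by (meson le_less_trans mult_nonneg_nonneg)
    \<comment> \<open>The optimum is s = P / R. If R = 0 a large s gives the contradiction, and if P
      = 0 a small one does.\<close>
    consider "0 < P" "0 < R" | "R = 0" | "P = 0" "0 < R" using P0 R0 by linarith
    then show False
    proof cases
      case 1
      then have "4 * (P / R) * K \<le> (2 * P)\<^sup>2" using key[of "P / R"] by simp
      then have "K \<le> P * R" using 1 by (simp add: power2_eq_square field_simps)
      then show False using PR by simp
    next
      case 2
      have "4 * ((P\<^sup>2 + 1) / K) * K \<le> P\<^sup>2" using key[of "(P\<^sup>2 + 1) / K"] K 2 by (simp add: add_nonneg_pos)
      then have "4 * P\<^sup>2 + 4 \<le> P\<^sup>2" using K by simp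
      then show False using zero_le_power2[of P] by linarith
    next
      case 3
      have "4 * (K / R\<^sup>2) * K \<le> (K / R\<^sup>2 * R)\<^sup>2" using key[of "K / R\<^sup>2"] K 3 by simp
      also have "\<dots> = (K / R\<^sup>2) * K" using 3 by (simp add: power2_eq_square)
      finally have "4 * ((K / R\<^sup>2) * K) \<le> (K / R\<^sup>2) * K" by simp
      moreover have "0 < (K / R\<^sup>2) * K" using K 3 by simp
      ultimately show False by linarith
    qed
  qed
  then show ?thesis by (simp add: K_def P_def R_def)
qed

lemma coeff_function_lorentzian_weak_reps:
  assumes B: "\<And>S. S \<in> B \<Longrightarrow> S \<subseteq> {..<n} \<and> card S = 3" and f: "f \<in> lorentzian_polys n B"
  shows "coeff_function f \<in> weak_reps n 3 B 2"
proof -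
  have lor: "lorentzian n f" and keys: "Poly_Mapping.keys f = indicator_vector ` B"
    using f by (auto simp: lorentzian_polys_def)
  have nn: "0 \<le> coeff_function f S" for S using lor by (simp add: lorentzian_def coeff_function_def)
  show ?thesis
  proof (rule weak_reps_2I[OF nn coeff_function_support[OF B keys]])
    fix m i j k l :: nat and x y :: real
    assume d: "distinct [m, i, j, k, l]" and sub: "{m, i, j, k, l} \<subseteq> {..<n}" and xy: "0 < x" "0 < y"
    let ?h = "contraction_matrix (coeff_function f) m"
    from lorentzian_quadratic_bound[OF B keys lor, of m] sub obtain l' where
      l': "\<And>w. (\<Sum>p<n. \<Sum>q<n. ?h p q * w p * w q) \<le> (\<Sum>p<n. l' p * w p)\<^sup>2" by auto
    have "?h k l * ?h i j * (x * y) \<le> (?h i k * x + ?h i l * y) * (?h j k * x + ?h j l * y)"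
      by (rule quadratic_bound_form[OF l' contraction_matrix_sym])
        (use d sub xy nn in \<open>auto simp: contraction_matrix_def card_insert_if\<close>)
    then show "coeff_function f {m, k, l} * coeff_function f {m, i, j} * (x * y)
      \<le> (coeff_function f {m, i, k} * x + coeff_function f {m, i, l} * y) *
        (coeff_function f {m, j, k} * x + coeff_function f {m, j, l} * y)"
      using d by (simp add: contraction_matrix_def)
  qed auto
qed

lemma stable_polys_stable_cubic:
  assumes B: "\<And>S. S \<in> B \<Longrightarrow> S \<subseteq> {..<n} \<and> card S = 3" and f: "f \<in> stable_polys n B"
  shows "stable_cubic (coeff_function f) n"
  using f mpoly_eval_eq_cubic[OF B] by (auto simp: stable_polys_def stable_def stable_cubic_def)

lemma coeff_function_stable_weak_reps:
  assumes B: "\<And>S. S \<in> B \<Longrightarrow> S \<subseteq> {..<n} \<and> card S = 3" and f: "f \<in> stable_polys n B"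
  shows "coeff_function f \<in> weak_reps n 3 B 2"
proof -
  have keys: "Poly_Mapping.keys f = indicator_vector ` B" using f by (auto simp: stable_polys_def)
  have nn: "0 \<le> coeff_function f S" for S using f by (simp add: stable_polys_def coeff_function_def)
  show ?thesis
  proof (rule weak_reps_2I[OF nn coeff_function_support[OF B keys]])
    fix m i j k l :: nat and x y :: real
    assume "distinct [m, i, j, k, l]" "{m, i, j, k, l} \<subseteq> {..<n}"
    then show "coeff_function f {m, k, l} * coeff_function f {m, i, j} * (x * y)
      \<le> (coeff_function f {m, i, k} * x + coeff_function f {m, i, l} * y) *
        (coeff_function f {m, j, k} * x + coeff_function f {m, j, l} * y)"
      by (intro stable_cubic_rayleigh[OF stable_polys_stable_cubic[OF B f]]) auto
  qed auto
qed

section \<open>Real configurations and the golden integers\<close>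

lemma det_3x3:
  fixes A :: "'a :: comm_ring_1 mat"
  assumes A: "A \<in> carrier_mat 3 3"
  shows "Determinant.det A = det3 (\<lambda>i j. A $$ (i, j)) 0 1 2"
proof -
  have 1: "Determinant.det M = M $$ (0, 0) * M $$ (1, 1) - M $$ (0, 1) * M $$ (1, 0)"
    if M: "M \<in> carrier_mat 2 2" for M :: "'a mat"
  proof -
    have "{..<2} = {0, 1 :: nat}" by auto
    then show ?thesis
      using M by (simp add: laplace_expansion_row[OF M, of 0] cofactor_def mat_delete_def det_single)
  qed
  have 2: "{..<3} = {0, 1, 2 :: nat}" by auto
  show ?thesis
    using A by (simp add: laplace_expansion_row[OF A, of 0] cofactor_def 2 1 mat_delete_def det3_def)
      (simp add: numeral_2_eq_2 algebra_simps)
qed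

lemma minor_eq_det3:
  fixes A :: "'a :: comm_ring_1 mat"
  assumes A: "A \<in> carrier_mat 3 n" and abc: "a < b" "b < c" "c < n"
  shows "Determinant.det (submatrix A UNIV {a, b, c}) = det3 (\<lambda>i j. A $$ (j, i)) a b c"
proof -
  let ?M = "submatrix A UNIV {a, b, c}"
  have "{j. j < dim_col A \<and> j \<in> {a, b, c}} = {a, b, c}" using A abc by auto
  moreover have "card {a, b, c} = 3" using abc by simp
  ultimately have cc: "card {j. j < dim_col A \<and> j \<in> {a, b, c}} = 3" by simp
  have cr: "card {i. i < dim_row A \<and> i \<in> UNIV} = 3" using A by simp
  have M: "?M \<in> carrier_mat 3 3" by (intro carrier_matI) (simp_all only: dim_submatrix cc cr)
  have "{x \<in> {a, b, c}. x < a} = {}" "{x \<in> {a, b, c}. x < b} = {a}" "{x \<in> {a, b, c}. x < c} = {a, b}"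
    using abc by auto
  then have c: "card {x \<in> {a, b, c}. x < a} = 0" "card {x \<in> {a, b, c}. x < b} = 1" "card {x \<in> {a, b, c}. x < c} = 2"
    using abc by simp_all
  have pick: "pick {a, b, c} 0 = a" "pick {a, b, c} 1 = b" "pick {a, b, c} 2 = c"
    using pick_card_in_set[of a "{a, b, c}", unfolded c] pick_card_in_set[of b "{a, b, c}", unfolded c]
      pick_card_in_set[of c "{a, b, c}", unfolded c] by blast+
  have "?M $$ (i, j) = A $$ (i, pick {a, b, c} j)" if "i < 3" "j < 3" for i j
    using submatrix_index[of i A UNIV j "{a, b, c}"] that unfolding cc cr by (simp add: pick_UNIV)
  then show ?thesis unfolding det_3x3[OF M] det3_def
      by (simp add: pick[unfolded One_nat_def] del: pick.simps) (simp add: algebra_simps)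
qed

lemma det3_kernel:
  fixes M :: "nat \<Rightarrow> nat \<Rightarrow> complex"
  assumes "det3 M 0 1 2 = 0"
  obtains w where "\<exists>j<3. w j \<noteq> 0" "\<And>i. i < 3 \<Longrightarrow> (\<Sum>j<3. M i j * w j) = 0"
proof -
  let ?A = "mat 3 3 (\<lambda>(i, j). M i j)"
  have A: "?A \<in> carrier_mat 3 3" by simp
  have "Determinant.det ?A = 0" unfolding det_3x3[OF A] using assms by (simp add: det3_def)
  then obtain v where v: "v \<in> carrier_vec 3" "v \<noteq> 0\<^sub>v 3" "?A *\<^sub>v v = 0\<^sub>v 3"
    using det_0_iff_vec_prod_zero_field[OF A] by blast
  show ?thesis
  proof (rule that[of "\<lambda>j. v $ j"])
    show "\<exists>j<3. v $ j \<noteq> 0"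
    proof (rule ccontr)
      assume "\<not> ?thesis"
      then have "v = 0\<^sub>v 3" using v(1) by (intro eq_vecI) auto
      with v(2) show False ..
    qed
    show "(\<Sum>j<3. M i j * v $ j) = 0" if "i < 3" for i
      using arg_cong[OF v(3), of "\<lambda>u. u $ i"] that v(1)
      by (simp add: scalar_prod_def lessThan_atLeast0)
  qed
qed

text \<open>
  The polynomial is the determinant of \<open>\<Sum>\<^sub>i z\<^sub>i v\<^sub>i v\<^sub>i\<^sup>T\<close>, whose imaginary part is positive definite.
\<close>

lemma stable_cubic_abs_minor_squared:
  assumes "a < n" "b < n" "c < n" "det3 V a b c \<noteq> 0"
  shows "stable_cubic (\<lambda>S. (abs_minor V S)\<^sup>2) n"
  unfolding stable_cubic_def
proof (intro allI impI notI)
  fix z :: "nat \<Rightarrow> complex"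
  assume im: "\<forall>i<n. 0 < Im (z i)" and zero: "cubic (\<lambda>S. (abs_minor V S)\<^sup>2) n z = 0"
  define v where "v = (\<lambda>i j. complex_of_real (V i j))"
  let ?M = "\<lambda>i j. \<Sum>k<n. z k * v k i * v k j"
  have "det3 ?M 0 1 2 = 0"
    using zero weighted_gram_det[of "{..<n}" V z] by (simp add: cubic_def v_def)
  then obtain w where w: "\<exists>j<3. w j \<noteq> 0" "\<And>i. i < 3 \<Longrightarrow> (\<Sum>j<3. ?M i j * w j) = 0"
    by (rule det3_kernel) blast
  define u where "u = (\<lambda>k. \<Sum>j<3. v k j * w j)"
  \<comment> \<open>The kernel vector makes conj(w)^T M w, the sum of the z_k |u_k|^2, vanish. As
    every Im z_k is positive, the imaginary part forces each u_k to be 0.\<close>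
  have "(\<Sum>k<n. z k * of_real ((cmod (u k))\<^sup>2)) = (\<Sum>k<n. \<Sum>i<3. \<Sum>j<3. cnj (w i) * (z k * v k i * v k j * w j))"
  proof (rule sum.cong[OF refl])
    fix k
    have "z k * of_real ((cmod (u k))\<^sup>2) = z k * (u k * cnj (u k))" by (simp only: complex_norm_square)
    also have "cnj (u k) = (\<Sum>i<3. v k i * cnj (w i))" by (simp add: u_def v_def)
    finally show "z k * of_real ((cmod (u k))\<^sup>2) = (\<Sum>i<3. \<Sum>j<3. cnj (w i) * (z k * v k i * v k j * w j))"
      unfolding u_def sum_product by (subst sum.swap) (simp add: sum_distrib_left mult_ac)
  qed
  also have "\<dots> = (\<Sum>i<3. \<Sum>k<n. \<Sum>j<3. cnj (w i) * (z k * v k i * v k j * w j))"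
    by (rule sum.swap)
  also have "\<dots> = (\<Sum>i<3. \<Sum>j<3. \<Sum>k<n. cnj (w i) * (z k * v k i * v k j * w j))"
    by (rule sum.cong[OF refl]) (rule sum.swap)
  also have "\<dots> = (\<Sum>i<3. cnj (w i) * (\<Sum>j<3. ?M i j * w j))"
    by (simp add: sum_distrib_left sum_distrib_right)
  also have "\<dots> = 0" using w(2) by (intro sum.neutral) auto
  finally have "Im (\<Sum>k<n. z k * of_real ((cmod (u k))\<^sup>2)) = 0" by simp
  then have "(\<Sum>k<n. Im (z k) * (cmod (u k))\<^sup>2) = 0" by simp
  moreover have "0 \<le> Im (z k) * (cmod (u k))\<^sup>2" if "k \<in> {..<n}" for k
    using im that by (intro mult_nonneg_nonneg) (auto intro: less_imp_le)
  ultimately have "\<forall>k\<in>{..<n}. Im (z k) * (cmod (u k))\<^sup>2 = 0"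
    by (subst (asm) sum_nonneg_eq_0_iff) auto
  then have u0: "u k = 0" if "k < n" for k using im that by force
  have three: "{..<3} = {0, 1, 2 :: nat}" by auto
  \<comment> \<open>Three of the vectors are independent and all are annihilated by w, so Cramer's
    rule gives w = 0.\<close>
  define D where "D = complex_of_real (det3 V a b c)"
  have D: "D = det3 v a b c" by (simp add: D_def det3_def v_def)
  have "D \<noteq> 0" using assms(4) by (simp add: D_def)
  have eqs: "v k 0 * w 0 + v k 1 * w 1 + v k 2 * w 2 = 0" if "k < n" for k
    using u0[OF that] by (simp add: u_def three add.assoc)
  note e = eqs[OF assms(1)] eqs[OF assms(2)] eqs[OF assms(3)]
  have "D * w 0 = ((v b 1 * v c 2 - v b 2 * v c 1) * (v a 0 * w 0 + v a 1 * w 1 + v a 2 * w 2)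
      - (v a 1 * v c 2 - v a 2 * v c 1) * (v b 0 * w 0 + v b 1 * w 1 + v b 2 * w 2)
      + (v a 1 * v b 2 - v a 2 * v b 1) * (v c 0 * w 0 + v c 1 * w 1 + v c 2 * w 2))"
    unfolding D det3_def by (simp add: algebra_simps)
  then have "D * w 0 = 0" unfolding e by simp
  moreover have "D * w 1 = - ((v b 0 * v c 2 - v b 2 * v c 0) * (v a 0 * w 0 + v a 1 * w 1 + v a 2 * w 2)
      - (v a 0 * v c 2 - v a 2 * v c 0) * (v b 0 * w 0 + v b 1 * w 1 + v b 2 * w 2)
      + (v a 0 * v b 2 - v a 2 * v b 0) * (v c 0 * w 0 + v c 1 * w 1 + v c 2 * w 2))"
    unfolding D det3_def by (simp add: algebra_simps)
  then have "D * w 1 = 0" unfolding e by simp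
  moreover have "D * w 2 = ((v b 0 * v c 1 - v b 1 * v c 0) * (v a 0 * w 0 + v a 1 * w 1 + v a 2 * w 2)
      - (v a 0 * v c 1 - v a 1 * v c 0) * (v b 0 * w 0 + v b 1 * w 1 + v b 2 * w 2)
      + (v a 0 * v b 1 - v a 1 * v b 0) * (v c 0 * w 0 + v c 1 * w 1 + v c 2 * w 2))"
    unfolding D det3_def by (simp add: algebra_simps)
  then have "D * w 2 = 0" unfolding e by simp
  ultimately have "w j = 0" if "j < 3" for j
    using \<open>D \<noteq> 0\<close> that by (auto simp: numeral_3_eq_3 less_Suc_eq numeral_2_eq_2)
  with w(1) show False by blast
qed

section \<open>The golden integers and the matrix over them\<close>

datatype golden = Golden (int_part: int) (phi_part: int)

instantiation golden :: comm_ring_1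
begin

definition "0 = Golden 0 0"
definition "1 = Golden 1 0"

primrec plus_golden where "Golden a b + y = Golden (a + int_part y) (b + phi_part y)"
primrec minus_golden where "Golden a b - y = Golden (a - int_part y) (b - phi_part y)"
primrec uminus_golden where "- Golden a b = Golden (- a) (- b)"
primrec times_golden where
  "Golden a b * y = Golden (a * int_part y + b * phi_part y) (a * phi_part y + b * int_part y + b * phi_part y)"

instance
proof
  fix x y z :: golden
  show "x * y * z = x * (y * z)" by (cases x; cases y; cases z) (simp add: algebra_simps)
  show "x * y = y * x" by (cases x; cases y) (simp add: algebra_simps)
  show "(x + y) * z = x * z + y * z" by (cases x; cases y; cases z) (simp add: algebra_simps)
  show "1 * x = x" by (cases x) (simp add: one_golden_def)
  show "x + y + z = x + (y + z)" by (cases x; cases y; cases z) simp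
  show "x + y = y + x" by (cases x; cases y) simp
  show "0 + x = x" by (cases x) (simp add: zero_golden_def)
  show "- x + x = 0" by (cases x) (simp add: zero_golden_def)
  show "x - y = x + - y" by (cases x; cases y) simp
  show "(0::golden) \<noteq> 1" by (simp add: zero_golden_def one_golden_def)
qed

end

text \<open>An element \<open>a + b\<phi>\<close> of \<open>\<int>[\<phi>]\<close> is sent to \<open>a + b x\<close>; this is a ring map for both roots \<open>x\<close> of \<open>x\<^sup>2 = x + 1\<close>.\<close>

definition golden_eval :: "real \<Rightarrow> golden \<Rightarrow> real" where
  "golden_eval x g = of_int (int_part g) + of_int (phi_part g) * x"

lemma golden_eval_ring:
  assumes "x\<^sup>2 = x + 1"
  shows "golden_eval x (g + h) = golden_eval x g + golden_eval x h"
    "golden_eval x (g - h) = golden_eval x g - golden_eval x h"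
    "golden_eval x (g * h) = golden_eval x g * golden_eval x h"
proof -
  have xx: "x * x = x + 1" "x * (x * r) = x * r + r" for r
    using assms by (simp_all add: power2_eq_square algebra_simps flip: mult.assoc)
  show "golden_eval x (g + h) = golden_eval x g + golden_eval x h"
    "golden_eval x (g - h) = golden_eval x g - golden_eval x h"
    "golden_eval x (g * h) = golden_eval x g * golden_eval x h"
    by (cases g; cases h; simp add: golden_eval_def algebra_simps xx)+
qed

definition golden_norm :: "golden \<Rightarrow> int" where
  "golden_norm g = (int_part g)\<^sup>2 + int_part g * phi_part g - (phi_part g)\<^sup>2"

text \<open>The two roots of x^2 = x + 1 sum to 1, so 1 - x is the conjugate root and the product is
  the norm of the quadratic ring.\<close>

lemma golden_eval_conjugate:
  assumes "x\<^sup>2 = x + 1"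
  shows "golden_eval x g * golden_eval (1 - x) g = of_int (golden_norm g)"
proof -
  have "golden_eval x g * golden_eval (1 - x) g
    = (of_int (int_part g))\<^sup>2 + of_int (int_part g) * of_int (phi_part g) + (of_int (phi_part g))\<^sup>2 * (x - x\<^sup>2)"
    by (simp add: golden_eval_def power2_eq_square algebra_simps)
  then show ?thesis using assms by (simp add: golden_norm_def)
qed

text \<open>The identity 1 / \<phi> = \<phi> - 1 makes every entry a golden integer, so minors can
  be computed exactly.\<close>

definition betsy_ross_golden :: "nat \<Rightarrow> nat \<Rightarrow> golden" where
  "betsy_ross_golden i j =
    ([[Golden 0 0, Golden 1 0, Golden 0 0], [Golden 0 0, Golden 0 0, Golden 1 0],
      [Golden 1 0, Golden 1 0, Golden 1 0], [Golden 1 0, Golden 1 1, Golden 0 1],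
      [Golden 1 0, Golden 0 1, Golden (- 1) 1], [Golden 1 0, Golden 1 1, Golden 0 0],
      [Golden 1 0, Golden 0 0, Golden 0 1], [Golden 1 0, Golden 0 1, Golden 0 1],
      [Golden 1 0, Golden 0 1, Golden 1 0], [Golden 1 0, Golden 1 1, Golden 1 0],
      [Golden 1 0, Golden 0 0, Golden 0 0]] ! i) ! j"

definition golden_minor :: "nat \<Rightarrow> nat \<Rightarrow> nat \<Rightarrow> golden" where
  "golden_minor = det3 betsy_ross_golden"

text \<open>An exhaustive exact computation. Norm 1 or -1 means that a nonzero minor is a unit, so
  its conjugate has the reciprocal absolute value.\<close>

lemma golden_minor_norm:
  assumes "a < 11" "b < 11" "c < 11"
  shows "golden_minor a b c = 0 \<or> \<bar>golden_norm (golden_minor a b c)\<bar> = 1"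
proof -
  have "\<forall>a\<in>set [0..<11]. \<forall>b\<in>set [0..<11]. \<forall>c\<in>set [0..<11].
      golden_minor a b c = 0 \<or> \<bar>golden_norm (golden_minor a b c)\<bar> = 1"
    unfolding golden_minor_def by code_simp
  then show ?thesis using assms by simp
qed

lemma golden_ratio_props: "golden_ratio\<^sup>2 = golden_ratio + 1" "1 < golden_ratio"
proof -
  have "(1 + sqrt 5)\<^sup>2 = 6 + 2 * sqrt (5 :: real)" by (simp add: power2_sum)
  then show "golden_ratio\<^sup>2 = golden_ratio + 1"
    unfolding golden_ratio_def by (simp add: power_divide field_simps)
  have "1 < sqrt (5 :: real)" by simp
  then show "1 < golden_ratio" unfolding golden_ratio_def by simp
qed

lemma golden_ratio_conjugate: "(1 - golden_ratio)\<^sup>2 = (1 - golden_ratio) + 1"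
  using golden_ratio_props(1) by (simp add: power2_eq_square algebra_simps)

lemma golden_ratio_inverse: "1 / golden_ratio = golden_ratio - 1"
  using golden_ratio_props by (simp add: field_simps power2_eq_square)

definition betsy_ross_vec :: "real \<Rightarrow> nat \<Rightarrow> nat \<Rightarrow> real" where
  "betsy_ross_vec x i j = golden_eval x (betsy_ross_golden i j)"

lemma det3_betsy_ross_vec:
  assumes "x\<^sup>2 = x + 1"
  shows "det3 (betsy_ross_vec x) a b c = golden_eval x (golden_minor a b c)"
  unfolding golden_minor_def det3_def betsy_ross_vec_def by (simp only: golden_eval_ring[OF assms])

lemma betsy_ross_matrix_carrier: "betsy_ross_matrix \<in> carrier_mat 3 11"
  by (intro carrier_matI) (simp_all add: betsy_ross_matrix_def Let_def mat_of_cols_list_def)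

lemma betsy_ross_matrix_index:
  assumes "i < 11" "j < 3"
  shows "betsy_ross_matrix $$ (j, i) = betsy_ross_vec golden_ratio i j"
proof -
  have "i = 0 \<or> i = 1 \<or> i = 2 \<or> i = 3 \<or> i = 4 \<or> i = 5 \<or> i = 6 \<or> i = 7 \<or> i = 8 \<or> i = 9 \<or> i = 10"
    "j = 0 \<or> j = 1 \<or> j = 2" using assms by presburger+
  then show ?thesis
    by (elim disjE; hypsubst)
      (simp_all add: betsy_ross_matrix_def Let_def mat_of_cols_list_def betsy_ross_vec_def
        betsy_ross_golden_def golden_eval_def golden_ratio_inverse)
qed

definition betsy_ross_abs :: "nat set \<Rightarrow> real" where
  "betsy_ross_abs = abs_minor (betsy_ross_vec golden_ratio)"

definition betsy_ross_abs_conjugate :: "nat set \<Rightarrow> real" where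
  "betsy_ross_abs_conjugate = abs_minor (betsy_ross_vec (1 - golden_ratio))"

lemma triple_sorted:
  assumes "S \<subseteq> {..<n :: nat}" "card S = 3"
  obtains a b c where "S = {a, b, c}" "a < b" "b < c" "c < n"
proof -
  have fin: "finite S" using assms(1) finite_subset by blast
  let ?l = "sorted_list_of_set S"
  have l: "length ?l = 3" "set ?l = S" "sorted_wrt (<) ?l" using fin assms(2) by auto
  have "\<exists>a b c. xs = [a, b, c]" if "length xs = 3" for xs :: "nat list"
    using that by (auto simp: numeral_3_eq_3 length_Suc_conv)
  then obtain a b c where abc: "?l = [a, b, c]" using l(1) by blast
  have "S = {a, b, c}" "a < b" "b < c" using l(2,3) unfolding abc by auto
  then show ?thesis using that assms(1) by blast
qed

lemma betsy_ross_abs_eq_minor: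
  assumes "S \<subseteq> {..<11}" "card S = 3"
  shows "betsy_ross_abs S = \<bar>betsy_ross_minor S\<bar>"
proof -
  obtain a b c where S: "S = {a, b, c}" "a < b" "b < c" "c < 11" using triple_sorted[OF assms] by blast
  have "betsy_ross_minor S = det3 (\<lambda>i j. betsy_ross_matrix $$ (j, i)) a b c"
    unfolding betsy_ross_minor_def S(1) by (rule minor_eq_det3[OF betsy_ross_matrix_carrier S(2-4)])
  also have "\<dots> = det3 (betsy_ross_vec golden_ratio) a b c"
    using S by (simp add: det3_def betsy_ross_matrix_index)
  finally show ?thesis using S by (simp add: betsy_ross_abs_def abs_minor_triple)
qed

lemma betsy_ross_bases_iff:
  "S \<in> betsy_ross_bases \<longleftrightarrow> S \<subseteq> {..<11} \<and> card S = 3 \<and> betsy_ross_abs S \<noteq> 0"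
  using betsy_ross_abs_eq_minor by (auto simp: betsy_ross_bases_def)

lemma betsy_ross_abs_triple:
  assumes "a \<noteq> b" "a \<noteq> c" "b \<noteq> c"
  shows "betsy_ross_abs {a, b, c} = \<bar>golden_eval golden_ratio (golden_minor a b c)\<bar>"
    and "betsy_ross_abs_conjugate {a, b, c} = \<bar>golden_eval (1 - golden_ratio) (golden_minor a b c)\<bar>"
  using assms by (simp_all add: betsy_ross_abs_def betsy_ross_abs_conjugate_def abs_minor_triple
      det3_betsy_ross_vec golden_ratio_props golden_ratio_conjugate)

lemma golden_eval_0 [simp]: "golden_eval x 0 = 0"
  by (simp add: golden_eval_def zero_golden_def)

text \<open>On nonbases both sides are 0 because \<open>1 / 0 = 0\<close>, so the sign of the
  exponent can be changed without separating the bases.\<close>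

lemma betsy_ross_abs_conjugate:
  assumes "S \<subseteq> {..<11}"
  shows "betsy_ross_abs_conjugate S = 1 / betsy_ross_abs S"
proof (cases "card S = 3")
  case True
  obtain a b c where S: "S = {a, b, c}" "a < b" "b < c" "c < 11" using triple_sorted[OF assms True] by blast
  let ?g = "golden_minor a b c"
  have prod: "betsy_ross_abs S * betsy_ross_abs_conjugate S = \<bar>of_int (golden_norm ?g)\<bar>"
    using S golden_eval_conjugate[OF golden_ratio_props(1), of ?g]
    by (simp add: betsy_ross_abs_triple flip: abs_mult)
  from golden_minor_norm[of a b c] S consider "?g = 0" | "\<bar>golden_norm ?g\<bar> = 1" by fastforce
  then show ?thesis
  proof cases
    case 1
    then show ?thesis using S by (simp add: betsy_ross_abs_triple)
  next
    case 2
    then have "betsy_ross_abs S * betsy_ross_abs_conjugate S = 1" unfolding prod by linarith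
    then show ?thesis by (simp add: eq_divide_eq mult.commute) (metis mult_zero_left zero_neq_one)
  qed
qed (simp add: betsy_ross_abs_def betsy_ross_abs_conjugate_def abs_minor_def)

lemma betsy_ross_abs_nonneg: "0 \<le> betsy_ross_abs S"
  by (simp add: betsy_ross_abs_def abs_minor_def Let_def)

section \<open>The curve of representations\<close>

definition betsy_ross_rep :: "real \<Rightarrow> nat set \<Rightarrow> real" where
  "betsy_ross_rep t S = (if S \<in> betsy_ross_bases then \<bar>betsy_ross_minor S\<bar> powr t else 0)"

lemma betsy_ross_curve_eq: "betsy_ross_curve t = rescaling_class 11 (betsy_ross_rep t)"
  unfolding betsy_ross_curve_def betsy_ross_rep_def ..

text \<open>The support condition disappears because \<open>0 powr t = 0\<close> for every t,
  including t = 0.\<close>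

lemma betsy_ross_rep_eq:
  assumes "S \<subseteq> {..<11}"
  shows "betsy_ross_rep t S = betsy_ross_abs S powr t"
proof (cases "card S = 3")
  case True
  then show ?thesis using assms betsy_ross_abs_eq_minor[OF assms] betsy_ross_bases_iff[of S]
    by (auto simp: betsy_ross_rep_def)
next
  case False
  then show ?thesis by (simp add: betsy_ross_rep_def betsy_ross_bases_iff betsy_ross_abs_def abs_minor_def)
qed

lemma betsy_ross_rep_eq_conjugate:
  assumes "S \<subseteq> {..<11}"
  shows "betsy_ross_rep t S = betsy_ross_abs_conjugate S powr (- t)"
  unfolding betsy_ross_rep_eq[OF assms] betsy_ross_abs_conjugate[OF assms]
  using betsy_ross_abs_nonneg[of S] by (simp add: powr_minus powr_divide)

lemma betsy_ross_rep_nonneg: "0 \<le> betsy_ross_rep t S"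
  by (simp add: betsy_ross_rep_def)

lemma betsy_ross_rep_support: "{S. betsy_ross_rep t S \<noteq> 0} = betsy_ross_bases"
  by (auto simp: betsy_ross_rep_def betsy_ross_bases_def)

lemma betsy_ross_rep_strong:
  assumes "ennreal \<bar>t\<bar> \<le> q"
  shows "betsy_ross_rep t \<in> strong_reps 11 3 betsy_ross_bases q"
proof -
  have "plucker_null q (betsy_ross_rep t) S1 S2"
    if S: "S1 \<subseteq> {..<11}" "S2 \<subseteq> {..<11}" "card S1 + 1 = 3" "card S2 = 3 + 1" for S1 S2
  proof -
    have sub: "insert x S1 \<subseteq> {..<11}" "S2 - {x} \<subseteq> {..<11}" if "x \<in> S2 - S1" for x
      using that S by auto
    have card: "card S1 = 2" "card S2 = 4" using S by auto
    show ?thesis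
    proof (cases "0 \<le> t")
      case True
      have "plucker_null q (betsy_ross_rep t) S1 S2 \<longleftrightarrow> plucker_null q (\<lambda>S. betsy_ross_abs S powr t) S1 S2"
        by (rule plucker_null_cong) (simp only: betsy_ross_rep_eq sub)
      then show ?thesis unfolding betsy_ross_abs_def
        using plucker_null_abs_minor_powr[OF card, of t q] True assms by simp
    next
      case False
      have "plucker_null q (betsy_ross_rep t) S1 S2
        \<longleftrightarrow> plucker_null q (\<lambda>S. betsy_ross_abs_conjugate S powr (- t)) S1 S2"
        by (rule plucker_null_cong) (simp only: betsy_ross_rep_eq_conjugate sub)
      then show ?thesis unfolding betsy_ross_abs_conjugate_def
        using plucker_null_abs_minor_powr[OF card, of "- t" q] False assms by simp
    qed
  qed
  then show ?thesis by (auto simp: strong_reps_def betsy_ross_rep_nonneg betsy_ross_rep_support)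
qed

text \<open>Powers of \<phi> with integer exponent; \<open>Golden (- 1) 1\<close> is \<phi> - 1, the
  inverse of \<phi>.\<close>

definition golden_unit :: "int \<Rightarrow> golden" where
  "golden_unit k = (if 0 \<le> k then Golden 0 1 ^ nat k else Golden (- 1) 1 ^ nat (- k))"

lemma golden_eval_unit: "golden_eval golden_ratio (golden_unit k) = golden_ratio powr k"
proof -
  have p: "0 < golden_ratio" using golden_ratio_props(2) by simp
  have pow: "golden_eval golden_ratio (g ^ m) = golden_eval golden_ratio g ^ m" for g m
    by (induction m) (simp_all add: golden_eval_ring[OF golden_ratio_props(1)], simp add: golden_eval_def one_golden_def)
  have val: "golden_eval golden_ratio (Golden 0 1) = golden_ratio"
    "golden_eval golden_ratio (Golden (- 1) 1) = inverse golden_ratio"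
    using golden_ratio_inverse by (simp_all add: golden_eval_def inverse_eq_divide)
  show ?thesis
  proof (cases "0 \<le> k")
    case True
    then show ?thesis using p by (simp add: golden_unit_def pow val flip: powr_realpow)
  next
    case False
    then have "golden_eval golden_ratio (golden_unit k) = inverse (golden_ratio ^ nat (- k))"
      by (simp add: golden_unit_def pow val power_inverse)
    also have "\<dots> = inverse (golden_ratio powr (- k))" using p False by (simp flip: powr_realpow)
    finally show ?thesis using p by (simp add: powr_minus)
  qed
qed

lemma betsy_ross_rep_abs:
  assumes "a < 11" "b < 11" "c < 11" "a \<noteq> b" "a \<noteq> c" "b \<noteq> c"
  shows "betsy_ross_rep t {a, b, c} = \<bar>golden_eval golden_ratio (golden_minor a b c)\<bar> powr t"
  using assms by (subst betsy_ross_rep_eq) (auto simp: betsy_ross_abs_triple)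

lemma betsy_ross_rep_unit:
  assumes "a < 11" "b < 11" "c < 11" "a \<noteq> b" "a \<noteq> c" "b \<noteq> c"
    and "golden_minor a b c \<in> {golden_unit k, - golden_unit k}"
  shows "betsy_ross_rep t {a, b, c} = golden_ratio powr (t * k)"
proof -
  have "golden_eval x (- g) = - golden_eval x g" for x g
    by (cases g) (simp add: golden_eval_def)
  then have "\<bar>golden_eval golden_ratio (golden_minor a b c)\<bar> = golden_ratio powr k"
    using assms(7) golden_ratio_props(2) by (auto simp: golden_eval_unit)
  then show ?thesis unfolding betsy_ross_rep_abs[OF assms(1-6)] by (simp add: powr_powr mult.commute)
qed

lemma betsy_ross_rep_zero:
  assumes "a < 11" "b < 11" "c < 11" "a \<noteq> b" "a \<noteq> c" "b \<noteq> c" "golden_minor a b c = 0"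
  shows "betsy_ross_rep t {a, b, c} = 0"
  unfolding betsy_ross_rep_abs[OF assms(1-6)] assms(7) by simp

section \<open>Rigidity\<close>

text \<open>
  The matroid is rigid up to one parameter: a function on the bases that satisfies the two-term
  Pluecker relations is determined by its values on the frame below.
\<close>

definition two_term :: "(nat set \<Rightarrow> real) \<Rightarrow> bool" where
  "two_term \<sigma> \<longleftrightarrow> (\<forall>m i j k l. distinct [m, i, j, k, l] \<and> {m, i, j, k, l} \<subseteq> {..<11} \<and>
     (golden_minor m i l = 0 \<or> golden_minor m j k = 0) \<longrightarrow>
     \<sigma> {m, i, j} * \<sigma> {m, k, l} = \<sigma> {m, i, k} * \<sigma> {m, j, l})"

text \<open>Such a step certifies the value 1 on {m, i, j}: one term of the Pluecker relation
  vanishes, and the three other sets in the remaining equality are already listed in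
  \<open>K\<close>. The list holds increasing triples, hence the sorting.\<close>

definition two_term_step :: "nat list list \<Rightarrow> nat \<times> nat \<times> nat \<times> nat \<times> nat \<Rightarrow> bool" where
  "two_term_step K s = (case s of (m, i, j, k, l) \<Rightarrow>
     distinct [m, i, j, k, l] \<and> list_all (\<lambda>x. x < 11) [m, i, j, k, l] \<and>
     (golden_minor m i l = 0 \<or> golden_minor m j k = 0) \<and>
     sort [m, k, l] \<in> set K \<and> sort [m, i, k] \<in> set K \<and> sort [m, j, l] \<in> set K)"

text \<open>An invalid step discards everything, so a faulty certificate could not cover the
  bases.\<close>

primrec propagate :: "nat list list \<Rightarrow> (nat \<times> nat \<times> nat \<times> nat \<times> nat) list \<Rightarrow> nat list list" where
  "propagate K [] = K"
| "propagate K (s # ss) = (if two_term_step K s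
     then propagate ((case s of (m, i, j, k, l) \<Rightarrow> sort [m, i, j]) # K) ss else [])"

lemma propagate_one:
  assumes "two_term \<sigma>" "\<forall>T\<in>set K. \<sigma> (set T) = 1"
  shows "\<forall>T\<in>set (propagate K ss). \<sigma> (set T) = 1"
  using assms(2)
proof (induction ss arbitrary: K)
  case (Cons s ss)
  obtain m i j k l where s: "s = (m, i, j, k, l)" by (cases s) auto
  show ?case
  proof (cases "two_term_step K s")
    case True
    note st = True[unfolded two_term_step_def s prod.case]
    have sub: "{m, i, j, k, l} \<subseteq> {..<11}" using st by (elim conjE) simp
    have one: "\<sigma> (set T) = 1" if "sort T \<in> set K" for T
      using bspec[OF Cons.prems that] unfolding set_sort .
    have "\<sigma> (set [m, k, l]) = 1" "\<sigma> (set [m, i, k]) = 1" "\<sigma> (set [m, j, l]) = 1"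
      using st one by blast+
    moreover have "\<sigma> {m, i, j} * \<sigma> {m, k, l} = \<sigma> {m, i, k} * \<sigma> {m, j, l}"
      using assms(1) st sub unfolding two_term_def by blast
    ultimately have "\<sigma> (set (sort [m, i, j])) = 1" unfolding set_sort by simp
    then have "\<forall>T\<in>set (sort [m, i, j] # K). \<sigma> (set T) = 1"
      using Cons.prems by (metis set_ConsD)
    from Cons.IH[OF this] show ?thesis using True unfolding s
      by (simp only: propagate.simps if_True prod.case)
  qed simp
qed simp

text \<open>Four triples on 0, 1, 2, 3 and one for each element from 4 to 10 make eleven, as many as
  there are torus coordinates. The twelfth, \<open>[1, 2, 10]\<close>, is settled by the
  exponent.\<close>

definition betsy_ross_frame :: "nat list list" where
  "betsy_ross_frame = [[0, 1, 2], [0, 1, 3], [0, 2, 3], [1, 2, 3], [2, 3, 4], [0, 2, 5], [1, 3, 6],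
    [2, 3, 7], [2, 3, 8], [0, 3, 9], [2, 3, 10], [1, 2, 10]]"

text \<open>The order matters: a step may use only the frame and the triples obtained by earlier
  steps.\<close>

definition betsy_ross_derivation :: "(nat \<times> nat \<times> nat \<times> nat \<times> nat) list" where
  "betsy_ross_derivation =
  [(2, 5, 8, 0, 3), (3, 7, 9, 2, 0), (3, 2, 9, 1, 0), (3, 6, 9, 1, 0), (2, 1, 8, 0, 3),
   (2, 1, 7, 10, 3), (3, 2, 6, 7, 9), (0, 5, 9, 2, 3), (0, 1, 9, 2, 3), (2, 5, 9, 8, 3),
   (9, 1, 2, 0, 3), (3, 1, 7, 0, 9), (9, 1, 6, 0, 3), (1, 7, 9, 3, 2), (9, 5, 6, 2, 3),
   (1, 3, 8, 7, 2), (9, 5, 7, 2, 1), (3, 8, 9, 1, 0), (1, 8, 9, 3, 7), (5, 6, 8, 9, 2),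
   (5, 0, 6, 2, 9), (9, 5, 8, 0, 3), (3, 1, 10, 8, 2), (3, 9, 10, 8, 1), (1, 9, 10, 6, 3),
   (1, 2, 6, 10, 9), (9, 5, 10, 8, 3), (5, 2, 10, 0, 9), (2, 1, 4, 6, 3), (5, 6, 10, 0, 2),
   (1, 4, 9, 2, 8), (1, 3, 4, 8, 9), (9, 4, 5, 1, 6), (3, 4, 9, 1, 7), (5, 0, 4, 6, 9),
   (2, 5, 7, 10, 3), (5, 4, 7, 0, 2), (5, 4, 10, 9, 6), (4, 3, 10, 9, 5), (3, 4, 8, 10, 1),
   (5, 4, 8, 9, 6), (4, 3, 7, 8, 5), (5, 6, 7, 8, 2), (8, 4, 9, 3, 1), (8, 1, 5, 3, 4),
   (1, 5, 10, 8, 3), (4, 2, 7, 1, 3), (7, 4, 9, 2, 1), (10, 2, 6, 1, 5), (4, 1, 10, 9, 3),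
   (5, 0, 1, 9, 8), (4, 1, 5, 2, 7), (2, 4, 8, 7, 5), (6, 9, 10, 1, 2), (2, 0, 4, 1, 8),
   (1, 5, 7, 8, 3), (2, 1, 5, 6, 10), (6, 2, 7, 10, 5), (2, 0, 6, 4, 3), (5, 1, 6, 4, 10),
   (0, 3, 5, 2, 6), (9, 0, 4, 5, 8), (9, 4, 6, 3, 10), (4, 2, 9, 8, 5), (6, 2, 8, 1, 5),
   (1, 7, 10, 9, 4), (6, 1, 4, 5, 9), (9, 0, 10, 4, 5), (6, 0, 4, 5, 9), (6, 1, 7, 3, 2),
   (3, 5, 7, 0, 9), (6, 4, 8, 9, 5), (4, 2, 10, 0, 5), (3, 2, 5, 9, 7), (2, 6, 9, 0, 4),
   (5, 3, 10, 7, 9), (4, 3, 6, 2, 1), (3, 5, 6, 0, 9), (1, 8, 10, 9, 4), (3, 5, 8, 7, 1),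
   (0, 6, 9, 5, 3), (4, 7, 10, 9, 5), (3, 4, 5, 9, 2), (4, 8, 10, 3, 1), (7, 4, 6, 9, 1),
   (1, 6, 8, 4, 10), (10, 7, 9, 4, 3), (0, 1, 6, 3, 9), (10, 4, 6, 3, 9), (10, 6, 8, 5, 1),
   (8, 3, 6, 4, 10), (10, 2, 9, 4, 6), (1, 0, 10, 6, 8), (2, 8, 10, 6, 9), (6, 0, 10, 1, 2),
   (10, 5, 7, 2, 9), (6, 3, 10, 4, 0), (2, 0, 10, 5, 8), (6, 7, 9, 2, 3), (6, 0, 8, 5, 3),
   (0, 3, 4, 1, 6), (7, 2, 9, 1, 10), (10, 5, 8, 3, 2), (0, 4, 10, 5, 1), (9, 8, 10, 5, 2),
   (0, 5, 8, 2, 6), (6, 7, 10, 1, 2), (8, 6, 9, 2, 5), (3, 7, 10, 5, 6), (8, 0, 3, 5, 2),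
   (2, 7, 8, 9, 1), (3, 7, 8, 5, 0), (6, 7, 8, 9, 0), (9, 0, 7, 3, 2), (0, 3, 10, 5, 9),
   (8, 7, 9, 3, 4), (8, 0, 10, 5, 2), (8, 0, 4, 3, 9), (7, 0, 5, 9, 3), (2, 0, 7, 10, 5),
   (0, 4, 7, 3, 9), (8, 0, 7, 10, 2), (10, 7, 8, 3, 6), (10, 0, 7, 9, 5), (8, 0, 1, 6, 9),
   (8, 5, 7, 1, 9), (1, 0, 4, 8, 3), (7, 0, 1, 8, 3)]"

definition covers_bases :: "nat list list \<Rightarrow> bool" where
  "covers_bases K \<longleftrightarrow> (\<forall>c\<in>set [0..<11]. \<forall>b\<in>set [0..<c]. \<forall>a\<in>set [0..<b].
     golden_minor a b c = 0 \<or> [a, b, c] \<in> set K)"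

lemma covers_bases_derivation: "covers_bases (propagate betsy_ross_frame betsy_ross_derivation)"
  unfolding golden_minor_def by code_simp

lemma two_term_rigid:
  assumes "two_term \<sigma>" "\<forall>T\<in>set betsy_ross_frame. \<sigma> (set T) = 1" "S \<in> betsy_ross_bases"
  shows "\<sigma> S = 1"
proof -
  obtain a b c where S: "S = {a, b, c}" "a < b" "b < c" "c < 11"
    using assms(3) triple_sorted[of S 11] unfolding betsy_ross_bases_iff by blast
  have "golden_minor a b c \<noteq> 0"
    using assms(3) S unfolding betsy_ross_bases_iff by (auto simp: betsy_ross_abs_triple)
  moreover have "c \<in> set [0..<11]" "b \<in> set [0..<c]" "a \<in> set [0..<b]" using S by auto
  ultimately have "[a, b, c] \<in> set (propagate betsy_ross_frame betsy_ross_derivation)"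
    using covers_bases_derivation unfolding covers_bases_def by blast
  from bspec[OF propagate_one[OF assms(1,2)] this] show ?thesis by (simp add: S(1))
qed

text \<open>If at most two entries are nonzero, the inequality at the maximal one bounds it by the
  other, so they agree. Thus the case \<open>q = \<infinity>\<close> is the weakest, and rigidity
  has to be shown only there.\<close>

lemma tropical_null_infinity:
  assumes "finite I" and nn: "\<And>i. i \<in> I \<Longrightarrow> 0 \<le> b i" and null: "tropical_null q I b"
  shows "tropical_null \<infinity> I b"
proof (cases "q = 0 \<or> q = \<infinity>")
  case True
  then show ?thesis using null by (auto simp: tropical_null_def Let_def)
next
  case False
  define e where "e = 1 / enn2real q"
  have le: "b i powr e \<le> (\<Sum>j\<in>I - {i}. b j powr e)" if "i \<in> I" for i
    using null that False by (simp add: tropical_null_def e_def)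
  have "0 < enn2real q" using False by (simp add: enn2real_positive_iff top.not_eq_extremum zero_less_iff_neq_zero)
  then have e: "0 < e" by (simp add: e_def)
  show ?thesis
  proof (cases "\<forall>i\<in>I. b i = 0")
    case True
    then show ?thesis by (simp add: tropical_null_def Let_def)
  next
    case False
    then have "b ` I \<noteq> {}" by blast
    then have "Max (b ` I) \<in> b ` I" using assms(1) by (intro Max_in) auto
    then obtain i where i: "i \<in> I" "b i = Max (b ` I)" by force
    have max: "b k \<le> b i" if "k \<in> I" for k unfolding i(2) using that assms(1) by (intro Max_ge) auto
    obtain i' where "i' \<in> I" "b i' \<noteq> 0" using False by blast
    then have bi: "0 < b i" using max[of i'] nn[of i'] by linarith
    have "\<exists>j\<in>I - {i}. b j \<noteq> 0"
    proof (rule ccontr)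
      assume "\<not> ?thesis"
      then have "(\<Sum>j\<in>I - {i}. b j powr e) = 0" by (intro sum.neutral) simp
      then show False using le[OF i(1)] bi by simp
    qed
    then obtain j where j: "j \<in> I" "j \<noteq> i" "b j \<noteq> 0" by blast
    show ?thesis
    proof (cases "\<exists>k\<in>I - {i, j}. b k \<noteq> 0")
      case True
      then obtain k where k: "k \<in> I" "k \<noteq> i" "k \<noteq> j" "b k \<noteq> 0" by blast
      have "card {i, j, k} \<le> card {i \<in> I. b i \<noteq> 0}"
        using i j k bi assms(1) by (intro card_mono) auto
      moreover have "card {i, j, k} = 3" using j(2) k(2,3) by auto
      ultimately show ?thesis by (simp add: tropical_null_def Let_def)
    next
      case False
      then have "(\<Sum>j\<in>I - {i}. b j powr e) = (\<Sum>j\<in>{j}. b j powr e)"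
        using assms(1) j by (intro sum.mono_neutral_right) auto
      then have "b i powr e \<le> b j powr e" using le[OF i(1)] by simp
      then have "b i \<le> b j" using powr_less_mono2[OF e nn[OF j(1)], of "b i"] by linarith
      then have "b i = b j" using max[OF j(1)] by simp
      then have "\<exists>i\<in>I. \<exists>j\<in>I. i \<noteq> j \<and> b i = b j \<and> (\<forall>k\<in>I. b k \<le> b i)"
        using i(1) j max by (intro bexI[of _ i] bexI[of _ j]) simp_all
      then show ?thesis by (simp add: tropical_null_def Let_def)
    qed
  qed
qed

lemma weak_reps_subset_infinity: "weak_reps n d B q \<subseteq> weak_reps n d B \<infinity>"
proof
  fix \<rho> assume \<rho>: "\<rho> \<in> weak_reps n d B q"
  have "plucker_null \<infinity> \<rho> S1 S2"
    if S: "S1 \<subseteq> {..<n}" "S2 \<subseteq> {..<n}" "card S1 + 1 = d" "card S2 = d + 1" "card (S2 - S1) = 3" for S1 S2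
    unfolding plucker_null_def
  proof (rule tropical_null_infinity)
    show "finite (S2 - S1)" using S(2) finite_subset by blast
    show "0 \<le> \<rho> (insert i S1) * \<rho> (S2 - {i})" for i using \<rho> by (simp add: weak_reps_def)
    show "tropical_null q (S2 - S1) (\<lambda>x. \<rho> (insert x S1) * \<rho> (S2 - {x}))"
      using \<rho> S unfolding weak_reps_def plucker_null_def by blast
  qed
  then show "\<rho> \<in> weak_reps n d B \<infinity>" using \<rho> unfolding weak_reps_def by blast
qed

lemma strong_reps_subset_weak_reps: "strong_reps n d B q \<subseteq> weak_reps n d B q"
  unfolding strong_reps_def weak_reps_def by blast

lemma strong_reps_rescale:
  assumes "\<rho> \<in> strong_reps n d B q" and t: "\<And>i. 0 < t i"
  shows "(\<lambda>S. (\<Prod>i\<in>S. t i) * \<rho> S) \<in> strong_reps n d B q"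
proof -
  \<comment> \<open>Arbitrary sets of naturals occur here, even infinite ones, whose product is 1 by
    convention. Positivity of \<open>t\<close> everywhere keeps the support unchanged set by
    set.\<close>
  have p: "0 < (\<Prod>i\<in>S. t i)" for S using t by (intro prod_pos) auto
  have "plucker_null q (\<lambda>S. (\<Prod>i\<in>S. t i) * \<rho> S) S1 S2 \<longleftrightarrow> plucker_null q \<rho> S1 S2"
    if "S1 \<subseteq> {..<n}" "S2 \<subseteq> {..<n}" for S1 S2
    using that assms by (intro plucker_null_rescale) (auto simp: strong_reps_def intro: finite_subset)
  moreover have "(\<Prod>i\<in>S. t i) * \<rho> S \<noteq> 0 \<longleftrightarrow> \<rho> S \<noteq> 0" for S using p[of S] by simp
  moreover have "0 \<le> (\<Prod>i\<in>S. t i) * \<rho> S" for S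
    using p[of S] assms(1) by (simp add: strong_reps_def)
  ultimately show ?thesis using assms(1) by (simp add: strong_reps_def)
qed

lemma rescaling_class_rescale:
  assumes t: "\<And>i. 0 < t i"
  shows "rescaling_class n (\<lambda>S. (\<Prod>i\<in>S. t i) * \<rho> S) = rescaling_class n \<rho>"
proof (intro equalityI subsetI)
  fix \<sigma> assume "\<sigma> \<in> rescaling_class n (\<lambda>S. (\<Prod>i\<in>S. t i) * \<rho> S)"
  then obtain u where u: "\<forall>i<n. 0 < u i" "\<sigma> = (\<lambda>S. (\<Prod>i\<in>S. u i) * ((\<Prod>i\<in>S. t i) * \<rho> S))"
    by (auto simp: rescaling_class_def)
  then have "\<sigma> = (\<lambda>S. (\<Prod>i\<in>S. u i * t i) * \<rho> S)" "\<forall>i<n. 0 < u i * t i"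
    using t by (auto simp: prod.distrib mult_ac)
  then show "\<sigma> \<in> rescaling_class n \<rho>" unfolding rescaling_class_def by blast
next
  fix \<sigma> assume "\<sigma> \<in> rescaling_class n \<rho>"
  then obtain u where u: "\<forall>i<n. 0 < u i" "\<sigma> = (\<lambda>S. (\<Prod>i\<in>S. u i) * \<rho> S)"
    by (auto simp: rescaling_class_def)
  have "(\<Prod>i\<in>S. u i) = (\<Prod>i\<in>S. u i / t i) * (\<Prod>i\<in>S. t i)" for S
    using t by (simp add: less_imp_neq[symmetric] flip: prod.distrib)
  then have "\<sigma> = (\<lambda>S. (\<Prod>i\<in>S. u i / t i) * ((\<Prod>i\<in>S. t i) * \<rho> S))" "\<forall>i<n. 0 < u i / t i"
    using u t by (simp_all add: mult.assoc)
  then show "\<sigma> \<in> rescaling_class n (\<lambda>S. (\<Prod>i\<in>S. t i) * \<rho> S)" unfolding rescaling_class_def by blast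
qed

lemma rescaling_class_self: "\<rho> \<in> rescaling_class n \<rho>"
  unfolding rescaling_class_def by (intro CollectI exI[of _ "\<lambda>_. 1"]) simp

text \<open>If the real value of a minor is 0, so is its norm, whereas nonzero minors have norm 1 or
  -1. Bases can therefore be recognised by exact computation.\<close>

lemma triple_in_betsy_ross_bases:
  assumes "{a, b, c} \<subseteq> {..<11}" "a \<noteq> b" "a \<noteq> c" "b \<noteq> c"
  shows "{a, b, c} \<in> betsy_ross_bases \<longleftrightarrow> golden_minor a b c \<noteq> 0"
proof -
  let ?g = "golden_minor a b c"
  have "golden_eval golden_ratio ?g \<noteq> 0" if "?g \<noteq> 0"
  proof
    assume "golden_eval golden_ratio ?g = 0"
    then have "golden_norm ?g = 0" using golden_eval_conjugate[OF golden_ratio_props(1), of ?g] by simp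
    then show False using golden_minor_norm[of a b c] assms that by simp
  qed
  then show ?thesis using assms by (auto simp: betsy_ross_bases_iff betsy_ross_abs_triple)
qed

text \<open>In the relation for {m, i} and {m, j, k, l} the third term is \<rho>{m, i, l} \<rho>{m,
  j, k}, which is 0. Three nonzero terms are then impossible, so \<open>\<infinity>\<close>-nullity
  forces the other two to agree.\<close>

lemma weak_reps_two_term:
  assumes "\<rho> \<in> weak_reps 11 3 betsy_ross_bases \<infinity>"
  shows "two_term \<rho>"
  unfolding two_term_def
proof (intro allI impI, elim conjE)
  fix m i j k l :: nat
  assume d: "distinct [m, i, j, k, l]" and sub: "{m, i, j, k, l} \<subseteq> {..<11}"
    and zero: "golden_minor m i l = 0 \<or> golden_minor m j k = 0"
  have nn: "0 \<le> \<rho> S" for S using assms by (simp add: weak_reps_def)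
  have supp: "\<rho> S = 0" if "S \<notin> betsy_ross_bases" for S using assms that by (auto simp: weak_reps_def)
  have ne: "j \<noteq> k" "k \<noteq> j" "j \<noteq> l" "l \<noteq> j" "k \<noteq> l" "l \<noteq> k" using d by auto
  define b where "b = (\<lambda>x. if x = j then \<rho> {m, i, j} * \<rho> {m, k, l}
    else if x = k then \<rho> {m, i, k} * \<rho> {m, j, l} else \<rho> {m, i, l} * \<rho> {m, j, k})"
  have "{m, j, k, l} - {m, i} = {j, k, l}" using d by auto
  then have "card ({m, j, k, l} - {m, i}) = 3" using ne by simp
  then have "plucker_null \<infinity> \<rho> {m, i} {m, j, k, l}"
    using assms d sub unfolding weak_reps_def by simp
  then have null: "tropical_null \<infinity> {j, k, l} b" unfolding plucker_null_three_term[OF d] b_def .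
  have "\<rho> {m, i, l} = 0 \<or> \<rho> {m, j, k} = 0"
    using zero triple_in_betsy_ross_bases[of m i l] triple_in_betsy_ross_bases[of m j k] sub d supp by auto
  then have bl: "b l = 0" using ne by (auto simp: b_def)
  have b0: "0 \<le> b x" for x using nn by (simp add: b_def)
  have "{x \<in> {j, k, l}. b x \<noteq> 0} \<subseteq> {j, k}" using bl by auto
  then have "card {x \<in> {j, k, l}. b x \<noteq> 0} \<le> card {j, k}" by (intro card_mono) auto
  then have "\<not> 3 \<le> card {x \<in> {j, k, l}. b x \<noteq> 0}" using ne by simp
  then have "b j = b k"
    using null bl b0[of j] b0[of k] by (auto simp: tropical_null_def Let_def)
  then show "\<rho> {m, i, j} * \<rho> {m, k, l} = \<rho> {m, i, k} * \<rho> {m, j, l}" using ne by (simp add: b_def)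
qed

text \<open>Together with the next two lemmas: solutions of the two-term relations are closed under
  pointwise products and inverses (with \<open>inverse 0 = 0\<close>) and include the torus factors.
  A representation may thus be divided by a point of the curve and rescaled.\<close>

lemma two_term_mult:
  assumes "two_term \<rho>" "two_term \<sigma>"
  shows "two_term (\<lambda>S. \<rho> S * \<sigma> S)"
  unfolding two_term_def
proof (intro allI impI)
  fix m i j k l
  assume A: "distinct [m, i, j, k, l] \<and> {m, i, j, k, l} \<subseteq> {..<11} \<and> (golden_minor m i l = 0 \<or> golden_minor m j k = 0)"
  have "\<rho> {m, i, j} * \<rho> {m, k, l} * (\<sigma> {m, i, j} * \<sigma> {m, k, l})
    = \<rho> {m, i, k} * \<rho> {m, j, l} * (\<sigma> {m, i, k} * \<sigma> {m, j, l})"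
    using assms A unfolding two_term_def by metis
  then show "\<rho> {m, i, j} * \<sigma> {m, i, j} * (\<rho> {m, k, l} * \<sigma> {m, k, l})
    = \<rho> {m, i, k} * \<sigma> {m, i, k} * (\<rho> {m, j, l} * \<sigma> {m, j, l})" by (simp only: mult_ac)
qed

lemma two_term_inverse:
  assumes "two_term \<rho>"
  shows "two_term (\<lambda>S. inverse (\<rho> S))"
  using assms unfolding two_term_def by (simp only: inverse_mult_distrib[symmetric]) metis

lemma two_term_prod: "two_term (\<lambda>S. \<Prod>i\<in>S. t i)"
  unfolding two_term_def by (auto simp: mult_ac)

lemma betsy_ross_frame_bases: "\<forall>T\<in>set betsy_ross_frame. set T \<in> betsy_ross_bases"
proof -
  have "list_all (\<lambda>T. golden_minor (T ! 0) (T ! 1) (T ! 2) \<noteq> 0) betsy_ross_frame"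
    unfolding golden_minor_def by code_simp
  then show ?thesis
    unfolding betsy_ross_frame_def by (simp add: triple_in_betsy_ross_bases)
qed

lemma betsy_ross_rep_values:
  "betsy_ross_rep s {0, 1, 2} = 1" "betsy_ross_rep s {2, 3, 10} = 1" "betsy_ross_rep s {1, 2, 10} = 1"
  "betsy_ross_rep s {0, 2, 10} = 1" "betsy_ross_rep s {0, 2, 3} = golden_ratio powr (- s)"
  "betsy_ross_rep s {1, 2, 3} = golden_ratio powr s"
proof -
  have "golden_minor 0 1 2 \<in> {golden_unit 0, - golden_unit 0} \<and>
    golden_minor 2 3 10 \<in> {golden_unit 0, - golden_unit 0} \<and>
    golden_minor 1 2 10 \<in> {golden_unit 0, - golden_unit 0} \<and>
    golden_minor 0 2 10 \<in> {golden_unit 0, - golden_unit 0} \<and>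
    golden_minor 0 2 3 \<in> {golden_unit (- 1), - golden_unit (- 1)} \<and>
    golden_minor 1 2 3 \<in> {golden_unit 1, - golden_unit 1}"
    unfolding golden_minor_def by code_simp
  then show "betsy_ross_rep s {0, 1, 2} = 1" "betsy_ross_rep s {2, 3, 10} = 1" "betsy_ross_rep s {1, 2, 10} = 1"
    "betsy_ross_rep s {0, 2, 10} = 1" "betsy_ross_rep s {0, 2, 3} = golden_ratio powr (- s)"
    "betsy_ross_rep s {1, 2, 3} = golden_ratio powr s"
    using betsy_ross_rep_unit[of 0 1 2 0 s] betsy_ross_rep_unit[of 2 3 10 0 s] betsy_ross_rep_unit[of 1 2 10 0 s]
      betsy_ross_rep_unit[of 0 2 10 0 s] betsy_ross_rep_unit[of 0 2 3 "- 1" s] betsy_ross_rep_unit[of 1 2 3 1 s]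
      golden_ratio_props(2)
    by (simp_all del: insert_iff)
qed

lemma weak_reps_normal_form:
  assumes \<rho>: "\<rho> \<in> weak_reps 11 3 betsy_ross_bases \<infinity>"
  obtains s t where "\<And>i. 0 < t i" "\<rho> = (\<lambda>S. (\<Prod>i\<in>S. t i) * betsy_ross_rep s S)"
proof -
  have supp: "\<rho> S \<noteq> 0 \<longleftrightarrow> S \<in> betsy_ross_bases" for S using \<rho> by (auto simp: weak_reps_def)
  have nn: "0 \<le> \<rho> S" for S using \<rho> by (simp add: weak_reps_def)
  have bpos: "0 < betsy_ross_rep s S" if "S \<in> betsy_ross_bases" for s S
    using that by (auto simp: betsy_ross_rep_def betsy_ross_bases_def)
  \<comment> \<open>A cross-ratio that is invariant under the torus. On
    \<open>betsy_ross_rep s\<close> it equals \<phi>^s, which is why s is its logarithm.\<close>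
  define c where "c = (\<rho> {0, 1, 2} * \<rho> {2, 3, 10}) / (\<rho> {0, 2, 3} * \<rho> {1, 2, 10})"
  define s where "s = log golden_ratio c"
  define \<theta> where "\<theta> = (\<lambda>S. \<rho> S * inverse (betsy_ross_rep s S))"
  have \<theta>pos: "0 < \<theta> S" if "S \<in> betsy_ross_bases" for S
    unfolding \<theta>_def using bpos[OF that] nn[of S] supp[of S] that by (simp add: less_le)
  define x where "x = (\<lambda>i j k. \<theta> {i, j, k})"
  have x0: "0 < x 0 1 2" "0 < x 0 1 3" "0 < x 0 2 3" "0 < x 1 2 3" "0 < x 2 3 4" "0 < x 0 2 5"
    "0 < x 1 3 6" "0 < x 2 3 7" "0 < x 2 3 8" "0 < x 0 3 9" "0 < x 2 3 10" "0 < x 1 2 10"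
    using betsy_ross_frame_bases unfolding betsy_ross_frame_def x_def by (auto intro!: \<theta>pos)
  have \<rho>0: "0 < \<rho> {0, 1, 2}" "0 < \<rho> {0, 2, 3}" "0 < \<rho> {2, 3, 10}" "0 < \<rho> {1, 2, 10}"
    using betsy_ross_frame_bases supp nn unfolding betsy_ross_frame_def by (auto simp: less_le)
  have "0 < c" using \<rho>0 by (simp add: c_def)
  then have "golden_ratio powr s = c" unfolding s_def using golden_ratio_props(2) by simp
  then have cross: "x 0 1 2 * x 2 3 10 = x 0 2 3 * x 1 2 10"
    using \<rho>0 by (simp add: x_def \<theta>_def betsy_ross_rep_values[unfolded One_nat_def] powr_minus c_def)
  define p where "p = x 0 1 2 * x 0 1 3 * x 0 2 3 * x 1 2 3"
  have p: "0 < p" using x0 by (simp add: p_def)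
  \<comment> \<open>Solves the frame equations on {0, 1, 2, 3}: with \<tau> i equal to \<kappa>
    times the value on the complementary triple, each of the four products becomes \<kappa>^3 p =
    1.\<close>
  define \<kappa> where "\<kappa> = p powr (- (1 / 3))"
  have \<kappa>: "0 < \<kappa>" using p by (simp add: \<kappa>_def)
  have "\<kappa> * \<kappa> * \<kappa> = p powr (- 1)" unfolding \<kappa>_def by (simp flip: powr_add)
  then have \<kappa>3: "\<kappa> * \<kappa> * \<kappa> * p = 1" using p by (simp add: powr_minus)
  \<comment> \<open>Each element from 4 to 10 is fixed by the frame triple that joins it to two of
    0, 1, 2, 3; for 10 this is {2, 3, 10}.\<close>
  define \<tau> where "\<tau> = (\<lambda>_ :: nat. 1 :: real)(0 := \<kappa> * x 1 2 3, 1 := \<kappa> * x 0 2 3, 2 := \<kappa> * x 0 1 3, 3 := \<kappa> * x 0 1 2,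
    4 := 1 / (\<kappa> * x 0 1 3 * (\<kappa> * x 0 1 2) * x 2 3 4), 5 := 1 / (\<kappa> * x 1 2 3 * (\<kappa> * x 0 1 3) * x 0 2 5),
    6 := 1 / (\<kappa> * x 0 2 3 * (\<kappa> * x 0 1 2) * x 1 3 6), 7 := 1 / (\<kappa> * x 0 1 3 * (\<kappa> * x 0 1 2) * x 2 3 7),
    8 := 1 / (\<kappa> * x 0 1 3 * (\<kappa> * x 0 1 2) * x 2 3 8), 9 := 1 / (\<kappa> * x 1 2 3 * (\<kappa> * x 0 1 2) * x 0 3 9),
    10 := 1 / (\<kappa> * x 0 1 3 * (\<kappa> * x 0 1 2) * x 2 3 10))"
  have \<tau>: "0 < \<tau> i" for i unfolding \<tau>_def using x0 \<kappa> by simp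
  define \<sigma> where "\<sigma> = (\<lambda>S. (\<Prod>i\<in>S. \<tau> i) * \<theta> S)"
  have "two_term \<sigma>"
    unfolding \<sigma>_def \<theta>_def
    by (intro two_term_mult two_term_inverse two_term_prod weak_reps_two_term \<rho>
        subsetD[OF strong_reps_subset_weak_reps] betsy_ross_rep_strong) simp
  moreover have "\<forall>T\<in>set betsy_ross_frame. \<sigma> (set T) = 1"
  proof -
    have x': "\<theta> {i, j, k} = x i j k" for i j k by (simp add: x_def)
    \<comment> \<open>The twelfth frame equation has no free torus coordinate left; it holds by the
      choice of s.\<close>
    have last: "\<tau> 1 * \<tau> 2 * \<tau> 10 * x 1 2 10 = 1"
      using x0 \<kappa> cross by (simp add: \<tau>_def field_simps)
    show ?thesis
      unfolding betsy_ross_frame_def \<sigma>_def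
      using x0 \<kappa> \<kappa>3 last unfolding p_def by (simp add: x') (simp add: \<tau>_def field_simps)
  qed
  ultimately have \<sigma>1: "\<sigma> S = 1" if "S \<in> betsy_ross_bases" for S
    using two_term_rigid that by blast
  have "\<rho> S = (\<Prod>i\<in>S. 1 / \<tau> i) * betsy_ross_rep s S" for S
  proof (cases "S \<in> betsy_ross_bases")
    case True
    have p: "0 < (\<Prod>i\<in>S. \<tau> i)" using \<tau> by (intro prod_pos) auto
    have "(\<Prod>i\<in>S. \<tau> i) * \<rho> S = betsy_ross_rep s S"
      using \<sigma>1[OF True] bpos[OF True, of s] unfolding \<sigma>_def \<theta>_def by (simp add: field_simps)
    then show ?thesis using p by (simp add: prod_dividef field_simps)
  next
    case False
    then show ?thesis using supp[of S] by (simp add: betsy_ross_rep_def)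
  qed
  then show ?thesis using that[of "\<lambda>i. 1 / \<tau> i" s] \<tau> by auto
qed

section \<open>Bounds on the exponent\<close>

text \<open>An entry (a, b, c, k) records that, after rescaling by
  \<open>parallelogram_weight\<close>, the coefficient of {a, b, c} is \<phi>^(s k). The vertices
  are 1, 10, 2, 4 in cyclic order, 6 and 7 are the directions of the sides, and 0 is the third
  direction.\<close>

definition parallelogram_units :: "(nat \<times> nat \<times> nat \<times> int) list" where
  "parallelogram_units =
   [(1, 10, 2, 0), (1, 10, 4, 0), (1, 2, 4, 0), (10, 2, 4, 0), (1, 2, 6, 0), (1, 4, 6, 0),
    (10, 2, 6, 0), (10, 4, 6, 0), (1, 10, 7, 0), (1, 2, 7, 0), (10, 4, 7, 0), (2, 4, 7, 0),
    (1, 6, 7, 0), (10, 6, 7, 0), (2, 6, 7, 0), (4, 6, 7, 0), (0, 1, 10, - 1), (0, 1, 2, 1),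
    (0, 1, 4, 0), (0, 10, 2, 0), (0, 10, 4, - 2), (0, 2, 4, - 1), (0, 1, 6, - 1), (0, 10, 6, - 1),
    (0, 2, 6, - 1), (0, 4, 6, - 1), (0, 1, 7, 0), (0, 10, 7, 0), (0, 2, 7, 0), (0, 4, 7, 0)]"

text \<open>Exponents of the torus element that gives all bases inside {1, 2, 4, 6, 7, 10} the value
  1.\<close>

definition parallelogram_weight :: "nat \<Rightarrow> int" where
  "parallelogram_weight i = (if i = 2 then 1 else if i = 6 \<or> i = 10 then - 1 else 0)"

definition parallelogram_lines :: "(nat \<times> nat \<times> nat) list" where
  "parallelogram_lines = [(1, 10, 6), (2, 4, 6), (1, 4, 7), (10, 2, 7), (0, 6, 7)]"

lemma golden_parallelogram:
  "list_all (\<lambda>(a, b, c, k).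
     (let m = k - parallelogram_weight a - parallelogram_weight b - parallelogram_weight c
      in golden_minor a b c \<in> {golden_unit m, - golden_unit m}) \<and>
     distinct [a, b, c] \<and> list_all (\<lambda>i. i < 11) [a, b, c]) parallelogram_units"
  "list_all (\<lambda>(a, b, c). golden_minor a b c = 0 \<and>
     distinct [a, b, c] \<and> list_all (\<lambda>i. i < 11) [a, b, c]) parallelogram_lines"
  unfolding golden_minor_def by code_simp+

lemma betsy_ross_rep_stable_cubic:
  assumes stab: "stable_cubic (betsy_ross_rep s) 11" and s: "\<bar>s\<bar> \<le> 2"
  shows "s = 2 \<or> s = - 2"
proof -
  let ?\<phi> = golden_ratio
  define \<tau> where "\<tau> = (\<lambda>i. ?\<phi> powr (s * of_int (parallelogram_weight i)))"
  define r where "r = (\<lambda>S. (\<Prod>i\<in>S. \<tau> i) * betsy_ross_rep s S)"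
  have p: "0 < ?\<phi>" "1 < ?\<phi>" using golden_ratio_props(2) by simp_all
  have "stable_cubic r 11" unfolding r_def using stab p by (intro stable_cubic_rescale) (simp_all add: \<tau>_def)
  have "list_all (\<lambda>(a, b, c, k). r {a, b, c} = ?\<phi> powr (s * of_int k)) parallelogram_units"
    using golden_parallelogram(1)
  proof (rule list.pred_mono_strong)
    fix x :: "nat \<times> nat \<times> nat \<times> int"
    obtain a b c k where x: "x = (a, b, c, k)" by (cases x)
    define m where "m = k - parallelogram_weight a - parallelogram_weight b - parallelogram_weight c"
    assume "case x of (a, b, c, k) \<Rightarrow>
      (let m = k - parallelogram_weight a - parallelogram_weight b - parallelogram_weight c
       in golden_minor a b c \<in> {golden_unit m, - golden_unit m}) \<and>
      distinct [a, b, c] \<and> list_all (\<lambda>i. i < 11) [a, b, c]"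
    then have g: "golden_minor a b c \<in> {golden_unit m, - golden_unit m}"
      and abc: "a < 11" "b < 11" "c < 11" "a \<noteq> b" "a \<noteq> c" "b \<noteq> c" by (auto simp: x m_def Let_def)
    have "r {a, b, c} = \<tau> a * \<tau> b * \<tau> c * ?\<phi> powr (s * of_int m)"
      unfolding r_def betsy_ross_rep_unit[OF abc g] using abc by simp
    also have "\<dots> = ?\<phi> powr (s * of_int k)"
      unfolding \<tau>_def powr_add[symmetric] by (simp add: m_def algebra_simps)
    finally show "case x of (a, b, c, k) \<Rightarrow> r {a, b, c} = ?\<phi> powr (s * of_int k)" by (simp add: x)
  qed
  note units = this[unfolded parallelogram_units_def list.pred_inject prod.case]
  have "list_all (\<lambda>(a, b, c). r {a, b, c} = 0) parallelogram_lines"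
    using golden_parallelogram(2)
    by (rule list.pred_mono_strong) (auto simp: r_def betsy_ross_rep_zero)
  note lines = this[unfolded parallelogram_lines_def list.pred_inject prod.case]
  define v where "v = ?\<phi> powr (- s)"
  have v: "0 < v" "?\<phi> \<noteq> 0" using p by (simp_all add: v_def)
  have "v\<^sup>2 = ?\<phi> powr - (s * 2)"
    unfolding v_def power2_eq_square powr_add[symmetric] by (rule arg_cong) simp
  then have vs: "?\<phi> powr - (s * 2) = v\<^sup>2" "?\<phi> powr (- s) = v" "?\<phi> powr s = 1 / v"
    by (simp_all add: v_def powr_minus divide_inverse)
  \<comment> \<open>Here u = v, p = 1 / v and q = v^2. Right minus left side, multiplied by v,
    factors as (v + 1)(v^2 - 3 v + 1).\<close>
  have "2 * v + 2 \<le> 1 / v + v\<^sup>2"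
    by (rule stable_cubic_parallelogram[OF \<open>stable_cubic r 11\<close>, of 1 10 2 4 6 7 0])
      (use v units lines in \<open>simp_all add: vs\<close>)
  then have "(2 * v + 2) * v \<le> (1 / v + v\<^sup>2) * v" using v by (intro mult_right_mono) auto
  also have "(1 / v + v\<^sup>2) * v = 1 + v * v * v" using v by (simp add: field_simps power2_eq_square)
  finally have "0 \<le> (v + 1) * (v\<^sup>2 - 3 * v + 1)" by (simp add: algebra_simps power2_eq_square)
  then have q: "0 \<le> v\<^sup>2 - 3 * v + 1" using v by (simp add: zero_le_mult_iff)
  \<comment> \<open>The roots of v^2 - 3 v + 1 are \<phi>^2 and \<phi>^(-2). Nonnegativity keeps v
    out of the open interval between them, while |s| <= 2 keeps it in the closed one.\<close>
  define w where "w = ?\<phi>\<^sup>2"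
  have w: "w * w = 3 * w - 1" "1 < w" unfolding w_def using p golden_ratio_props(1)
    by (simp_all add: power2_eq_square algebra_simps)
  have w': "w = ?\<phi> powr 2" "1 / w = ?\<phi> powr (- 2)" using p by (simp_all add: w_def powr_minus divide_inverse)
  have "w * (v\<^sup>2 - 3 * v + 1) = (w * v - 1) * (v - w)"
  proof -
    have "w * (v\<^sup>2 - 3 * v + 1) - (w * v - 1) * (v - w) = v * (w * w - (3 * w - 1))"
      by (simp add: power2_eq_square algebra_simps)
    then show ?thesis using w(1) by simp
  qed
  moreover have "0 \<le> w * (v\<^sup>2 - 3 * v + 1)" using q w(2) by (intro mult_nonneg_nonneg) auto
  ultimately have "0 \<le> (w * v - 1) * (v - w)" by simp
  moreover have "v \<le> w" unfolding v_def w'(1) using p s by (intro powr_mono) auto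
  moreover have "1 / w \<le> v" unfolding v_def w'(2) using p s by (intro powr_mono) auto
  then have "1 \<le> w * v" using w(2) by (simp add: field_simps)
  ultimately have "v = w \<or> w * v = 1" by (auto simp: zero_le_mult_iff)
  then have "?\<phi> powr (- s) = ?\<phi> powr 2 \<or> ?\<phi> powr (- s) = ?\<phi> powr (- 2)"
    using w(2) unfolding w'[symmetric] v_def[symmetric] by (auto simp: field_simps)
  then have "- s = 2 \<or> - s = - 2"
    by (simp only: powr_inj[OF p(1) less_imp_neq[OF p(2), symmetric]])
  then show ?thesis by auto
qed

text \<open>For r > 0 put y = \<phi>^(|s| / r). The relation gives y <= 1 + 1 / y, and the positive
  root of y^2 = y + 1 is \<phi>, so |s| / r <= 1. For r = 0 the three terms are distinct unless s =
  0.\<close>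

lemma betsy_ross_rep_bound:
  assumes "betsy_ross_rep s \<in> weak_reps 11 3 betsy_ross_bases (ennreal r)" and r: "0 \<le> r"
  shows "\<bar>s\<bar> \<le> r"
proof -
  let ?\<phi> = golden_ratio
  have p: "0 < ?\<phi>" "1 < ?\<phi>" using golden_ratio_props(2) by simp_all
  have d: "distinct [2, 0, 1, 3, 10 :: nat]" by simp
  have "{2, 1, 3, 10} - {2, 0} = {1, 3, 10 :: nat}" by auto
  then have "plucker_null (ennreal r) (betsy_ross_rep s) {2, 0} {2, 1, 3, 10}"
    using assms(1) unfolding weak_reps_def by simp
  then have "tropical_null (ennreal r) {1, 3, 10 :: nat} (\<lambda>x. if x = 1 then betsy_ross_rep s {2, 0, 1} * betsy_ross_rep s {2, 3, 10}
      else if x = 3 then betsy_ross_rep s {2, 0, 3} * betsy_ross_rep s {2, 1, 10}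
      else betsy_ross_rep s {2, 0, 10} * betsy_ross_rep s {2, 1, 3})"
    by (simp only: plucker_null_three_term[OF d])
  moreover have "{2, 0, 1} = {0, 1, 2 :: nat}" "{2, 0, 3} = {0, 2, 3 :: nat}" "{2, 1, 10} = {1, 2, 10 :: nat}"
    "{2, 0, 10} = {0, 2, 10 :: nat}" "{2, 1, 3} = {1, 2, 3 :: nat}" by auto
  ultimately have null: "tropical_null (ennreal r) {1, 3, 10 :: nat}
      (\<lambda>x. if x = 1 then 1 else if x = 3 then ?\<phi> powr (- s) else ?\<phi> powr s)"
    by (simp only: betsy_ross_rep_values mult_1_left mult_1_right)
  show ?thesis
  proof (cases "r = 0")
    case True
    have "s = 0"
    proof (rule ccontr)
      assume "s \<noteq> 0"
      then have "?\<phi> powr s \<noteq> 1" "?\<phi> powr (- s) \<noteq> 1" "?\<phi> powr s \<noteq> ?\<phi> powr (- s)"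
        using p powr_inj[of ?\<phi> s 0] powr_inj[of ?\<phi> "- s" 0] powr_inj[of ?\<phi> s "- s"] by auto
      then show False using null p unfolding True tropical_null_def Let_def by auto
    qed
    then show ?thesis using True by simp
  next
    case False
    then have r: "0 < r" using r by simp
    define y where "y = ?\<phi> powr (\<bar>s\<bar> / r)"
    have y: "0 < y" using p by (simp add: y_def)
    have sets: "{1, 3, 10} - {3} = {1, 10 :: nat}" "{1, 3, 10} - {10} = {1, 3 :: nat}" by auto
    have ineq: "\<forall>i\<in>{1, 3, 10 :: nat}. (if i = 1 then 1 else if i = 3 then ?\<phi> powr (- s) else ?\<phi> powr s) powr (1 / r)
      \<le> (\<Sum>j\<in>{1, 3, 10} - {i}. (if j = 1 then 1 else if j = 3 then ?\<phi> powr (- s) else ?\<phi> powr s) powr (1 / r))"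
      using null r unfolding tropical_null_def Let_def by (simp add: ennreal_eq_0_iff)
    have pp: "(?\<phi> powr s) powr (1 / r) = ?\<phi> powr (s / r)" "(?\<phi> powr (- s)) powr (1 / r) = ?\<phi> powr (- (s / r))"
      by (simp_all only: powr_powr times_divide_eq_right mult_1_right minus_divide_left)
    have "y \<le> 1 + 1 / y"
    proof (cases "0 \<le> s")
      case True
      have "(?\<phi> powr s) powr (1 / r) \<le> 1 + (?\<phi> powr (- s)) powr (1 / r)"
        using bspec[OF ineq, of 10] unfolding sets by simp
      then show ?thesis unfolding pp y_def using True by (simp add: powr_minus divide_inverse)
    next
      case False
      have "(?\<phi> powr (- s)) powr (1 / r) \<le> 1 + (?\<phi> powr s) powr (1 / r)"
        using bspec[OF ineq, of 3] unfolding sets by simp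
      then show ?thesis unfolding pp y_def using False by (simp add: powr_minus divide_inverse)
    qed
    then have "y * y \<le> (1 + 1 / y) * y" using y by (intro mult_right_mono) auto
    also have "(1 + 1 / y) * y = y + 1" using y by (simp add: field_simps)
    finally have "y * y \<le> y + 1" .
    then have "(y - ?\<phi>) * (y + (?\<phi> - 1)) \<le> 0"
      using golden_ratio_props(1) by (simp add: power2_eq_square algebra_simps)
    moreover have "0 < y + (?\<phi> - 1)" using y p by simp
    ultimately have "y \<le> ?\<phi>" by (simp add: mult_le_0_iff)
    then have "?\<phi> powr (\<bar>s\<bar> / r) \<le> ?\<phi> powr 1" using p by (simp add: y_def)
    then have "\<bar>s\<bar> / r \<le> 1" using p by (simp only: powr_le_cancel_iff)
    then show ?thesis using r by simp
  qed
qed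

lemma weak_reps_normal_form_bound:
  assumes \<rho>: "\<rho> \<in> weak_reps 11 3 betsy_ross_bases q"
  obtains s t where "\<And>i. 0 < t i" "\<rho> = (\<lambda>S. (\<Prod>i\<in>S. t i) * betsy_ross_rep s S)" "ennreal \<bar>s\<bar> \<le> q"
proof -
  obtain s t where st: "\<And>i. 0 < t i" "\<rho> = (\<lambda>S. (\<Prod>i\<in>S. t i) * betsy_ross_rep s S)"
    using weak_reps_normal_form subsetD[OF weak_reps_subset_infinity \<rho>] by blast
  have "ennreal \<bar>s\<bar> \<le> q"
  proof (cases q)
    case (real r)
    have "plucker_null q (betsy_ross_rep s) S1 S2"
      if S: "S1 \<subseteq> {..<11}" "S2 \<subseteq> {..<11}" "card S1 + 1 = 3" "card S2 = 3 + 1" "card (S2 - S1) = 3" for S1 S2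
    proof -
      have "plucker_null q \<rho> S1 S2" using \<rho> S unfolding weak_reps_def by blast
      moreover have "finite S1" "finite S2" using S finite_subset by blast+
      ultimately show ?thesis unfolding st(2)
        using plucker_null_rescale[of S1 S2 t "betsy_ross_rep s" q] st(1) betsy_ross_rep_nonneg by blast
    qed
    then have "betsy_ross_rep s \<in> weak_reps 11 3 betsy_ross_bases q"
      unfolding weak_reps_def using betsy_ross_rep_nonneg betsy_ross_rep_support by blast
    then have "\<bar>s\<bar> \<le> r" using betsy_ross_rep_bound real by blast
    then show ?thesis using real by (simp add: ennreal_leI)
  qed simp
  then show ?thesis using that st by blast
qed

section \<open>Equality of strong and weak representations, and the images of the intervals\<close>

lemma betsy_ross_strong_eq_weak:
  "strong_reps 11 3 betsy_ross_bases q = weak_reps 11 3 betsy_ross_bases q"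
proof (rule antisym[OF strong_reps_subset_weak_reps subsetI])
  fix \<rho> assume "\<rho> \<in> weak_reps 11 3 betsy_ross_bases q"
  then obtain s t where "\<And>i. 0 < t i" "\<rho> = (\<lambda>S. (\<Prod>i\<in>S. t i) * betsy_ross_rep s S)" "ennreal \<bar>s\<bar> \<le> q"
    using weak_reps_normal_form_bound by blast
  then show "\<rho> \<in> strong_reps 11 3 betsy_ross_bases q"
    using strong_reps_rescale[OF betsy_ross_rep_strong] by blast
qed

lemma weak_reps_class:
  assumes "\<rho> \<in> weak_reps 11 3 betsy_ross_bases q"
  obtains s where "rescaling_class 11 \<rho> = betsy_ross_curve s" "ennreal \<bar>s\<bar> \<le> q"
proof -
  obtain s t where "\<And>i. 0 < t i" "\<rho> = (\<lambda>S. (\<Prod>i\<in>S. t i) * betsy_ross_rep s S)" "ennreal \<bar>s\<bar> \<le> q"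
    using weak_reps_normal_form_bound[OF assms] by blast
  then show ?thesis using that rescaling_class_rescale[of t 11 "betsy_ross_rep s"] by (simp add: betsy_ross_curve_eq)
qed

lemma betsy_ross_curve_image:
  assumes "0 \<le> q"
  shows "betsy_ross_curve ` {- q..q} = rescaling_class 11 ` strong_reps 11 3 betsy_ross_bases (ennreal q)"
proof (intro equalityI subsetI)
  fix C assume "C \<in> betsy_ross_curve ` {- q..q}"
  then obtain t where "- q \<le> t" "t \<le> q" and C: "C = betsy_ross_curve t" by auto
  then have t: "\<bar>t\<bar> \<le> q" "C = betsy_ross_curve t" by (simp_all add: abs_le_iff)
  then show "C \<in> rescaling_class 11 ` strong_reps 11 3 betsy_ross_bases (ennreal q)"
    using betsy_ross_rep_strong[of t "ennreal q"] by (auto simp: betsy_ross_curve_eq intro: ennreal_leI)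
next
  fix C assume "C \<in> rescaling_class 11 ` strong_reps 11 3 betsy_ross_bases (ennreal q)"
  then obtain \<rho> where "C = rescaling_class 11 \<rho>" "\<rho> \<in> weak_reps 11 3 betsy_ross_bases (ennreal q)"
    using betsy_ross_strong_eq_weak by blast
  with weak_reps_class obtain s where "C = betsy_ross_curve s" "ennreal \<bar>s\<bar> \<le> ennreal q" by metis
  then show "C \<in> betsy_ross_curve ` {- q..q}" using assms by (auto simp: ennreal_le_iff abs_le_iff)
qed

section \<open>The inverse of the curve and the homeomorphism\<close>

definition betsy_ross_slope :: "(nat set \<Rightarrow> real) \<Rightarrow> real" where
  "betsy_ross_slope \<rho> = ln (\<rho> {0, 2, 10} * \<rho> {1, 2, 3} / (\<rho> {0, 1, 2} * \<rho> {2, 3, 10})) / ln golden_ratio"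

text \<open>Numerator and denominator are two terms of one Pluecker relation and carry the same
  torus factor, which cancels; \<phi>^s remains.\<close>

lemma betsy_ross_slope_rep:
  assumes "\<forall>i<11. 0 < t i"
  shows "betsy_ross_slope (\<lambda>S. (\<Prod>i\<in>S. t i) * betsy_ross_rep s S) = s"
proof -
  have t: "t 0 \<noteq> 0" "t 1 \<noteq> 0" "t 2 \<noteq> 0" "t 3 \<noteq> 0" "t 10 \<noteq> 0"
    using assms by (simp_all add: less_imp_neq[symmetric])
  have "(\<Prod>i\<in>{0, 2, 10}. t i) * 1 * ((\<Prod>i\<in>{1, 2, 3}. t i) * golden_ratio powr s)
    / ((\<Prod>i\<in>{0, 1, 2}. t i) * 1 * ((\<Prod>i\<in>{2, 3, 10}. t i) * 1)) = golden_ratio powr s"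
    using t by (simp add: field_simps)
  then show ?thesis
    unfolding betsy_ross_slope_def betsy_ross_rep_values using golden_ratio_props(2) by (simp add: ln_powr)
qed

lemma homeomorphic_map_betsy_ross_curve:
  "homeomorphic_map euclideanreal (Gr_strong 11 3 betsy_ross_bases \<infinity>) betsy_ross_curve"
proof -
  let ?X = "strong_reps 11 3 betsy_ross_bases \<infinity>"
  let ?Y = "rescaling_quotient 11 ?X"
  \<comment> \<open>The choice of a representative is harmless because the slope is constant on
    classes. Continuity on the quotient then reduces to that of the composite with the class map,
    which is the slope itself.\<close>
  define G where "G = (\<lambda>C. betsy_ross_slope (SOME \<rho>. \<rho> \<in> C))"
  have G: "G (rescaling_class 11 \<rho>) = betsy_ross_slope \<rho>" if \<rho>: "\<rho> \<in> ?X" for \<rho>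
  proof -
    obtain s t where st: "\<And>i. 0 < t i" "\<rho> = (\<lambda>S. (\<Prod>i\<in>S. t i) * betsy_ross_rep s S)"
      using weak_reps_normal_form subsetD[OF strong_reps_subset_weak_reps \<rho>] by blast
    have "(SOME \<rho>'. \<rho>' \<in> rescaling_class 11 \<rho>) \<in> rescaling_class 11 \<rho>"
      using someI[of "\<lambda>\<rho>'. \<rho>' \<in> rescaling_class 11 \<rho>" \<rho>] rescaling_class_self by blast
    then obtain u where u: "\<forall>i<11. 0 < u i" "(SOME \<rho>'. \<rho>' \<in> rescaling_class 11 \<rho>) = (\<lambda>S. (\<Prod>i\<in>S. u i) * \<rho> S)"
      unfolding rescaling_class_def by blast
    have eq: "(\<lambda>S. (\<Prod>i\<in>S. u i) * \<rho> S) = (\<lambda>S. (\<Prod>i\<in>S. u i * t i) * betsy_ross_rep s S)"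
      by (simp add: st(2) prod.distrib mult.assoc)
    have "G (rescaling_class 11 \<rho>) = s" unfolding G_def u(2) eq using u(1) st(1) by (intro betsy_ross_slope_rep) simp
    also have "s = betsy_ross_slope \<rho>" unfolding st(2) using st(1) by (intro betsy_ross_slope_rep[symmetric]) simp
    finally show ?thesis .
  qed
  have slope: "betsy_ross_slope (betsy_ross_rep s) = s" for s
    using betsy_ross_slope_rep[of "\<lambda>_. 1" s] by simp
  have rep: "betsy_ross_rep s \<in> ?X" for s by (rule betsy_ross_rep_strong) simp
  have cont_rep: "continuous_map euclideanreal (top_of_set ?X) betsy_ross_rep"
  proof -
    have "continuous_on UNIV (\<lambda>s. betsy_ross_rep s S)" for S
    proof (cases "S \<in> betsy_ross_bases")
      case True
      then have "betsy_ross_minor S \<noteq> 0" by (simp add: betsy_ross_bases_def)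
      then have "continuous_on UNIV (\<lambda>s. \<bar>betsy_ross_minor S\<bar> powr s)" by (intro continuous_intros) auto
      then show ?thesis using True by (simp add: betsy_ross_rep_def)
    qed (simp add: betsy_ross_rep_def)
    then have "continuous_on UNIV betsy_ross_rep" by (intro continuous_on_coordinatewise_then_product)
    then have "continuous_map euclideanreal euclidean betsy_ross_rep" by simp
    then show ?thesis using rep unfolding continuous_map_in_subtopology by blast
  qed
  have quot: "quotient_map (top_of_set ?X) ?Y (rescaling_class 11)" by (rule quotient_map_rescaling_class)
  have h: "betsy_ross_curve = rescaling_class 11 \<circ> betsy_ross_rep" by (auto simp: betsy_ross_curve_eq)
  have cont_h: "continuous_map euclideanreal ?Y betsy_ross_curve"
    unfolding h by (rule continuous_map_compose[OF cont_rep quotient_imp_continuous_map[OF quot]])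
  have pos: "0 < \<rho> {0, 2, 10} * \<rho> {1, 2, 3} / (\<rho> {0, 1, 2} * \<rho> {2, 3, 10})" if \<rho>: "\<rho> \<in> ?X" for \<rho>
  proof -
    have "0 < \<rho> S" if "S \<in> betsy_ross_bases" for S
      using \<rho> that unfolding strong_reps_def by (auto simp: less_le)
    moreover have base: "S \<in> betsy_ross_bases" if "betsy_ross_rep 0 S \<noteq> 0" for S
      using that betsy_ross_rep_support[of 0] by blast
    have "{0, 2, 10} \<in> betsy_ross_bases" "{1, 2, 3} \<in> betsy_ross_bases"
      "{0, 1, 2} \<in> betsy_ross_bases" "{2, 3, 10} \<in> betsy_ross_bases"
      by (rule base, unfold betsy_ross_rep_values, use golden_ratio_props(2) in simp)+
    ultimately show ?thesis by simp
  qed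
  have coord: "continuous_on ?X (\<lambda>\<rho>. \<rho> S)" for S :: "nat set"
    by (rule continuous_on_subset[OF continuous_on_product_coordinates]) simp
  have lnz: "ln golden_ratio \<noteq> 0" using ln_gt_zero[OF golden_ratio_props(2)] by linarith
  have nz: "\<rho> {0, 1, 2} * \<rho> {2, 3, 10} \<noteq> 0" "\<rho> {0, 2, 10} * \<rho> {1, 2, 3} / (\<rho> {0, 1, 2} * \<rho> {2, 3, 10}) \<noteq> 0"
    if "\<rho> \<in> ?X" for \<rho> using pos[OF that] by auto
  have "continuous_on ?X betsy_ross_slope"
    unfolding betsy_ross_slope_def
    by (intro continuous_intros coord ballI nz lnz)
  then have "continuous_map (top_of_set ?X) euclideanreal betsy_ross_slope" by simp
  then have "continuous_map (top_of_set ?X) euclideanreal (G \<circ> rescaling_class 11)"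
    by (rule continuous_map_eq) (simp add: G)
  then have cont_G: "continuous_map ?Y euclideanreal G"
    using continuous_compose_quotient_map_eq[OF quot] by blast
  have "homeomorphic_maps euclideanreal ?Y betsy_ross_curve G"
    unfolding homeomorphic_maps_def
  proof (intro conjI ballI cont_h cont_G)
    show "G (betsy_ross_curve s) = s" for s
      using G[OF rep[of s]] slope by (simp add: betsy_ross_curve_eq)
    fix C assume "C \<in> topspace ?Y"
    then obtain \<rho> where \<rho>: "\<rho> \<in> ?X" "C = rescaling_class 11 \<rho>" by (auto simp: topspace_rescaling_quotient)
    obtain s where s: "rescaling_class 11 \<rho> = betsy_ross_curve s"
      using weak_reps_class subsetD[OF strong_reps_subset_weak_reps \<rho>(1)] by metis
    show "betsy_ross_curve (G C) = C"
      using G[OF rep[of s]] slope s \<rho>(2) by (simp add: betsy_ross_curve_eq)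
  qed
  then show ?thesis unfolding Gr_strong_def using homeomorphic_map_maps by blast
qed

section \<open>The Lorentzian and the stable classes\<close>

lemma betsy_ross_bases_triples: "S \<in> betsy_ross_bases \<Longrightarrow> S \<subseteq> {..<11} \<and> card S = 3"
  by (simp add: betsy_ross_bases_def)

lemma ex_poly_with_coeff_function:
  assumes "finite B" "\<And>S. S \<in> B \<Longrightarrow> finite S" and supp: "{S. \<rho> S \<noteq> 0} = B"
  obtains f :: real_mpoly where "Poly_Mapping.keys f = indicator_vector ` B" "coeff_function f = \<rho>"
proof -
  define f where "f = (\<Sum>S\<in>B. Poly_Mapping.single (indicator_vector S) (\<rho> S))"
  have look: "Poly_Mapping.lookup f \<alpha> = (\<Sum>S\<in>B. if indicator_vector S = \<alpha> then \<rho> S else 0)" for \<alpha>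
    by (simp add: f_def lookup_sum lookup_single when_def)
  have lookS: "Poly_Mapping.lookup f (indicator_vector T) = \<rho> T" if "finite T" for T
  proof -
    have "Poly_Mapping.lookup f (indicator_vector T) = (\<Sum>S\<in>B. if S = T then \<rho> S else 0)"
      unfolding look using assms(2) that by (intro sum.cong refl) (simp add: indicator_vector_eq_iff)
    also have "\<dots> = \<rho> T" using assms(1) supp by auto
    finally show ?thesis .
  qed
  have "Poly_Mapping.keys f = indicator_vector ` B"
  proof (intro equalityI subsetI)
    fix \<alpha> assume "\<alpha> \<in> Poly_Mapping.keys f"
    then have "(\<Sum>S\<in>B. if indicator_vector S = \<alpha> then \<rho> S else 0) \<noteq> 0" by (simp add: in_keys_iff look)
    then obtain S where "S \<in> B" "(if indicator_vector S = \<alpha> then \<rho> S else 0) \<noteq> 0"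
        by (rule sum.not_neutral_contains_not_neutral)
    then show "\<alpha> \<in> indicator_vector ` B" by (auto split: if_splits)
  next
    fix \<alpha> assume "\<alpha> \<in> indicator_vector ` B"
    then obtain S where "S \<in> B" "\<alpha> = indicator_vector S" by blast
    then show "\<alpha> \<in> Poly_Mapping.keys f" using lookS[of S] assms(2) supp by (auto simp: in_keys_iff)
  qed
  moreover have "coeff_function f = \<rho>"
    using lookS assms(2) supp by (auto simp: coeff_function_def fun_eq_iff)
  ultimately show ?thesis using that by blast
qed

lemma betsy_ross_poly:
  obtains f :: real_mpoly where "Poly_Mapping.keys f = indicator_vector ` betsy_ross_bases"
    "coeff_function f = betsy_ross_rep t" "\<And>\<alpha>. 0 \<le> Poly_Mapping.lookup f \<alpha>"
proof -
  have "betsy_ross_bases \<subseteq> Pow {..<11}" using betsy_ross_bases_triples by blast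
  then have fin: "finite betsy_ross_bases" "\<And>S. S \<in> betsy_ross_bases \<Longrightarrow> finite S"
    using finite_subset by (blast intro: finite_Pow_iff[THEN iffD2])+
  obtain f :: real_mpoly where f: "Poly_Mapping.keys f = indicator_vector ` betsy_ross_bases"
    "coeff_function f = betsy_ross_rep t"
    using ex_poly_with_coeff_function[OF fin betsy_ross_rep_support] by blast
  have "0 \<le> Poly_Mapping.lookup f \<alpha>" for \<alpha>
  proof (cases "\<alpha> \<in> Poly_Mapping.keys f")
    case True
    then obtain S where S: "S \<in> betsy_ross_bases" "\<alpha> = indicator_vector S" unfolding f(1) by blast
    then have "Poly_Mapping.lookup f \<alpha> = coeff_function f S" using fin(2) by (simp add: coeff_function_def)
    then show ?thesis unfolding f(2) using betsy_ross_rep_nonneg by simp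
  qed (simp add: in_keys_iff)
  then show ?thesis using that f by blast
qed

text \<open>At exponent 0 the representation is the indicator of the bases. In the 0-null relation
  for \<open>S - {i}\<close> and \<open>insert i T\<close> the term at i is positive, so the maximum
  is attained at a second index, and that index is the exchange partner.\<close>

lemma betsy_ross_bases_exchange:
  assumes "S \<in> betsy_ross_bases" "T \<in> betsy_ross_bases" "i \<in> S - T"
  shows "\<exists>j\<in>T - S. insert j (S - {i}) \<in> betsy_ross_bases"
proof -
  let ?\<rho> = "betsy_ross_rep 0"
  have S: "S \<subseteq> {..<11}" "card S = 3" and T: "T \<subseteq> {..<11}" "card T = 3"
    using assms betsy_ross_bases_triples by auto
  have fin: "finite S" "finite T" using S T finite_subset by blast+
  have "?\<rho> \<in> strong_reps 11 3 betsy_ross_bases 0" by (rule betsy_ross_rep_strong) simp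
  moreover have "S - {i} \<subseteq> {..<11}" "insert i T \<subseteq> {..<11}" "card (S - {i}) + 1 = 3" "card (insert i T) = 3 + 1"
    using S T assms(3) fin by auto
  ultimately have "plucker_null 0 ?\<rho> (S - {i}) (insert i T)" unfolding strong_reps_def by blast
  moreover define I where "I = insert i T - (S - {i})"
  moreover define b where "b = (\<lambda>x. ?\<rho> (insert x (S - {i})) * ?\<rho> (insert i T - {x}))"
  ultimately have null: "tropical_null 0 I b" unfolding plucker_null_def by simp
  have pos: "0 < ?\<rho> S" if "S \<in> betsy_ross_bases" for S
    using that by (simp add: betsy_ross_rep_def betsy_ross_bases_def)
  have i: "i \<in> I" by (simp add: I_def)
  have "insert i (S - {i}) = S" "insert i T - {i} = T" using assms(3) by auto
  then have bi: "0 < b i" using pos[OF assms(1)] pos[OF assms(2)] by (simp add: b_def)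
  have "\<not> (\<forall>x\<in>I. b x = 0)" using bspec[OF _ i, of "\<lambda>x. b x = 0"] bi by linarith
  with null have "\<exists>x\<in>I. \<exists>y\<in>I. x \<noteq> y \<and> b x = b y \<and> (\<forall>k\<in>I. b k \<le> b x)"
    unfolding tropical_null_def Let_def by simp
  then obtain x y where xy: "x \<in> I" "y \<in> I" "x \<noteq> y" "b x = b y" "b i \<le> b x" using i by blast
  define j where "j = (if x = i then y else x)"
  have j: "j \<noteq> i" "j \<in> I" "0 < b j" using xy bi by (simp_all add: j_def)
  have "insert j (S - {i}) \<in> betsy_ross_bases"
  proof (rule ccontr)
    assume "\<not> ?thesis"
    then have "b j = 0" by (simp add: b_def betsy_ross_rep_def)
    with j(3) show False by simp
  qed
  then show ?thesis using j(1,2) by (intro bexI[of _ j]) (auto simp: I_def)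
qed

lemma betsy_ross_rep_quadratic:
  assumes "\<bar>t\<bar> \<le> 2" "i < 11"
  shows "\<exists>l. \<forall>x. (\<Sum>j<11. \<Sum>k<11. contraction_matrix (betsy_ross_rep t) i j k * x j * x k) \<le> (\<Sum>j<11. l j * x j)\<^sup>2"
proof -
  have *: "\<exists>V s. 0 \<le> s \<and> s \<le> 2 \<and> (\<forall>S. S \<subseteq> {..<11} \<longrightarrow> betsy_ross_rep t S = abs_minor V S powr s)"
  proof (cases "0 \<le> t")
    case True
    then show ?thesis using assms(1) betsy_ross_rep_eq[unfolded betsy_ross_abs_def]
      by (intro exI[of _ "betsy_ross_vec golden_ratio"] exI[of _ t]) auto
  next
    case False
    then show ?thesis using assms(1) betsy_ross_rep_eq_conjugate[unfolded betsy_ross_abs_conjugate_def]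
      by (intro exI[of _ "betsy_ross_vec (1 - golden_ratio)"] exI[of _ "- t"]) auto
  qed
  then obtain V s where s: "0 \<le> s" "s \<le> 2"
    and rep: "\<And>S. S \<subseteq> {..<11} \<Longrightarrow> betsy_ross_rep t S = abs_minor V S powr s" by blast
  have "contraction_matrix (betsy_ross_rep t) i j k = \<bar>det3 V i j k\<bar> powr s" if "j < 11" "k < 11" for j k
  proof (cases "i \<noteq> j \<and> i \<noteq> k \<and> j \<noteq> k")
    case True
    then show ?thesis using that assms(2) by (simp add: contraction_matrix_def rep abs_minor_triple)
  next
    case False
    then show ?thesis by (auto simp: contraction_matrix_def card_insert_if)
  qed
  then show ?thesis using abs_det3_powr_lorentzian[OF s, where V = V and i = i and n = 11] by simp
qed

lemma betsy_ross_lorentzian_classes: "betsy_ross_curve ` {- 2..2} = lorentzian_classes 11 betsy_ross_bases"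
proof (intro equalityI subsetI)
  fix C assume "C \<in> betsy_ross_curve ` {- 2..2}"
  then obtain t where "- 2 \<le> t" "t \<le> 2" and C: "C = betsy_ross_curve t" by auto
  then have t: "\<bar>t\<bar> \<le> 2" "C = betsy_ross_curve t" by (simp_all add: abs_le_iff)
  obtain f where f: "Poly_Mapping.keys f = indicator_vector ` betsy_ross_bases"
    "coeff_function f = betsy_ross_rep t" "\<And>\<alpha>. 0 \<le> Poly_Mapping.lookup f \<alpha>"
    using betsy_ross_poly by blast
  have "betsy_ross_bases \<noteq> {}" using betsy_ross_frame_bases unfolding betsy_ross_frame_def by auto
  then have "lorentzian 11 f"
    using betsy_ross_bases_exchange betsy_ross_rep_quadratic[OF t(1)]
    by (intro lorentzianI[OF betsy_ross_bases_triples f(1,3)]) (simp_all add: f(2))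
  then show "C \<in> lorentzian_classes 11 betsy_ross_bases"
    unfolding lorentzian_classes_def lorentzian_polys_def t(2) betsy_ross_curve_eq using f by force
next
  fix C assume "C \<in> lorentzian_classes 11 betsy_ross_bases"
  then obtain f where f: "f \<in> lorentzian_polys 11 betsy_ross_bases" "C = rescaling_class 11 (coeff_function f)"
    by (auto simp: lorentzian_classes_def)
  have "coeff_function f \<in> weak_reps 11 3 betsy_ross_bases 2"
    by (rule coeff_function_lorentzian_weak_reps[OF betsy_ross_bases_triples f(1)])
  then obtain s where "C = betsy_ross_curve s" "ennreal \<bar>s\<bar> \<le> 2" using weak_reps_class f(2) by metis
  moreover from this(2) have "\<bar>s\<bar> \<le> 2" using ennreal_le_iff[of 2 "\<bar>s\<bar>"] by simp
  ultimately show "C \<in> betsy_ross_curve ` {- 2..2}" by (auto simp: abs_le_iff)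
qed

lemma betsy_ross_rep_2_stable: "stable_cubic (betsy_ross_rep 2) 11" "stable_cubic (betsy_ross_rep (- 2)) 11"
proof -
  have eq: "stable_cubic (betsy_ross_rep t) 11"
    if "\<And>S. S \<subseteq> {..<11} \<Longrightarrow> betsy_ross_rep t S = abs_minor V S powr 2" "det3 V 0 1 2 \<noteq> 0" for V t
  proof -
    have "betsy_ross_rep t S = (abs_minor V S)\<^sup>2" if "S \<subseteq> {..<11}" for S
      unfolding \<open>\<And>S. S \<subseteq> {..<11} \<Longrightarrow> betsy_ross_rep t S = abs_minor V S powr 2\<close>[OF that]
      by (simp add: abs_minor_def Let_def powr_numeral)
    then have "cubic (betsy_ross_rep t) 11 z = cubic (\<lambda>S. (abs_minor V S)\<^sup>2) 11 z" for z
      unfolding cubic_def by (intro subset_sum_cong) simp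
    then show ?thesis using stable_cubic_abs_minor_squared[of 0 11 1 2 V] that(2)
      unfolding stable_cubic_def by simp
  qed
  have ne: "abs_minor V {0, 1, 2} \<noteq> 0 \<Longrightarrow> det3 V 0 1 2 \<noteq> 0" for V
    by (simp add: abs_minor_triple)
  show "stable_cubic (betsy_ross_rep 2) 11"
  proof (rule eq)
    show "betsy_ross_rep 2 S = abs_minor (betsy_ross_vec golden_ratio) S powr 2" if "S \<subseteq> {..<11}" for S
      using betsy_ross_rep_eq[OF that] by (simp only: betsy_ross_abs_def)
    from this[of "{0, 1, 2}"] show "det3 (betsy_ross_vec golden_ratio) 0 1 2 \<noteq> 0"
      unfolding betsy_ross_rep_values by (intro ne) auto
  qed
  show "stable_cubic (betsy_ross_rep (- 2)) 11"
  proof (rule eq)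
    show "betsy_ross_rep (- 2) S = abs_minor (betsy_ross_vec (1 - golden_ratio)) S powr 2" if "S \<subseteq> {..<11}" for S
      using betsy_ross_rep_eq_conjugate[OF that, of "- 2"] by (simp only: betsy_ross_abs_conjugate_def minus_minus)
    from this[of "{0, 1, 2}"] show "det3 (betsy_ross_vec (1 - golden_ratio)) 0 1 2 \<noteq> 0"
      unfolding betsy_ross_rep_values by (intro ne) auto
  qed
qed

lemma betsy_ross_stable_classes: "betsy_ross_curve ` {- 2, 2} = stable_classes 11 betsy_ross_bases"
proof (intro equalityI subsetI)
  fix C assume "C \<in> betsy_ross_curve ` {- 2, 2}"
  then consider "C = betsy_ross_curve (- 2)" | "C = betsy_ross_curve 2" by blast
  then obtain t where t: "stable_cubic (betsy_ross_rep t) 11" "C = betsy_ross_curve t"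
    using betsy_ross_rep_2_stable by cases
  obtain f where f: "Poly_Mapping.keys f = indicator_vector ` betsy_ross_bases"
    "coeff_function f = betsy_ross_rep t" "\<And>\<alpha>. 0 \<le> Poly_Mapping.lookup f \<alpha>"
    using betsy_ross_poly by blast
  have "in_variables 11 f"
    unfolding in_variables_def f(1)
  proof
    fix \<alpha> assume "\<alpha> \<in> indicator_vector ` betsy_ross_bases"
    then obtain S where S: "S \<in> betsy_ross_bases" "\<alpha> = indicator_vector S" by blast
    then have sub: "S \<subseteq> {..<11}" using betsy_ross_bases_triples by blast
    then have "finite S" by (rule finite_subset) simp
    then show "Poly_Mapping.keys \<alpha> \<subseteq> {..<11}" using sub by (simp add: S(2) keys_indicator_vector)
  qed
  moreover have "mpoly_eval f z = cubic (betsy_ross_rep t) 11 z" for z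
    unfolding f(2)[symmetric] by (rule mpoly_eval_eq_cubic[OF betsy_ross_bases_triples f(1)])
  ultimately have "stable 11 f"
    using t(1) by (simp add: stable_def stable_cubic_def)
  then have "f \<in> stable_polys 11 betsy_ross_bases"
    by (simp add: stable_polys_def f(1,3))
  then show "C \<in> stable_classes 11 betsy_ross_bases"
    unfolding stable_classes_def t(2) betsy_ross_curve_eq f(2)[symmetric] by (rule imageI)
next
  fix C assume "C \<in> stable_classes 11 betsy_ross_bases"
  then obtain f where f: "f \<in> stable_polys 11 betsy_ross_bases" "C = rescaling_class 11 (coeff_function f)"
    by (auto simp: stable_classes_def)
  have "coeff_function f \<in> weak_reps 11 3 betsy_ross_bases 2"
    by (rule coeff_function_stable_weak_reps[OF betsy_ross_bases_triples f(1)])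
  then obtain s t where t: "\<And>i. 0 < t i" and c: "coeff_function f = (\<lambda>S. (\<Prod>i\<in>S. t i) * betsy_ross_rep s S)"
    and s: "ennreal \<bar>s\<bar> \<le> 2"
    using weak_reps_normal_form_bound by blast
  have "\<bar>s\<bar> \<le> 2" using s ennreal_le_iff[of 2 "\<bar>s\<bar>"] by simp
  have "stable_cubic (coeff_function f) 11"
    by (rule stable_polys_stable_cubic[OF betsy_ross_bases_triples f(1)])
  moreover have "\<forall>i<11. 0 < 1 / t i" using t by simp
  ultimately have "stable_cubic (\<lambda>S. (\<Prod>i\<in>S. 1 / t i) * coeff_function f S) 11"
    by (rule stable_cubic_rescale)
  moreover have "(\<lambda>S. (\<Prod>i\<in>S. 1 / t i) * coeff_function f S) = betsy_ross_rep s"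
  proof
    fix S
    have "0 < (\<Prod>i\<in>S. t i)" using t by (intro prod_pos) simp
    then show "(\<Prod>i\<in>S. 1 / t i) * coeff_function f S = betsy_ross_rep s S"
      unfolding c by (simp add: prod_dividef)
  qed
  ultimately have "s = 2 \<or> s = - 2" using betsy_ross_rep_stable_cubic \<open>\<bar>s\<bar> \<le> 2\<close> by simp
  moreover have "C = betsy_ross_curve s"
    unfolding f(2) c betsy_ross_curve_eq by (rule rescaling_class_rescale[OF t])
  ultimately show "C \<in> betsy_ross_curve ` {- 2, 2}" by auto
qed

theorem theorem5p18:
  shows "(\<forall>q :: ennreal. Gr_strong 11 3 betsy_ross_bases q = Gr_weak 11 3 betsy_ross_bases q) \<and>
    homeomorphic_map euclideanreal (Gr_strong 11 3 betsy_ross_bases \<infinity>) betsy_ross_curve \<and>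
    (\<forall>q :: real. 0 \<le> q \<longrightarrow>
       betsy_ross_curve ` {-q..q} = topspace (Gr_strong 11 3 betsy_ross_bases (ennreal q))) \<and>
    betsy_ross_curve ` {-2..2} = lorentzian_classes 11 betsy_ross_bases \<and>
    betsy_ross_curve ` {-2, 2} = stable_classes 11 betsy_ross_bases"
  using homeomorphic_map_betsy_ross_curve betsy_ross_curve_image betsy_ross_lorentzian_classes
    betsy_ross_stable_classes
  by (simp add: Gr_strong_def Gr_weak_def betsy_ross_strong_eq_weak topspace_rescaling_quotient)

end
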